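(* Let $n\geq 1$ and let $(\mathcal{C},\Sigma,\mathcal{T})$ and $(\mathcal{C}',\Sigma',\mathcal{T}')$ be $(n+2)$-angulated categories. Consider the associated $n$-exangulated categories $(\mathcal{C},\mathbb{E},\mathfrak{s})$ and $(\mathcal{C}',\mathbb{E}',\mathfrak{s}')$, where $\mathbb{E}=\mathbb{E}_{\Sigma}$, $\mathbb{E}'=\mathbb{E}_{\Sigma'}$, and $\mathfrak{s},\mathfrak{s}'$ are the exact realisations induced by $\mathcal{T},\mathcal{T}'$ respectively. Suppose $\mathscr{F}\colon\mathcal{C}\to\mathcal{C}'$ is an additive covariant functor. Then $\mathscr{F}$ is an $(n+2)$-angulated functor if and only if $\mathscr{F}$ is an $n$-exangulated functor.
   Context: Fix an integer $n\geq 1$, an additive category $\mathcal{C}$ and an autoequivalence $\Sigma\colon\mathcal{C}\to\mathcal{C}$. **$(n+2)$-angulated categories.** An $(n+2)$-$\Sigma$-sequence is a sequence of morphisms $X^0\xrightarrow{d_X^0}X^1\xrightarrow{d_X^1}\cdots\xrightarrow{d_X^n}X^{n+1}\xrightarrow{d_X^{n+1}}\Sigma X^0$ in $\mathcal{C}$. A morphism of $(n+2)$-$\Sigma$-sequences from $(X^i,d_X^i)$ to $(Y^i,d_Y^i)$ is a tuple $(f^0,\dots,f^{n+1})$ of morphisms $f^i\colon X^i\to Y^i$ with $f^{i+1}d_X^i=d_Y^if^i$ for $0\leq i\leq n$ and $(\Sigma f^0)d_X^{n+1}=d_Y^{n+1}f^{n+1}$. Let $\mathcal{T}$ be a class of $(n+2)$-$\Sigma$-sequences.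 The triple $(\mathcal{C},\Sigma,\mathcal{T})$ is a weak $(n+2)$-angulated category if: (F1) (a) $\mathcal{T}$ is closed under finite direct sums and direct summands; (b) for each $X\in\mathcal{C}$ the sequence $X\xrightarrow{1_X}X\to 0\to\cdots\to 0\to\Sigma X$ is in $\mathcal{T}$; (c) each morphism $d_X^0$ of $\mathcal{C}$ is the first morphism of some member of $\mathcal{T}$. (F2) $X^0\xrightarrow{d_X^0}\cdots\xrightarrow{d_X^n}X^{n+1}\xrightarrow{d_X^{n+1}}\Sigma X^0$ is in $\mathcal{T}$ if and only if $X^1\xrightarrow{d_X^1}\cdots\xrightarrow{d_X^n}X^{n+1}\xrightarrow{d_X^{n+1}}\Sigma X^0\xrightarrow{(-1)^n\Sigma d_X^0}\Sigma X^1$ is in $\mathcal{T}$. (F3) Given two members $(X^i,d_X^i)$, $(Y^i,d_Y^i)$ of $\mathcal{T}$ and morphisms $f^0\colon X^0\to Y^0$, $f^1\colon X^1\to Y^1$ with $f^1d_X^0=d_Y^0f^0$, there are $f^2,\dots,f^{n+1}$ such that $(f^0,\dots,f^{n+1})$ is a morphism of $(n+2)$-$\Sigma$-sequences. (F4) In (F3), $f^2,\dots,f^{n+1}$ can be chosen so that the cone $X^1\oplus Y^0\xrightarrow{d_C^0}X^2\oplus Y^1\xrightarrow{d_C^1}\cdots\xrightarrow{d_C^n}\Sigma X^0\oplus Y^{n+1}\xrightarrow{d_C^{n+1}}\Sigma X^1\oplus\Sigma Y^0$ lies in $\mathcal{T}$, where $d_C^i=\begin{pmatrix}-d_X^{i+1}&0\\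 f^{i+1}&d_Y^i\end{pmatrix}$, $d_X^{n+2}:=\Sigma d_X^0$, $f^{n+2}:=\Sigma f^0$. It is an $(n+2)$-angulated category if moreover $\Sigma$ is an automorphism of $\mathcal{C}$. Members of $\mathcal{T}$ are called $(n+2)$-angles. **$(n+2)$-angulated functor.** An additive covariant functor $\mathscr{F}\colon\mathcal{C}\to\mathcal{C}'$ between (weak) $(n+2)$-angulated categories is $(n+2)$-angulated if there is a natural isomorphism $\Theta\colon\mathscr{F}\Sigma\Rightarrow\Sigma'\mathscr{F}$ such that for every $(n+2)$-angle $X^0\xrightarrow{d_X^0}\cdots\xrightarrow{d_X^n}X^{n+1}\xrightarrow{d_X^{n+1}}\Sigma X^0$ in $\mathcal{C}$, the sequence $\mathscr{F}X^0\xrightarrow{\mathscr{F}d_X^0}\cdots\xrightarrow{\mathscr{F}d_X^n}\mathscr{F}X^{n+1}\xrightarrow{\Theta_{X^0}\circ\mathscr{F}d_X^{n+1}}\Sigma'\mathscr{F}X^0$ is an $(n+2)$-angle in $\mathcal{C}'$. **Homotopy classes.** For objects $A,C$, let $\mathsf{C}^n_{(A,C)}$ be the category of cochain complexes $X^\bullet$ in $\mathcal{C}$ concentrated in degrees $0,\dots,n+1$ with $X^0=A$, $X^{n+1}=C$, with morphisms the chain maps $f^\bullet$ with $f^0=1_A$, $f^{n+1}=1_C$. Two such morphisms are identified if they are homotopic in the usual sense as chain maps; $X^\bullet,Y^\bullet\in\mathsf{C}^n_{(A,C)}$ are homotopy equivalent if they become isomorphic in the resulting quotient category, and $[X^\bullet]$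 denotes the homotopy equivalence class of $X^\bullet$ in $\mathsf{C}^n_{(A,C)}$. **The $n$-exangulated category of an $(n+2)$-angulated category.** For $(\mathcal{C},\Sigma,\mathcal{T})$ $(n+2)$-angulated, define $\mathbb{E}_\Sigma\colon\mathcal{C}^{\mathrm{op}}\times\mathcal{C}\to\mathsf{Ab}$ by $\mathbb{E}_\Sigma(X^{n+1},X^0)=\mathcal{C}(X^{n+1},\Sigma X^0)$ and $\mathbb{E}_\Sigma(f,g)(\delta)=(\Sigma g)\circ\delta\circ f$ for $f\colon Y^{n+1}\to X^{n+1}$, $g\colon X^0\to Y^0$. For $\delta\in\mathbb{E}_\Sigma(X^{n+1},X^0)$, complete $\delta$ to an $(n+2)$-angle $X^0\to X^1\to\cdots\to X^{n+1}\xrightarrow{\delta}\Sigma X^0$ and set $\mathfrak{s}(\delta)=[X^0\to\cdots\to X^{n+1}]$. It is known that this is well defined and that $(\mathcal{C},\mathbb{E}_\Sigma,\mathfrak{s})$ is an $n$-exangulated category in the sense of Herschend–Liu–Nakaoka. **$n$-exangulated functor.** (Only the underlying data of the $n$-exangulated categories enter this definition.) An additive covariant functor $\mathscr{F}\colon\mathcal{C}\to\mathcal{C}'$ between $n$-exangulated categories $(\mathcal{C},\mathbb{E},\mathfrak{s})$ and $(\mathcal{C}',\mathbb{E}',\mathfrak{s}')$ is $n$-exangulated if there is a natural transformation $\Gamma\colon\mathbb{E}(-,-)\Rightarrow\mathbb{E}'(\mathscr{F}-,\mathscr{F}-)$ of functors $\mathcal{C}^{\mathrm{op}}\times\mathcal{C}\to\mathsf{Ab}$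 such that $\mathfrak{s}(\delta)=[X^\bullet]$ implies $\mathfrak{s}'(\Gamma_{(X^{n+1},X^0)}(\delta))=[\mathscr{F}_{\mathsf{C}}X^\bullet]$, where $\mathscr{F}_{\mathsf{C}}X^\bullet$ is the complex obtained by applying $\mathscr{F}$ to $X^\bullet$ degreewise. *)

theory Defs
  imports "HOL-Algebra.Group"
begin

section \<open>Categories, functors, natural transformations\<close>

text \<open>Arrows carry their domain and codomain, so hom-sets of distinct pairs of objects are disjoint.
  All predicates below are relativised to the objects and arrows of the category; the values of the
  structure maps elsewhere are irrelevant.\<close>

record ('o, 'm) cat =
  Obj :: "'o set"
  Arr :: "'m set"
  Dom :: "'m \<Rightarrow> 'o"
  Cod :: "'m \<Rightarrow> 'o"
  Idt :: "'o \<Rightarrow> 'm"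
  Comp :: "'m \<Rightarrow> 'm \<Rightarrow> 'm"  (infixl "\<cdot>\<index>" 70)

definition Mor :: "('o, 'm, 'r) cat_scheme \<Rightarrow> 'o \<Rightarrow> 'o \<Rightarrow> 'm set" where
  "Mor C A B = {f \<in> Arr C. Dom C f = A \<and> Cod C f = B}"

locale category =
  fixes C :: "('o, 'm, 'r) cat_scheme" (structure)
  assumes Dom_Obj: "f \<in> Arr C \<Longrightarrow> Dom C f \<in> Obj C"
    and Cod_Obj: "f \<in> Arr C \<Longrightarrow> Cod C f \<in> Obj C"
    and Idt_Mor: "A \<in> Obj C \<Longrightarrow> Idt C A \<in> Mor C A A"
    and Comp_Mor: "f \<in> Mor C A B \<Longrightarrow> g \<in> Mor C B D \<Longrightarrow> g \<cdot> f \<in> Mor C A D"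
    and Comp_Idt: "f \<in> Mor C A B \<Longrightarrow> f \<cdot> Idt C A = f"
    and Idt_Comp: "f \<in> Mor C A B \<Longrightarrow> Idt C B \<cdot> f = f"
    and Comp_assoc:
      "f \<in> Mor C A B \<Longrightarrow> g \<in> Mor C B D \<Longrightarrow> h \<in> Mor C D E \<Longrightarrow> h \<cdot> (g \<cdot> f) = (h \<cdot> g) \<cdot> f"

definition iso_arrow :: "('o, 'm, 'r) cat_scheme \<Rightarrow> 'm \<Rightarrow> bool" where
  "iso_arrow C f \<longleftrightarrow> f \<in> Arr C \<and>
     (\<exists>g \<in> Mor C (Cod C f) (Dom C f).
        g \<cdot>\<^bsub>C\<^esub> f = Idt C (Dom C f) \<and> f \<cdot>\<^bsub>C\<^esub> g = Idt C (Cod C f))"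

record ('o, 'm, 'p, 'q) cat_functor =
  on_obj :: "'o \<Rightarrow> 'p"
  on_arr :: "'m \<Rightarrow> 'q"

definition is_functor ::
  "('o, 'm, 'r) cat_scheme \<Rightarrow> ('p, 'q, 's) cat_scheme \<Rightarrow> ('o, 'm, 'p, 'q) cat_functor \<Rightarrow> bool" where
  "is_functor C D F \<longleftrightarrow>
     (\<forall>A \<in> Obj C. on_obj F A \<in> Obj D) \<and>
     (\<forall>A B. \<forall>f \<in> Mor C A B. on_arr F f \<in> Mor D (on_obj F A) (on_obj F B)) \<and>
     (\<forall>A \<in> Obj C. on_arr F (Idt C A) = Idt D (on_obj F A)) \<and>
     (\<forall>A B E. \<forall>f \<in> Mor C A B. \<forall>g \<in> Mor C B E.
        on_arr F (g \<cdot>\<^bsub>C\<^esub> f) = on_arr F g \<cdot>\<^bsub>D\<^esub> on_arr F f)"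

definition id_functor :: "('o, 'm, 'o, 'm) cat_functor" where
  "id_functor = \<lparr>on_obj = id, on_arr = id\<rparr>"

definition comp_functor ::
  "('p, 'q, 'u, 'v) cat_functor \<Rightarrow> ('o, 'm, 'p, 'q) cat_functor \<Rightarrow> ('o, 'm, 'u, 'v) cat_functor" where
  "comp_functor G F = \<lparr>on_obj = on_obj G \<circ> on_obj F, on_arr = on_arr G \<circ> on_arr F\<rparr>"

definition nat_iso ::
  "('o, 'm, 'r) cat_scheme \<Rightarrow> ('p, 'q, 's) cat_scheme \<Rightarrow>
   ('o, 'm, 'p, 'q) cat_functor \<Rightarrow> ('o, 'm, 'p, 'q) cat_functor \<Rightarrow> ('o \<Rightarrow> 'q) \<Rightarrow> bool" where
  "nat_iso C D F G \<eta> \<longleftrightarrow>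
     (\<forall>A \<in> Obj C. \<eta> A \<in> Mor D (on_obj F A) (on_obj G A) \<and> iso_arrow D (\<eta> A)) \<and>
     (\<forall>A B. \<forall>f \<in> Mor C A B. \<eta> B \<cdot>\<^bsub>D\<^esub> on_arr F f = on_arr G f \<cdot>\<^bsub>D\<^esub> \<eta> A)"

definition autoequivalence ::
  "('o, 'm, 'r) cat_scheme \<Rightarrow> ('o, 'm, 'o, 'm) cat_functor \<Rightarrow> bool" where
  "autoequivalence C S \<longleftrightarrow> is_functor C C S \<and>
     (\<exists>G. is_functor C C G \<and>
       (\<exists>\<eta>. nat_iso C C id_functor (comp_functor G S) \<eta>) \<and>
       (\<exists>\<epsilon>. nat_iso C C (comp_functor S G) id_functor \<epsilon>))"

definition automorphism ::
  "('o, 'm, 'r) cat_scheme \<Rightarrow> ('o, 'm, 'o, 'm) cat_functor \<Rightarrow> bool" where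
  "automorphism C S \<longleftrightarrow> is_functor C C S \<and>
     (\<exists>G. is_functor C C G \<and>
       (\<forall>A \<in> Obj C. on_obj G (on_obj S A) = A \<and> on_obj S (on_obj G A) = A) \<and>
       (\<forall>f \<in> Arr C. on_arr G (on_arr S f) = f \<and> on_arr S (on_arr G f) = f))"


section \<open>Additive categories\<close>

record ('o, 'm) addcat = "('o, 'm) cat" +
  Add :: "'m \<Rightarrow> 'm \<Rightarrow> 'm"  (infixl "\<boxplus>\<index>" 65)
  Nul :: "'o \<Rightarrow> 'o \<Rightarrow> 'm"

definition hom_group :: "('o, 'm, 'r) addcat_scheme \<Rightarrow> 'o \<Rightarrow> 'o \<Rightarrow> 'm monoid" where
  "hom_group C A B = \<lparr>carrier = Mor C A B, monoid.mult = Add C, one = Nul C A B\<rparr>"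

definition Neg :: "('o, 'm, 'r) addcat_scheme \<Rightarrow> 'm \<Rightarrow> 'm" where
  "Neg C f = inv\<^bsub>hom_group C (Dom C f) (Cod C f)\<^esub> f"

definition is_zero_object :: "('o, 'm, 'r) cat_scheme \<Rightarrow> 'o \<Rightarrow> bool" where
  "is_zero_object C Z \<longleftrightarrow> Z \<in> Obj C \<and>
     (\<forall>A \<in> Obj C. (\<exists>!f. f \<in> Mor C Z A) \<and> (\<exists>!f. f \<in> Mor C A Z))"

text \<open>\<open>is_biproduct C A B D i j p q\<close>: \<open>D\<close> is a biproduct of \<open>A\<close> and \<open>B\<close>, with inclusions \<open>i, j\<close>
  and projections \<open>p, q\<close>.\<close>

definition is_biproduct ::
  "('o, 'm, 'r) addcat_scheme \<Rightarrow> 'o \<Rightarrow> 'o \<Rightarrow> 'o \<Rightarrow> 'm \<Rightarrow> 'm \<Rightarrow> 'm \<Rightarrow> 'm \<Rightarrow> bool" where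
  "is_biproduct C A B D i j p q \<longleftrightarrow>
     i \<in> Mor C A D \<and> j \<in> Mor C B D \<and> p \<in> Mor C D A \<and> q \<in> Mor C D B \<and>
     p \<cdot>\<^bsub>C\<^esub> i = Idt C A \<and> q \<cdot>\<^bsub>C\<^esub> j = Idt C B \<and>
     p \<cdot>\<^bsub>C\<^esub> j = Nul C B A \<and> q \<cdot>\<^bsub>C\<^esub> i = Nul C A B \<and>
     i \<cdot>\<^bsub>C\<^esub> p \<boxplus>\<^bsub>C\<^esub> j \<cdot>\<^bsub>C\<^esub> q = Idt C D"

locale additive_category = category C
  for C :: "('o, 'm, 'r) addcat_scheme" (structure) +
  assumes hom_comm_group: "A \<in> Obj C \<Longrightarrow> B \<in> Obj C \<Longrightarrow> comm_group (hom_group C A B)"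
    and Comp_Add: "f \<in> Mor C A B \<Longrightarrow> f' \<in> Mor C A B \<Longrightarrow> g \<in> Mor C B D \<Longrightarrow>
      g \<cdot> (f \<boxplus> f') = g \<cdot> f \<boxplus> g \<cdot> f'"
    and Add_Comp: "f \<in> Mor C A B \<Longrightarrow> g \<in> Mor C B D \<Longrightarrow> g' \<in> Mor C B D \<Longrightarrow>
      (g \<boxplus> g') \<cdot> f = g \<cdot> f \<boxplus> g' \<cdot> f"
    and zero_object_exists: "\<exists>Z. is_zero_object C Z"
    and biproduct_exists: "A \<in> Obj C \<Longrightarrow> B \<in> Obj C \<Longrightarrow>
      \<exists>D i j p q. D \<in> Obj C \<and> is_biproduct C A B D i j p q"

definition additive_functor ::
  "('o, 'm, 'r) addcat_scheme \<Rightarrow> ('p, 'q, 's) addcat_scheme \<Rightarrow> ('o, 'm, 'p, 'q) cat_functor \<Rightarrow> bool"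
  where
  "additive_functor C D F \<longleftrightarrow> is_functor C D F \<and>
     (\<forall>A B. \<forall>f \<in> Mor C A B. \<forall>g \<in> Mor C A B.
        on_arr F (f \<boxplus>\<^bsub>C\<^esub> g) = on_arr F f \<boxplus>\<^bsub>D\<^esub> on_arr F g)"


section \<open>Angulated categories\<close>

text \<open>An $(n+2)$-$\Sigma$-sequence is encoded as the list $[d^0, \ldots, d^{n+1}]$ of its morphisms.
  The object $X^i$ is the domain of $d^i$; the suspension $\Sigma$ is called \<open>S\<close>.\<close>

definition sigma_seqs ::
  "nat \<Rightarrow> ('o, 'm, 'r) addcat_scheme \<Rightarrow> ('o, 'm, 'o, 'm) cat_functor \<Rightarrow> 'm list set" where
  "sigma_seqs n C S = {X. length X = n + 2 \<and> set X \<subseteq> Arr C \<and>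
     (\<forall>i \<le> n. Cod C (X ! i) = Dom C (X ! (i + 1))) \<and>
     Cod C (X ! (n + 1)) = on_obj S (Dom C (X ! 0))}"

definition seq_morphism ::
  "nat \<Rightarrow> ('o, 'm, 'r) addcat_scheme \<Rightarrow> ('o, 'm, 'o, 'm) cat_functor \<Rightarrow>
   'm list \<Rightarrow> 'm list \<Rightarrow> 'm list \<Rightarrow> bool" where
  "seq_morphism n C S X Y f \<longleftrightarrow> length f = n + 2 \<and>
     (\<forall>i \<le> n + 1. f ! i \<in> Mor C (Dom C (X ! i)) (Dom C (Y ! i))) \<and>
     (\<forall>i \<le> n. f ! (i + 1) \<cdot>\<^bsub>C\<^esub> X ! i = Y ! i \<cdot>\<^bsub>C\<^esub> f ! i) \<and>
     on_arr S (f ! 0) \<cdot>\<^bsub>C\<^esub> X ! (n + 1) = Y ! (n + 1) \<cdot>\<^bsub>C\<^esub> f ! (n + 1)"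

text \<open>\<open>Z\<close> is a direct sum of \<open>X\<close> and \<open>Y\<close> in the category of $(n+2)$-$\Sigma$-sequences. Since this
  is a predicate on \<open>Z\<close>, closure of a class under direct sums or summands includes closure under
  isomorphism.\<close>

definition seq_direct_sum ::
  "nat \<Rightarrow> ('o, 'm, 'r) addcat_scheme \<Rightarrow> ('o, 'm, 'o, 'm) cat_functor \<Rightarrow>
   'm list \<Rightarrow> 'm list \<Rightarrow> 'm list \<Rightarrow> bool" where
  "seq_direct_sum n C S X Y Z \<longleftrightarrow>
     X \<in> sigma_seqs n C S \<and> Y \<in> sigma_seqs n C S \<and> Z \<in> sigma_seqs n C S \<and>
     (\<exists>i j p q. seq_morphism n C S X Z i \<and> seq_morphism n C S Y Z j \<and>
        seq_morphism n C S Z X p \<and> seq_morphism n C S Z Y q \<and>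
        (\<forall>k \<le> n + 1. is_biproduct C (Dom C (X ! k)) (Dom C (Y ! k)) (Dom C (Z ! k))
           (i ! k) (j ! k) (p ! k) (q ! k)))"

text \<open>\<open>trivial_seq n C S A Z\<close> is $A \to A \to Z \to \cdots \to Z \to \Sigma A$ with first morphism the
  identity (\<open>Z\<close> is meant to be a zero object and \<open>n \<ge> 1\<close>).\<close>

definition trivial_seq ::
  "nat \<Rightarrow> ('o, 'm, 'r) addcat_scheme \<Rightarrow> ('o, 'm, 'o, 'm) cat_functor \<Rightarrow> 'o \<Rightarrow> 'o \<Rightarrow> 'm list" where
  "trivial_seq n C S A Z =
     [Idt C A, Nul C A Z] @ replicate (n - 1) (Nul C Z Z) @ [Nul C Z (on_obj S A)]"

definition rotate_seq ::
  "nat \<Rightarrow> ('o, 'm, 'r) addcat_scheme \<Rightarrow> ('o, 'm, 'o, 'm) cat_functor \<Rightarrow> 'm list \<Rightarrow> 'm list" where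
  "rotate_seq n C S X =
     tl X @ [if even n then on_arr S (hd X) else Neg C (on_arr S (hd X))]"

text \<open>\<open>K\<close> is a cone of the morphism \<open>f\<close> from \<open>X\<close> to \<open>Y\<close>: the object $K^k$ is a biproduct of $X^{k+1}$
  and $Y^k$ with inclusions \<open>i k, j k\<close> and projections \<open>p k, q k\<close>, and the matrix of $d_K^k$ is
  expanded along these. Appending the \<open>S\<close>-image of the first entry realises the conventions
  $d_X^{n+2} = \Sigma d_X^0$ and $f^{n+2} = \Sigma f^0$; the conditions on \<open>i (n + 2)\<close> and
  \<open>j (n + 2)\<close> identify $\Sigma X^1 \oplus \Sigma Y^0$ with $\Sigma K^0$.\<close>

definition is_cone ::
  "nat \<Rightarrow> ('o, 'm, 'r) addcat_scheme \<Rightarrow> ('o, 'm, 'o, 'm) cat_functor \<Rightarrow>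
   'm list \<Rightarrow> 'm list \<Rightarrow> 'm list \<Rightarrow> 'm list \<Rightarrow> bool" where
  "is_cone n C S X Y f K \<longleftrightarrow> K \<in> sigma_seqs n C S \<and>
     (let X' = X @ [on_arr S (X ! 0)]; f' = f @ [on_arr S (f ! 0)] in
      \<exists>i j p q. i (n + 2) = on_arr S (i 0) \<and> j (n + 2) = on_arr S (j 0) \<and>
        (\<forall>k \<le> n + 1.
           is_biproduct C (Dom C (X' ! (k + 1))) (Dom C (Y ! k)) (Dom C (K ! k))
             (i k) (j k) (p k) (q k) \<and>
           K ! k = i (k + 1) \<cdot>\<^bsub>C\<^esub> Neg C (X' ! (k + 1)) \<cdot>\<^bsub>C\<^esub> p k
             \<boxplus>\<^bsub>C\<^esub> j (k + 1) \<cdot>\<^bsub>C\<^esub> f' ! (k + 1) \<cdot>\<^bsub>C\<^esub> p k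
             \<boxplus>\<^bsub>C\<^esub> j (k + 1) \<cdot>\<^bsub>C\<^esub> Y ! k \<cdot>\<^bsub>C\<^esub> q k))"

text \<open>Closure under the empty direct sum need not be demanded: a sequence of zero objects is a
  direct summand of any sequence.\<close>

locale weak_angulated_category = additive_category C
  for n :: nat and C :: "('o, 'm, 'r) addcat_scheme" (structure)
    and S :: "('o, 'm, 'o, 'm) cat_functor" and T :: "'m list set" +
  assumes suspension: "autoequivalence C S"
    and angles_subset: "T \<subseteq> sigma_seqs n C S"
    and F1a_sum: "X \<in> T \<Longrightarrow> Y \<in> T \<Longrightarrow> seq_direct_sum n C S X Y W \<Longrightarrow> W \<in> T"
    and F1a_summand: "W \<in> T \<Longrightarrow> seq_direct_sum n C S X Y W \<Longrightarrow> X \<in> T"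
    and F1b: "A \<in> Obj C \<Longrightarrow> is_zero_object C Z \<Longrightarrow> trivial_seq n C S A Z \<in> T"
    and F1c: "d \<in> Arr C \<Longrightarrow> \<exists>X \<in> T. X ! 0 = d"
    and F2: "X \<in> sigma_seqs n C S \<Longrightarrow> X \<in> T \<longleftrightarrow> rotate_seq n C S X \<in> T"
    and F3: "X \<in> T \<Longrightarrow> Y \<in> T \<Longrightarrow>
      f0 \<in> Mor C (Dom C (X ! 0)) (Dom C (Y ! 0)) \<Longrightarrow>
      f1 \<in> Mor C (Dom C (X ! 1)) (Dom C (Y ! 1)) \<Longrightarrow>
      f1 \<cdot> X ! 0 = Y ! 0 \<cdot> f0 \<Longrightarrow>
      \<exists>f. seq_morphism n C S X Y f \<and> f ! 0 = f0 \<and> f ! 1 = f1"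
    and F4: "X \<in> T \<Longrightarrow> Y \<in> T \<Longrightarrow>
      f0 \<in> Mor C (Dom C (X ! 0)) (Dom C (Y ! 0)) \<Longrightarrow>
      f1 \<in> Mor C (Dom C (X ! 1)) (Dom C (Y ! 1)) \<Longrightarrow>
      f1 \<cdot> X ! 0 = Y ! 0 \<cdot> f0 \<Longrightarrow>
      \<exists>f. seq_morphism n C S X Y f \<and> f ! 0 = f0 \<and> f ! 1 = f1 \<and>
        (\<exists>K. is_cone n C S X Y f K \<and> K \<in> T)"

locale angulated_category = weak_angulated_category +
  assumes suspension_automorphism: "automorphism C S"

definition angulated_functor ::
  "('o, 'm, 'r) addcat_scheme \<Rightarrow> ('o, 'm, 'o, 'm) cat_functor \<Rightarrow> 'm list set \<Rightarrow>
   ('p, 'q, 's) addcat_scheme \<Rightarrow> ('p, 'q, 'p, 'q) cat_functor \<Rightarrow> 'q list set \<Rightarrow>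
   ('o, 'm, 'p, 'q) cat_functor \<Rightarrow> bool" where
  "angulated_functor C S T C' S' T' F \<longleftrightarrow> additive_functor C C' F \<and>
     (\<exists>\<Theta>. nat_iso C C' (comp_functor F S) (comp_functor S' F) \<Theta> \<and>
       (\<forall>X \<in> T. map (on_arr F) (butlast X)
          @ [\<Theta> (Dom C (hd X)) \<cdot>\<^bsub>C'\<^esub> on_arr F (last X)] \<in> T'))"


section \<open>Homotopy classes of complexes with fixed ends\<close>

text \<open>A complex concentrated in degrees $0, \ldots, n+1$ is encoded as the list $[d^0, \ldots, d^n]$
  of its differentials.\<close>

definition complexes ::
  "nat \<Rightarrow> ('o, 'm, 'r) addcat_scheme \<Rightarrow> 'o \<Rightarrow> 'o \<Rightarrow> 'm list set" where
  "complexes n C A B = {X. length X = n + 1 \<and> set X \<subseteq> Arr C \<and>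
     Dom C (hd X) = A \<and> Cod C (last X) = B \<and>
     (\<forall>i < n. Cod C (X ! i) = Dom C (X ! (i + 1)) \<and>
        X ! (i + 1) \<cdot>\<^bsub>C\<^esub> X ! i = Nul C (Dom C (X ! i)) (Cod C (X ! (i + 1))))}"

definition cpx_obj :: "('o, 'm, 'r) addcat_scheme \<Rightarrow> 'm list \<Rightarrow> nat \<Rightarrow> 'o" where
  "cpx_obj C X i = (if i < length X then Dom C (X ! i) else Cod C (last X))"

text \<open>Morphisms of $\mathsf{C}^n_{(A,B)}$: chain maps that are the identity in degrees $0$ and $n+1$.\<close>

definition cpx_morphism ::
  "nat \<Rightarrow> ('o, 'm, 'r) addcat_scheme \<Rightarrow> 'o \<Rightarrow> 'o \<Rightarrow> 'm list \<Rightarrow> 'm list \<Rightarrow> 'm list \<Rightarrow> bool" where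
  "cpx_morphism n C A B X Y f \<longleftrightarrow> length f = n + 2 \<and>
     (\<forall>i \<le> n + 1. f ! i \<in> Mor C (cpx_obj C X i) (cpx_obj C Y i)) \<and>
     (\<forall>i \<le> n. f ! (i + 1) \<cdot>\<^bsub>C\<^esub> X ! i = Y ! i \<cdot>\<^bsub>C\<^esub> f ! i) \<and>
     f ! 0 = Idt C A \<and> f ! (n + 1) = Idt C B"

definition cpx_id :: "nat \<Rightarrow> ('o, 'm, 'r) addcat_scheme \<Rightarrow> 'm list \<Rightarrow> 'm list" where
  "cpx_id n C X = map (\<lambda>i. Idt C (cpx_obj C X i)) [0..<n + 2]"

definition cpx_comp :: "('o, 'm, 'r) addcat_scheme \<Rightarrow> 'm list \<Rightarrow> 'm list \<Rightarrow> 'm list" where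
  "cpx_comp C g f = map2 (Comp C) g f"

text \<open>The usual chain homotopy relation; \<open>h ! i\<close> is the component $X^{i+1} \to Y^i$, and the
  components out of degree $0$ and into degree $n+1$ are zero, whereas \<open>h ! 0\<close> and \<open>h ! n\<close>
  are not required to vanish.\<close>

definition homotopic ::
  "nat \<Rightarrow> ('o, 'm, 'r) addcat_scheme \<Rightarrow> 'm list \<Rightarrow> 'm list \<Rightarrow> 'm list \<Rightarrow> 'm list \<Rightarrow> bool" where
  "homotopic n C X Y f g \<longleftrightarrow> (\<exists>h. length h = n + 1 \<and>
     (\<forall>i \<le> n. h ! i \<in> Mor C (cpx_obj C X (i + 1)) (cpx_obj C Y i)) \<and>
     f ! 0 = g ! 0 \<boxplus>\<^bsub>C\<^esub> h ! 0 \<cdot>\<^bsub>C\<^esub> X ! 0 \<and>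
     (\<forall>i. 1 \<le> i \<and> i \<le> n \<longrightarrow>
        f ! i = g ! i \<boxplus>\<^bsub>C\<^esub> (Y ! (i - 1) \<cdot>\<^bsub>C\<^esub> h ! (i - 1) \<boxplus>\<^bsub>C\<^esub> h ! i \<cdot>\<^bsub>C\<^esub> X ! i)) \<and>
     f ! (n + 1) = g ! (n + 1) \<boxplus>\<^bsub>C\<^esub> Y ! n \<cdot>\<^bsub>C\<^esub> h ! n)"

text \<open>Isomorphism in the quotient of $\mathsf{C}^n_{(A,B)}$ by the homotopy relation, spelled out on
  representatives.\<close>

definition homotopy_equivalent ::
  "nat \<Rightarrow> ('o, 'm, 'r) addcat_scheme \<Rightarrow> 'o \<Rightarrow> 'o \<Rightarrow> 'm list \<Rightarrow> 'm list \<Rightarrow> bool" where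
  "homotopy_equivalent n C A B X Y \<longleftrightarrow>
     (\<exists>f g. cpx_morphism n C A B X Y f \<and> cpx_morphism n C A B Y X g \<and>
        homotopic n C X X (cpx_comp C g f) (cpx_id n C X) \<and>
        homotopic n C Y Y (cpx_comp C f g) (cpx_id n C Y))"

definition homotopy_class ::
  "nat \<Rightarrow> ('o, 'm, 'r) addcat_scheme \<Rightarrow> 'o \<Rightarrow> 'o \<Rightarrow> 'm list \<Rightarrow> 'm list set" where
  "homotopy_class n C A B X = {Y \<in> complexes n C A B. homotopy_equivalent n C A B X Y}"


section \<open>Exangulated functors\<close>

text \<open>The data $(\mathbb{E}, \mathfrak{s})$ of an $n$-exangulated category: \<open>Ext E B A\<close> is the abelian
  group $\mathbb{E}(B, A)$, \<open>ExtMap E f g\<close> is $\mathbb{E}(f, g)$, and \<open>Real E B A \<delta>\<close> is the homotopy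
  class $\mathfrak{s}(\delta)$ for $\delta \in \mathbb{E}(B, A)$.\<close>

record ('o, 'm, 'e) exang_data =
  Ext :: "'o \<Rightarrow> 'o \<Rightarrow> 'e monoid"
  ExtMap :: "'m \<Rightarrow> 'm \<Rightarrow> 'e \<Rightarrow> 'e"
  Real :: "'o \<Rightarrow> 'o \<Rightarrow> 'e \<Rightarrow> 'm list set"

definition exangulated_functor ::
  "nat \<Rightarrow> ('o, 'm, 'r) addcat_scheme \<Rightarrow> ('o, 'm, 'e) exang_data \<Rightarrow>
   ('p, 'q, 's) addcat_scheme \<Rightarrow> ('p, 'q, 'e') exang_data \<Rightarrow>
   ('o, 'm, 'p, 'q) cat_functor \<Rightarrow> bool" where
  "exangulated_functor n C E C' E' F \<longleftrightarrow> additive_functor C C' F \<and>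
     (\<exists>\<Gamma>.
       (\<forall>B \<in> Obj C. \<forall>A \<in> Obj C.
          \<Gamma> B A \<in> hom (Ext E B A) (Ext E' (on_obj F B) (on_obj F A))) \<and>
       (\<forall>B \<in> Obj C. \<forall>B' \<in> Obj C. \<forall>A \<in> Obj C. \<forall>A' \<in> Obj C.
          \<forall>f \<in> Mor C B' B. \<forall>g \<in> Mor C A A'. \<forall>\<delta> \<in> carrier (Ext E B A).
            \<Gamma> B' A' (ExtMap E f g \<delta>) = ExtMap E' (on_arr F f) (on_arr F g) (\<Gamma> B A \<delta>)) \<and>
       (\<forall>B \<in> Obj C. \<forall>A \<in> Obj C. \<forall>\<delta> \<in> carrier (Ext E B A). \<forall>X \<in> complexes n C A B.
          Real E B A \<delta> = homotopy_class n C A B X \<longrightarrow>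
          Real E' (on_obj F B) (on_obj F A) (\<Gamma> B A \<delta>)
            = homotopy_class n C' (on_obj F A) (on_obj F B) (map (on_arr F) X)))"

text \<open>The data $(\mathbb{E}_\Sigma, \mathfrak{s})$ induced by an angulated category; the class
  $\mathfrak{s}(\delta)$ is that of an arbitrarily chosen completion of \<open>\<delta>\<close> to an angle.\<close>

definition exang_of_angulated ::
  "nat \<Rightarrow> ('o, 'm, 'r) addcat_scheme \<Rightarrow> ('o, 'm, 'o, 'm) cat_functor \<Rightarrow> 'm list set \<Rightarrow>
   ('o, 'm, 'm) exang_data" where
  "exang_of_angulated n C S T =
     \<lparr>Ext = (\<lambda>B A. hom_group C B (on_obj S A)),
      ExtMap = (\<lambda>f g \<delta>. on_arr S g \<cdot>\<^bsub>C\<^esub> \<delta> \<cdot>\<^bsub>C\<^esub> f),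
      Real = (\<lambda>B A \<delta>. homotopy_class n C A B (SOME X. X @ [\<delta>] \<in> T \<and> Dom C (hd X) = A))\<rparr>"

end

theory Submission
  imports Defs
begin

text \<open>A natural transformation \<open>\<Gamma>\<close> of the bifunctors is, by the Yoneda lemma, the same as a natural
  transformation \<open>\<Theta>\<close> from \<open>F \<Sigma>\<close> to \<open>\<Sigma>' F\<close>, via \<open>\<Gamma> \<delta> = \<Theta> \<circ> F \<delta>\<close>. So the theorem amounts to two
  facts. First, a complex \<open>X\<close> realises \<open>\<delta>\<close> if and only if \<open>X\<close> together with \<open>\<delta>\<close> is an angle: two
  completions of \<open>\<delta>\<close> are homotopy equivalent relative to their ends, and angles are closed under
  such homotopy equivalences. Secondly, \<open>\<Theta>\<close> is invertible, because the image of an angle on an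
  identity of \<open>\<Sigma> A\<close> is an angle that starts and ends with zero differentials.\<close>

section \<open>Additive categories\<close>

text \<open>Equality of homotopy classes says only that \<open>F X\<close> is homotopy equivalent to
  some completion of the image of \<open>\<delta>\<close>, whereas an angulated functor must send
  the angle itself to an angle; this is why closure under homotopy equivalence is the core. Homotopy
  equivalent complexes need not be isomorphic in each degree, so closure under isomorphism does not
  suffice. Instead the second complex is displayed as a retract of the first one plus trivial
  angles, and closure under direct summands is applied. A retract is a summand only if it has a
  complement, and idempotents are not assumed to split; hence every inclusion built on the way is
  accompanied by a biproduct projection. Exactness of angles is drawn from (F3) applied to trivial
  angles, placed in an arbitrary position by undoing rotations. Because \<Sigma> is an automorphism,
  this can be done with equalities of objects and morphisms instead of isomorphisms. The angle
  condition for \<Theta> can be checked before \<Theta> is known to be invertible, so that deducing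
  invertibility from it is not circular.\<close>

lemma MorI: "f \<in> Arr C \<Longrightarrow> Dom C f = A \<Longrightarrow> Cod C f = B \<Longrightarrow> f \<in> Mor C A B"
  by (simp add: Mor_def)

lemma MorE:
  assumes "f \<in> Mor C A B"
  shows "f \<in> Arr C" "Dom C f = A" "Cod C f = B"
  using assms by (simp_all add: Mor_def)

lemma (in category) Arr_Comp [simp]:
  assumes "f \<in> Arr C" "g \<in> Arr C" "Cod C f = Dom C g"
  shows "g \<cdot> f \<in> Arr C" "Dom C (g \<cdot> f) = Dom C f" "Cod C (g \<cdot> f) = Cod C g"
  using Comp_Mor[of f "Dom C f" "Dom C g" g "Cod C g"] assms by (simp_all add: Mor_def)

lemma (in category) Arr_Idt [simp]:
  assumes "A \<in> Obj C"
  shows "Idt C A \<in> Arr C" "Dom C (Idt C A) = A" "Cod C (Idt C A) = A"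
  using Idt_Mor[OF assms] by (simp_all add: Mor_def)

lemma (in category) Obj_Arr [simp]:
  assumes "f \<in> Arr C"
  shows "Dom C f \<in> Obj C" "Cod C f \<in> Obj C"
  using assms by (simp_all add: Dom_Obj Cod_Obj)

lemma (in category) Comp_Idt' [simp]:
  assumes "f \<in> Arr C"
  shows "Dom C f = A \<Longrightarrow> f \<cdot> Idt C A = f" "Cod C f = A \<Longrightarrow> Idt C A \<cdot> f = f"
  using assms by (auto intro: Comp_Idt Idt_Comp simp: Mor_def)

lemma (in category) Comp_assoc':
  assumes "f \<in> Arr C" "g \<in> Arr C" "h \<in> Arr C" "Cod C f = Dom C g" "Cod C g = Dom C h"
  shows "(h \<cdot> g) \<cdot> f = h \<cdot> (g \<cdot> f)"
  using Comp_assoc[of f "Dom C f" "Dom C g" g "Dom C h" h "Cod C h"] assms by (simp add: Mor_def)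

lemma (in category) Mor_Obj:
  assumes "f \<in> Mor C A B"
  shows "A \<in> Obj C" "B \<in> Obj C"
  using MorE[OF assms] Dom_Obj Cod_Obj by auto

context additive_category
begin

abbreviation Sub (infixl "\<boxminus>" 65) where "f \<boxminus> g \<equiv> f \<boxplus> Neg C g"

lemma Arr_Nul [simp]:
  assumes "A \<in> Obj C" "B \<in> Obj C"
  shows "Nul C A B \<in> Arr C" "Dom C (Nul C A B) = A" "Cod C (Nul C A B) = B"
proof -
  interpret comm_group "hom_group C A B" using hom_comm_group[OF assms] .
  show "Nul C A B \<in> Arr C" "Dom C (Nul C A B) = A" "Cod C (Nul C A B) = B"
    using one_closed by (auto simp: hom_group_def Mor_def)
qed

lemma Arr_Add [simp]:
  assumes "f \<in> Arr C" "g \<in> Arr C" "Dom C g = Dom C f" "Cod C g = Cod C f"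
  shows "f \<boxplus> g \<in> Arr C" "Dom C (f \<boxplus> g) = Dom C f" "Cod C (f \<boxplus> g) = Cod C f"
proof -
  interpret comm_group "hom_group C (Dom C f) (Cod C f)" using hom_comm_group assms by simp
  show "f \<boxplus> g \<in> Arr C" "Dom C (f \<boxplus> g) = Dom C f" "Cod C (f \<boxplus> g) = Cod C f"
    using m_closed[of f g] assms by (auto simp: hom_group_def Mor_def)
qed

lemma Arr_Neg [simp]:
  assumes "f \<in> Arr C"
  shows "Neg C f \<in> Arr C" "Dom C (Neg C f) = Dom C f" "Cod C (Neg C f) = Cod C f"
    "f \<boxplus> Neg C f = Nul C (Dom C f) (Cod C f)"
proof -
  interpret comm_group "hom_group C (Dom C f) (Cod C f)" using hom_comm_group assms by simp
  show "Neg C f \<in> Arr C" "Dom C (Neg C f) = Dom C f" "Cod C (Neg C f) = Cod C f"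
    "f \<boxplus> Neg C f = Nul C (Dom C f) (Cod C f)"
    using inv_closed[of f] r_inv[of f] assms by (auto simp: hom_group_def Mor_def Neg_def)
qed

lemma Add_assoc:
  assumes "f \<in> Arr C" "g \<in> Arr C" "h \<in> Arr C"
    "Dom C g = Dom C f" "Cod C g = Cod C f" "Dom C h = Dom C f" "Cod C h = Cod C f"
  shows "(f \<boxplus> g) \<boxplus> h = f \<boxplus> (g \<boxplus> h)"
proof -
  interpret comm_group "hom_group C (Dom C f) (Cod C f)" using hom_comm_group assms by simp
  show ?thesis
    using m_assoc[of f g h] assms by (auto simp: hom_group_def Mor_def)
qed

lemma Add_commute:
  assumes "f \<in> Arr C" "g \<in> Arr C" "Dom C g = Dom C f" "Cod C g = Cod C f"
  shows "f \<boxplus> g = g \<boxplus> f"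
proof -
  interpret comm_group "hom_group C (Dom C f) (Cod C f)" using hom_comm_group assms by simp
  show ?thesis
    using m_comm[of f g] assms by (auto simp: hom_group_def Mor_def)
qed

lemma Add_left_commute:
  assumes "f \<in> Arr C" "g \<in> Arr C" "h \<in> Arr C"
    "Dom C g = Dom C f" "Cod C g = Cod C f" "Dom C h = Dom C f" "Cod C h = Cod C f"
  shows "f \<boxplus> (g \<boxplus> h) = g \<boxplus> (f \<boxplus> h)"
  using Add_assoc[of f g h] Add_assoc[of g f h] Add_commute[of f g] assms by simp

lemma Add_Nul [simp]:
  assumes "f \<in> Arr C" "Dom C f = A" "Cod C f = B"
  shows "f \<boxplus> Nul C A B = f" "Nul C A B \<boxplus> f = f"
proof -
  interpret comm_group "hom_group C A B" using hom_comm_group assms by auto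
  show "f \<boxplus> Nul C A B = f" "Nul C A B \<boxplus> f = f"
    using r_one[of f] l_one[of f] assms by (auto simp: hom_group_def Mor_def)
qed

lemma Neg_Add_self [simp]:
  "f \<in> Arr C \<Longrightarrow> Neg C f \<boxplus> f = Nul C (Dom C f) (Cod C f)"
  using Add_commute[of f "Neg C f"] by simp

lemma Neg_Add_cancel [simp]:
  assumes "f \<in> Arr C" "g \<in> Arr C" "Dom C g = Dom C f" "Cod C g = Cod C f"
  shows "f \<boxplus> (Neg C f \<boxplus> g) = g" "Neg C f \<boxplus> (f \<boxplus> g) = g"
  using assms Add_assoc[of f "Neg C f" g, symmetric] Add_assoc[of "Neg C f" f g, symmetric]
  by simp_all

lemma Add_left_cancel:
  assumes "f \<boxplus> g = f \<boxplus> h" "f \<in> Arr C" "g \<in> Arr C" "h \<in> Arr C"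
    "Dom C g = Dom C f" "Cod C g = Cod C f" "Dom C h = Dom C f" "Cod C h = Cod C f"
  shows "g = h"
  using assms Neg_Add_cancel(2)[of f g] Neg_Add_cancel(2)[of f h] by metis

lemma Neg_unique:
  assumes "f \<in> Arr C" "g \<in> Arr C" "Dom C g = Dom C f" "Cod C g = Cod C f"
    "f \<boxplus> g = Nul C (Dom C f) (Cod C f)"
  shows "g = Neg C f"
  using Add_left_cancel[of f g "Neg C f"] assms by simp

lemma Neg_Neg [simp]: "f \<in> Arr C \<Longrightarrow> Neg C (Neg C f) = f"
  using Neg_unique[of "Neg C f" f] by simp

lemma Neg_Nul [simp]: "A \<in> Obj C \<Longrightarrow> B \<in> Obj C \<Longrightarrow> Neg C (Nul C A B) = Nul C A B"
  using Neg_unique[of "Nul C A B" "Nul C A B"] by simp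

lemma Neg_Add:
  assumes "f \<in> Arr C" "g \<in> Arr C" "Dom C g = Dom C f" "Cod C g = Cod C f"
  shows "Neg C (f \<boxplus> g) = Neg C f \<boxplus> Neg C g"
proof -
  have "(f \<boxplus> g) \<boxplus> (Neg C f \<boxplus> Neg C g) = Nul C (Dom C f) (Cod C f)"
    using assms by (simp add: Add_assoc Add_left_commute[of g "Neg C f" "Neg C g"])
  then show ?thesis
    using Neg_unique[of "f \<boxplus> g" "Neg C f \<boxplus> Neg C g"] assms by simp
qed

lemma distribL:
  assumes "f \<in> Arr C" "f' \<in> Arr C" "g \<in> Arr C"
    "Dom C f' = Dom C f" "Cod C f' = Cod C f" "Cod C f = Dom C g"
  shows "g \<cdot> (f \<boxplus> f') = g \<cdot> f \<boxplus> g \<cdot> f'"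
  using Comp_Add[of f "Dom C f" "Cod C f" f' g "Cod C g"] assms by (simp add: Mor_def)

lemma distribR:
  assumes "g \<in> Arr C" "g' \<in> Arr C" "f \<in> Arr C"
    "Dom C g' = Dom C g" "Cod C g' = Cod C g" "Cod C f = Dom C g"
  shows "(g \<boxplus> g') \<cdot> f = g \<cdot> f \<boxplus> g' \<cdot> f"
  using Add_Comp[of f "Dom C f" "Cod C f" g "Cod C g" g'] assms by (simp add: Mor_def)

lemma idem_Nul:
  assumes "f \<in> Arr C" "f \<boxplus> f = f"
  shows "f = Nul C (Dom C f) (Cod C f)"
  using Add_left_cancel[of f f "Nul C (Dom C f) (Cod C f)"] assms by simp

lemma Comp_Nul [simp]:
  assumes "g \<in> Arr C" "A \<in> Obj C"
  shows "Dom C g = B \<Longrightarrow> g \<cdot> Nul C A B = Nul C A (Cod C g)"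
    "Cod C g = B \<Longrightarrow> Nul C B A \<cdot> g = Nul C (Dom C g) A"
proof -
  show "Dom C g = B \<Longrightarrow> g \<cdot> Nul C A B = Nul C A (Cod C g)"
    using idem_Nul[of "g \<cdot> Nul C A B"] distribL[of "Nul C A B" "Nul C A B" g] assms by auto
  show "Cod C g = B \<Longrightarrow> Nul C B A \<cdot> g = Nul C (Dom C g) A"
    using idem_Nul[of "Nul C B A \<cdot> g"] distribR[of "Nul C B A" "Nul C B A" g] assms by auto
qed

lemma Comp_Neg:
  assumes "f \<in> Arr C" "g \<in> Arr C" "Cod C f = Dom C g"
  shows "g \<cdot> Neg C f = Neg C (g \<cdot> f)" "Neg C g \<cdot> f = Neg C (g \<cdot> f)"
proof -
  show "g \<cdot> Neg C f = Neg C (g \<cdot> f)"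
    using distribL[of f "Neg C f" g] assms by (intro Neg_unique) auto
  show "Neg C g \<cdot> f = Neg C (g \<cdot> f)"
    using distribR[of g "Neg C g" f] assms by (intro Neg_unique) auto
qed

lemma zero_object_Nul:
  assumes "is_zero_object C Z" "f \<in> Arr C" "Dom C f = Z \<or> Cod C f = Z"
  shows "f = Nul C (Dom C f) (Cod C f)"
proof -
  have "f \<in> Mor C (Dom C f) (Cod C f)" "Nul C (Dom C f) (Cod C f) \<in> Mor C (Dom C f) (Cod C f)"
    using assms by (simp_all add: Mor_def)
  moreover have "Dom C f \<in> Obj C" "Cod C f \<in> Obj C"
    using assms by auto
  ultimately show ?thesis
    using assms(1,3) unfolding is_zero_object_def by blast
qed

lemma zero_object_iff:
  "is_zero_object C Z \<longleftrightarrow> Z \<in> Obj C \<and> Idt C Z = Nul C Z Z"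
proof
  assume "is_zero_object C Z"
  then show "Z \<in> Obj C \<and> Idt C Z = Nul C Z Z"
    using zero_object_Nul[of Z "Idt C Z"] by (auto simp: is_zero_object_def)
next
  assume Z: "Z \<in> Obj C \<and> Idt C Z = Nul C Z Z"
  have 1: "f = Nul C Z A" if "f \<in> Mor C Z A" for f A
    using that Z Comp_Idt'(1)[of f Z] Comp_Nul(1)[of f Z Z] by (auto simp: Mor_def)
  have 2: "f = Nul C A Z" if "f \<in> Mor C A Z" for f A
    using that Z Comp_Idt'(2)[of f Z] Comp_Nul(2)[of f Z Z] by (auto simp: Mor_def)
  have "\<exists>!f. f \<in> Mor C Z A" "\<exists>!f. f \<in> Mor C A Z" if "A \<in> Obj C" for A
    using 1[of _ A] 2[of _ A] Z that Arr_Nul[of Z A] Arr_Nul[of A Z] by (metis MorI)+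
  with Z show "is_zero_object C Z"
    by (auto simp: is_zero_object_def)
qed

section \<open>Biproducts and complements of retracts\<close>

lemma biproduct_simps:
  assumes "is_biproduct C A B D i j p q"
  shows "A \<in> Obj C" "B \<in> Obj C" "D \<in> Obj C"
    "i \<in> Arr C" "Dom C i = A" "Cod C i = D"
    "j \<in> Arr C" "Dom C j = B" "Cod C j = D"
    "p \<in> Arr C" "Dom C p = D" "Cod C p = A"
    "q \<in> Arr C" "Dom C q = D" "Cod C q = B"
    "p \<cdot> i = Idt C A" "q \<cdot> j = Idt C B" "p \<cdot> j = Nul C B A" "q \<cdot> i = Nul C A B"
    "i \<cdot> p \<boxplus> j \<cdot> q = Idt C D"
    "f \<in> Arr C \<Longrightarrow> Cod C f = A \<Longrightarrow> p \<cdot> (i \<cdot> f) = f"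
    "f \<in> Arr C \<Longrightarrow> Cod C f = B \<Longrightarrow> q \<cdot> (j \<cdot> f) = f"
    "f \<in> Arr C \<Longrightarrow> Cod C f = B \<Longrightarrow> p \<cdot> (j \<cdot> f) = Nul C (Dom C f) A"
    "f \<in> Arr C \<Longrightarrow> Cod C f = A \<Longrightarrow> q \<cdot> (i \<cdot> f) = Nul C (Dom C f) B"
    "f \<in> Arr C \<Longrightarrow> Cod C f = D \<Longrightarrow> i \<cdot> (p \<cdot> f) \<boxplus> j \<cdot> (q \<cdot> f) = f"
proof -
  have b: "i \<in> Mor C A D" "j \<in> Mor C B D" "p \<in> Mor C D A" "q \<in> Mor C D B"
    "p \<cdot> i = Idt C A" "q \<cdot> j = Idt C B" "p \<cdot> j = Nul C B A" "q \<cdot> i = Nul C A B"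
    "i \<cdot> p \<boxplus> j \<cdot> q = Idt C D"
    using assms by (simp_all add: is_biproduct_def)
  note o = Mor_Obj[OF b(1)] Mor_Obj[OF b(2)]
  note m = MorE[OF b(1)] MorE[OF b(2)] MorE[OF b(3)] MorE[OF b(4)]
  show "A \<in> Obj C" "B \<in> Obj C" "D \<in> Obj C"
    "i \<in> Arr C" "Dom C i = A" "Cod C i = D"
    "j \<in> Arr C" "Dom C j = B" "Cod C j = D"
    "p \<in> Arr C" "Dom C p = D" "Cod C p = A"
    "q \<in> Arr C" "Dom C q = D" "Cod C q = B"
    "p \<cdot> i = Idt C A" "q \<cdot> j = Idt C B" "p \<cdot> j = Nul C B A" "q \<cdot> i = Nul C A B"
    "i \<cdot> p \<boxplus> j \<cdot> q = Idt C D"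
    using b o m by simp_all
  show "p \<cdot> (i \<cdot> f) = f" if "f \<in> Arr C" "Cod C f = A"
    using that m o b Comp_assoc'[of f i p] by simp
  show "q \<cdot> (j \<cdot> f) = f" if "f \<in> Arr C" "Cod C f = B"
    using that m o b Comp_assoc'[of f j q] by simp
  show "p \<cdot> (j \<cdot> f) = Nul C (Dom C f) A" if "f \<in> Arr C" "Cod C f = B"
    using that m o b Comp_assoc'[of f j p] by simp
  show "q \<cdot> (i \<cdot> f) = Nul C (Dom C f) B" if "f \<in> Arr C" "Cod C f = A"
    using that m o b Comp_assoc'[of f i q] by simp
  show "i \<cdot> (p \<cdot> f) \<boxplus> j \<cdot> (q \<cdot> f) = f" if "f \<in> Arr C" "Cod C f = D"
    using that m o b distribR[of "i \<cdot> p" "j \<cdot> q" f] by (simp add: Comp_assoc')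
qed

lemma biproductI:
  assumes "i \<in> Arr C" "Dom C i = A" "Cod C i = D"
    "j \<in> Arr C" "Dom C j = B" "Cod C j = D"
    "p \<in> Arr C" "Dom C p = D" "Cod C p = A"
    "q \<in> Arr C" "Dom C q = D" "Cod C q = B"
    "p \<cdot> i = Idt C A" "q \<cdot> j = Idt C B" "p \<cdot> j = Nul C B A" "q \<cdot> i = Nul C A B"
    "i \<cdot> p \<boxplus> j \<cdot> q = Idt C D"
  shows "is_biproduct C A B D i j p q"
  using assms by (simp add: is_biproduct_def Mor_def)

lemma biproduct_sym: "is_biproduct C A B D i j p q \<Longrightarrow> is_biproduct C B A D j i q p"
  using Add_commute[of "j \<cdot> q" "i \<cdot> p"] by (intro biproductI) (simp_all add: biproduct_simps)

text \<open>Complements add up along a chain: a complement \<open>E\<close> of \<open>A\<close> in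
  \<open>B\<close> and a complement \<open>E'\<close> of \<open>B\<close> in \<open>D\<close>
  combine to the complement \<open>G\<close>, the sum of \<open>E\<close> and \<open>E'\<close>, of
  \<open>A\<close> in \<open>D\<close>. The two long terms are its inclusion and its
  projection.\<close>

lemma biproduct_trans:
  assumes b1: "is_biproduct C A E B a b c q"
    and b2: "is_biproduct C B E' D a' b' d q'"
    and b3: "is_biproduct C E E' G i j r s"
  shows "is_biproduct C A G D (a' \<cdot> a) (a' \<cdot> b \<cdot> r \<boxplus> b' \<cdot> s) (c \<cdot> d) (i \<cdot> q \<cdot> d \<boxplus> j \<cdot> q')"
proof -
  note [simp] = biproduct_simps[OF b1] biproduct_simps[OF b2] biproduct_simps[OF b3]
  have "a' \<cdot> (a \<cdot> (c \<cdot> d)) \<boxplus> a' \<cdot> (b \<cdot> (q \<cdot> d)) = a' \<cdot> d"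
    by (subst distribL[symmetric]) simp_all
  then have 2: "a' \<cdot> (a \<cdot> (c \<cdot> d)) \<boxplus> (a' \<cdot> (b \<cdot> (q \<cdot> d)) \<boxplus> b' \<cdot> q') = Idt C D"
    by (subst Add_assoc[symmetric]) simp_all
  have 3: "r \<cdot> (i \<cdot> (q \<cdot> d) \<boxplus> j \<cdot> q') = q \<cdot> d" "s \<cdot> (i \<cdot> (q \<cdot> d) \<boxplus> j \<cdot> q') = q'"
    by (subst distribL; simp)+
  show ?thesis
    using 2 3
    by (intro biproductI) (simp_all add: Comp_assoc' distribL distribR Add_assoc)
qed

text \<open>Where idempotents need not split, a retraction may fail to have a complement; this
  singles out those that do. The complement is bound existentially because only its existence has to
  survive composition.\<close>

definition split_proj where
  "split_proj A D c \<longleftrightarrow> (\<exists>E a b q. is_biproduct C A E D a b c q)"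

lemma split_proj_Idt:
  assumes "A \<in> Obj C"
  shows "split_proj A A (Idt C A)"
proof -
  obtain Z where Z: "is_zero_object C Z"
    using zero_object_exists by blast
  have "is_biproduct C A Z A (Idt C A) (Nul C Z A) (Idt C A) (Nul C A Z)"
    using Z assms by (intro biproductI) (auto simp: zero_object_iff)
  then show ?thesis
    unfolding split_proj_def by blast
qed

lemma split_proj_biproduct:
  assumes "is_biproduct C A B D i j p q"
  shows "split_proj A D p" "split_proj B D q"
  using assms biproduct_sym[OF assms] unfolding split_proj_def by metis+

lemma split_proj_Comp:
  assumes "split_proj A B c" "split_proj B D d"
  shows "split_proj A D (c \<cdot> d)"
proof -
  obtain E a b q where b1: "is_biproduct C A E B a b c q"
    using assms unfolding split_proj_def by blast
  obtain E' a' b' q' where b2: "is_biproduct C B E' D a' b' d q'"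
    using assms unfolding split_proj_def by blast
  obtain G i j r s where b3: "is_biproduct C E E' G i j r s"
    using biproduct_exists[of E E'] biproduct_simps(2)[OF b1] biproduct_simps(2)[OF b2] by blast
  show ?thesis
    using biproduct_trans[OF b1 b2 b3] unfolding split_proj_def by blast
qed

text \<open>A complement of \<open>c\<close> is also one of \<open>p\<close>, via \<open>1 - i p\<close> and \<open>1 - i c\<close>. Thus the idempotent \<open>i p\<close>
  splits although \<open>C\<close> need not be idempotent complete.\<close>

lemma retract_complement:
  assumes "split_proj A D c" "i \<in> Arr C" "p \<in> Arr C"
    "Cod C i = D" "Dom C i = A" "Dom C p = D" "Cod C p = A"
    "c \<cdot> i = Idt C A" "p \<cdot> i = Idt C A"
  shows "\<exists>E j q. is_biproduct C A E D i j p q"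
proof -
  obtain E a b q where b1: "is_biproduct C A E D a b c q"
    using assms unfolding split_proj_def by blast
  note [simp] = biproduct_simps[OF b1] assms(2-)
  have [simp]: "c \<cdot> (i \<cdot> f) = f" "p \<cdot> (i \<cdot> f) = f" if "f \<in> Arr C" "Cod C f = A" for f
    using that Comp_assoc'[of f i c] Comp_assoc'[of f i p] by simp_all
  \<comment> \<open>Eliminating \<open>b q\<close> as \<open>1 - a c\<close> reduces the last
    biproduct identity to \<open>(1 - i p)(1 - a c)(1 - i c) = 1 - i p\<close>, which follows from
    \<open>c i = p i = 1\<close>.\<close>
  have bq: "b \<cdot> (q \<cdot> f) = f \<boxplus> Neg C (a \<cdot> (c \<cdot> f))" if "f \<in> Arr C" "Cod C f = D" for f
  proof -
    have "f \<boxplus> Neg C (a \<cdot> (c \<cdot> f)) = (a \<cdot> (c \<cdot> f) \<boxplus> b \<cdot> (q \<cdot> f)) \<boxplus> Neg C (a \<cdot> (c \<cdot> f))"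
      using biproduct_simps(25)[OF b1 that] by simp
    also have "\<dots> = b \<cdot> (q \<cdot> f)"
      using that by (subst Add_commute[of "a \<cdot> (c \<cdot> f)"]) (simp_all add: Add_assoc)
    finally show ?thesis
      using that by simp
  qed
  have bq': "b \<cdot> q = Idt C D \<boxplus> Neg C (a \<cdot> c)"
    using bq[of "Idt C D"] by simp
  have "is_biproduct C A E D i (b \<boxminus> i \<cdot> p \<cdot> b) p (q \<boxminus> q \<cdot> i \<cdot> c)"
    by (intro biproductI; simp add: Comp_assoc' distribL distribR Add_assoc Comp_Neg Neg_Add
        del: biproduct_simps(20,25)[OF b1])
      (simp add: bq bq' Comp_assoc' distribL distribR Add_assoc Comp_Neg Neg_Add
          Add_left_commute[of _ "Neg C (i \<cdot> p)"]
        del: biproduct_simps(20,25)[OF b1],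
       simp add: Add_left_commute[of _ "i \<cdot> c"] del: biproduct_simps(20,25)[OF b1],
       simp add: Add_left_commute[of _ "a \<cdot> c"] del: biproduct_simps(20,25)[OF b1])
  then show ?thesis
    by blast
qed

end

section \<open>Additive functors\<close>

lemma functor_Arr:
  assumes "is_functor C D F" "f \<in> Arr C"
  shows "on_arr F f \<in> Arr D" "Dom D (on_arr F f) = on_obj F (Dom C f)"
    "Cod D (on_arr F f) = on_obj F (Cod C f)"
proof -
  have "on_arr F f \<in> Mor D (on_obj F (Dom C f)) (on_obj F (Cod C f))"
    using assms unfolding is_functor_def by (simp add: Mor_def)
  then show "on_arr F f \<in> Arr D" "Dom D (on_arr F f) = on_obj F (Dom C f)"
    "Cod D (on_arr F f) = on_obj F (Cod C f)"
    by (simp_all add: Mor_def)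
qed

lemma functor_Obj: "is_functor C D F \<Longrightarrow> A \<in> Obj C \<Longrightarrow> on_obj F A \<in> Obj D"
  and functor_Idt: "is_functor C D F \<Longrightarrow> A \<in> Obj C \<Longrightarrow> on_arr F (Idt C A) = Idt D (on_obj F A)"
  by (simp_all add: is_functor_def)

lemma functor_Comp:
  assumes "is_functor C D F" "f \<in> Arr C" "g \<in> Arr C" "Cod C f = Dom C g"
  shows "on_arr F (g \<cdot>\<^bsub>C\<^esub> f) = on_arr F g \<cdot>\<^bsub>D\<^esub> on_arr F f"
  using assms unfolding is_functor_def by (auto simp: Mor_def)

locale additive_functor_pair = C: additive_category C + D: additive_category D
  for C :: "('o, 'm, 'r) addcat_scheme" and D :: "('p, 'q, 's) addcat_scheme" +
  fixes F :: "('o, 'm, 'p, 'q) cat_functor"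
  assumes additive: "additive_functor C D F"
begin

lemma is_functor: "is_functor C D F"
  using additive by (simp add: additive_functor_def)

lemmas map_Arr [simp] = functor_Arr[OF is_functor]
lemmas map_Obj [simp] = functor_Obj[OF is_functor]
lemmas map_Idt [simp] = functor_Idt[OF is_functor]

lemma map_Comp [simp]:
  "f \<in> Arr C \<Longrightarrow> g \<in> Arr C \<Longrightarrow> Cod C f = Dom C g \<Longrightarrow>
    on_arr F (g \<cdot>\<^bsub>C\<^esub> f) = on_arr F g \<cdot>\<^bsub>D\<^esub> on_arr F f"
  using functor_Comp[OF is_functor] by blast

lemma map_Add [simp]:
  "f \<in> Arr C \<Longrightarrow> g \<in> Arr C \<Longrightarrow> Dom C g = Dom C f \<Longrightarrow> Cod C g = Cod C f \<Longrightarrow>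
    on_arr F (f \<boxplus>\<^bsub>C\<^esub> g) = on_arr F f \<boxplus>\<^bsub>D\<^esub> on_arr F g"
  using additive by (auto simp: additive_functor_def Mor_def)

lemma map_Nul [simp]:
  assumes "A \<in> Obj C" "B \<in> Obj C"
  shows "on_arr F (Nul C A B) = Nul D (on_obj F A) (on_obj F B)"
  using D.idem_Nul[of "on_arr F (Nul C A B)"] map_Add[of "Nul C A B" "Nul C A B"] assms by simp

lemma map_Neg [simp]:
  assumes "f \<in> Arr C"
  shows "on_arr F (Neg C f) = Neg D (on_arr F f)"
  using D.Neg_unique[of "on_arr F f" "on_arr F (Neg C f)"] map_Add[of f "Neg C f"] assms by simp

lemma map_biproduct:
  assumes "is_biproduct C A B E i j p q"
  shows "is_biproduct D (on_obj F A) (on_obj F B) (on_obj F E)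
    (on_arr F i) (on_arr F j) (on_arr F p) (on_arr F q)"
proof -
  note [simp] = C.biproduct_simps[OF assms]
  have "on_arr F (i \<cdot>\<^bsub>C\<^esub> p \<boxplus>\<^bsub>C\<^esub> j \<cdot>\<^bsub>C\<^esub> q) = Idt D (on_obj F E)"
    by simp
  then have "on_arr F i \<cdot>\<^bsub>D\<^esub> on_arr F p \<boxplus>\<^bsub>D\<^esub> on_arr F j \<cdot>\<^bsub>D\<^esub> on_arr F q = Idt D (on_obj F E)"
    by (subst (asm) map_Add) simp_all
  then show ?thesis
    by (intro D.biproductI) (simp_all flip: map_Comp)
qed

end

text \<open>Fullness, faithfulness and bijectivity on objects of an automorphism force it to preserve
  products, and hence the addition of morphisms.\<close>

lemma (in additive_category) automorphism_additive:
  assumes "automorphism C S"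
  shows "additive_functor C C S"
proof -
  obtain G where S: "is_functor C C S" and G: "is_functor C C G"
    and GS: "\<And>A. A \<in> Obj C \<Longrightarrow> on_obj G (on_obj S A) = A"
    and SG: "\<And>A. A \<in> Obj C \<Longrightarrow> on_obj S (on_obj G A) = A"
    and gs: "\<And>f. f \<in> Arr C \<Longrightarrow> on_arr G (on_arr S f) = f"
    and sg: "\<And>f. f \<in> Arr C \<Longrightarrow> on_arr S (on_arr G f) = f"
    using assms unfolding automorphism_def by auto
  note [simp] = functor_Arr[OF S] functor_Arr[OF G] functor_Obj[OF S] functor_Obj[OF G]
    functor_Idt[OF S] functor_Comp[OF S] GS SG gs sg
  obtain Z where Z: "is_zero_object C Z"
    using zero_object_exists by blast
  then have Zo [simp]: "Z \<in> Obj C"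
    by (simp add: is_zero_object_def)
  \<comment> \<open>Both sides are endomorphisms of the zero object \<open>Z\<close> and hence
    agree. Applying \<open>S\<close> shows that the identity of \<open>S Z\<close> is zero.\<close>
  have "on_arr G (Nul C (on_obj S Z) (on_obj S Z)) = Idt C Z"
    using zero_object_Nul[OF Z, of "Idt C Z"]
      zero_object_Nul[OF Z, of "on_arr G (Nul C (on_obj S Z) (on_obj S Z))"] by simp
  then have "on_arr S (on_arr G (Nul C (on_obj S Z) (on_obj S Z))) = on_arr S (Idt C Z)"
    by simp
  then have SZ: "is_zero_object C (on_obj S Z)"
    by (simp add: zero_object_iff)
  have nul: "on_arr S (Nul C A B) = Nul C (on_obj S A) (on_obj S B)" if "A \<in> Obj C" "B \<in> Obj C" for
      A B
  proof -
    have "on_arr S (Nul C A B) = on_arr S (Nul C Z B \<cdot> Nul C A Z)"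
      using that by simp
    also have "\<dots> = on_arr S (Nul C Z B) \<cdot> on_arr S (Nul C A Z)"
      using that by (subst functor_Comp[OF S]) simp_all
    also have "on_arr S (Nul C A Z) = Nul C (on_obj S A) (on_obj S Z)"
      using zero_object_Nul[OF SZ, of "on_arr S (Nul C A Z)"] that by simp
    finally show ?thesis
      using that by simp
  qed
  have "on_arr S (f \<boxplus> g) = on_arr S f \<boxplus> on_arr S g"
    if [simp]: "f \<in> Arr C" "g \<in> Arr C" "Dom C g = Dom C f" "Cod C g = Cod C f" for f g
  proof -
    define B where "B = Cod C f"
    have [simp]: "Cod C f = B" "Cod C g = B" "B \<in> Obj C"
      by (simp_all add: B_def)
    obtain D i j p q where b: "is_biproduct C B B D i j p q"
      using biproduct_exists[of B B] by auto
    note [simp] = biproduct_simps[OF b]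
    \<comment> \<open>The image of the biproduct is again a biproduct once this endomorphism is the
      identity. Its preimage \<open>h\<close> under \<open>S\<close> satisfies
      \<open>p h = p\<close> and \<open>q h = q\<close>, since these hold after \<open>S\<close>;
      therefore \<open>h\<close> is the identity.\<close>
    define e where "e = on_arr S i \<cdot> on_arr S p \<boxplus> on_arr S j \<cdot> on_arr S q"
    have c: "on_arr S p \<cdot> on_arr S i = Idt C (on_obj S B)" "on_arr S q \<cdot> on_arr S j = Idt C (on_obj
        S B)"
      "on_arr S p \<cdot> on_arr S j = Nul C (on_obj S B) (on_obj S B)"
      "on_arr S q \<cdot> on_arr S i = Nul C (on_obj S B) (on_obj S B)"
      by (simp_all add: nul flip: functor_Comp[OF S])
    have c': "on_arr S p \<cdot> (on_arr S i \<cdot> on_arr S p) = on_arr S p"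
      "on_arr S p \<cdot> (on_arr S j \<cdot> on_arr S q) = Nul C (on_obj S D) (on_obj S B)"
      "on_arr S q \<cdot> (on_arr S j \<cdot> on_arr S q) = on_arr S q"
      "on_arr S q \<cdot> (on_arr S i \<cdot> on_arr S p) = Nul C (on_obj S D) (on_obj S B)"
      using c by (simp_all add: Comp_assoc'[symmetric])
    have e: "e \<in> Arr C" "Dom C e = on_obj S D" "Cod C e = on_obj S D"
      "on_arr S p \<cdot> e = on_arr S p" "on_arr S q \<cdot> e = on_arr S q"
      using c' by (simp_all add: distribL e_def)
    define h where "h = on_arr G e"
    have h: "h \<in> Arr C" "Dom C h = D" "Cod C h = D" "on_arr S h = e"
      using e by (simp_all add: h_def)
    have "on_arr S (p \<cdot> h) = on_arr S p" "on_arr S (q \<cdot> h) = on_arr S q"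
      using e h by simp_all
    then have "p \<cdot> h = p" "q \<cdot> h = q"
      using h gs[of "p \<cdot> h"] gs[of "q \<cdot> h"] by (simp_all del: functor_Comp[OF S])
    then have "h = Idt C D"
      using biproduct_simps(25)[OF b, of h] h by simp
    then have e1: "e = Idt C (on_obj S D)"
      using h by simp
    \<comment> \<open>The sum \<open>f \<boxplus> g\<close> factors as the pairing \<open>?u\<close>
      followed by the codiagonal \<open>?s\<close>. Composites with projections and inclusions
      determine both, and \<open>S\<close> preserves those composites.\<close>
    let ?u = "i \<cdot> f \<boxplus> j \<cdot> g" and ?s = "p \<boxplus> q"
    have u: "p \<cdot> ?u = f" "q \<cdot> ?u = g" "?s \<cdot> i = Idt C B" "?s \<cdot> j = Idt C B" "?s \<cdot> ?u = f \<boxplus> g"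
      by (simp_all add: distribL distribR Add_commute)
    have "on_arr S ?u = on_arr S i \<cdot> on_arr S f \<boxplus> on_arr S j \<cdot> on_arr S g"
    proof -
      have "on_arr S ?u = e \<cdot> on_arr S ?u"
        using e1 by simp
      also have "\<dots> = on_arr S i \<cdot> on_arr S (p \<cdot> ?u) \<boxplus> on_arr S j \<cdot> on_arr S (q \<cdot> ?u)"
        by (simp add: e_def distribR Comp_assoc' del: biproduct_simps(16-25)[OF b])
      finally show ?thesis
        using u by simp
    qed
    moreover have "on_arr S ?s = on_arr S p \<boxplus> on_arr S q"
    proof -
      have "on_arr S ?s = on_arr S ?s \<cdot> e"
        using e1 by simp
      also have "\<dots> = on_arr S (?s \<cdot> i) \<cdot> on_arr S p \<boxplus> on_arr S (?s \<cdot> j) \<cdot> on_arr S q"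
        by (simp add: e_def distribL Comp_assoc' del: biproduct_simps(16-25)[OF b])
      finally show ?thesis
        using u by simp
    qed
    moreover have "on_arr S (f \<boxplus> g) = on_arr S ?s \<cdot> on_arr S ?u"
      using u by (simp flip: functor_Comp[OF S])
    ultimately show ?thesis
      using c by (simp add: distribL distribR flip: Comp_assoc')
  qed
  with S show ?thesis
    by (auto simp: additive_functor_def Mor_def)
qed

section \<open>Angles\<close>

definition tab :: "nat \<Rightarrow> (nat \<Rightarrow> 'a) \<Rightarrow> 'a list" where
  "tab m h = map h [0..<m]"

lemma tab [simp]: "length (tab m h) = m" "k < m \<Longrightarrow> tab m h ! k = h k"
  by (simp_all add: tab_def)

locale angulated = angulated_category n C S T
  for n :: nat and C :: "('o, 'm, 'r) addcat_scheme" (structure)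
    and S :: "('o, 'm, 'o, 'm) cat_functor" and T :: "'m list set" +
  assumes n_pos: "n \<ge> 1"

sublocale angulated \<subseteq> S: additive_functor_pair C C S
  using automorphism_additive[OF suspension_automorphism] by unfold_locales

context angulated
begin

lemma S_inj_Obj: "A \<in> Obj C \<Longrightarrow> B \<in> Obj C \<Longrightarrow> on_obj S A = on_obj S B \<Longrightarrow> A = B"
  and S_inj: "f \<in> Arr C \<Longrightarrow> g \<in> Arr C \<Longrightarrow> on_arr S f = on_arr S g \<Longrightarrow> f = g"
  and S_surj: "f \<in> Arr C \<Longrightarrow> \<exists>g \<in> Arr C. on_arr S g = f"
  using suspension_automorphism functor_Arr unfolding automorphism_def by metis+

lemma zero_object_S:
  assumes "A \<in> Obj C" "is_zero_object C (on_obj S A)"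
  shows "is_zero_object C A"
  using assms S_inj[of "Idt C A" "Nul C A A"] by (simp add: zero_object_iff)

text \<open>The sign \<open>(-1)^n\<close> of the rotation axiom. It is an involution compatible
  with composition and with \<Sigma>, so the parity of \<open>n\<close> never has to be examined
  again.\<close>

definition signed :: "'m \<Rightarrow> 'm" where
  "signed f = (if even n then f else Neg C f)"

lemma signed [simp]:
  assumes "f \<in> Arr C"
  shows "signed f \<in> Arr C" "Dom C (signed f) = Dom C f" "Cod C (signed f) = Cod C f"
    "signed (signed f) = f" "on_arr S (signed f) = signed (on_arr S f)"
  using assms by (simp_all add: signed_def)

lemma signed_Comp [simp]:
  assumes "f \<in> Arr C" "g \<in> Arr C" "Cod C f = Dom C g"
  shows "g \<cdot> signed f = signed (g \<cdot> f)" "signed g \<cdot> f = signed (g \<cdot> f)"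
  using assms by (simp_all add: signed_def Comp_Neg)

lemma signed_inject: "f \<in> Arr C \<Longrightarrow> g \<in> Arr C \<Longrightarrow> signed f = signed g \<Longrightarrow> f = g"
  using signed(4) by metis

lemma signed_Nul [simp]: "A \<in> Obj C \<Longrightarrow> B \<in> Obj C \<Longrightarrow> signed (Nul C A B) = Nul C A B"
  by (simp add: signed_def)

abbreviation "seqs \<equiv> sigma_seqs n C S"
abbreviation "mor \<equiv> seq_morphism n C S"
abbreviation "rot \<equiv> rotate_seq n C S"

section \<open>Sequences, their morphisms, and rotation\<close>

lemma seq:
  assumes "X \<in> seqs"
  shows "length X = Suc (Suc n)"
    "k \<le> Suc n \<Longrightarrow> X ! k \<in> Arr C"
    "k \<le> n \<Longrightarrow> Cod C (X ! k) = Dom C (X ! Suc k)"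
    "Cod C (X ! Suc n) = on_obj S (Dom C (X ! 0))"
  using assms by (auto simp: sigma_seqs_def)

lemma seqI:
  assumes "length X = Suc (Suc n)"
    "\<And>k. k \<le> Suc n \<Longrightarrow> X ! k \<in> Arr C"
    "\<And>k. k \<le> n \<Longrightarrow> Cod C (X ! k) = Dom C (X ! Suc k)"
    "Cod C (X ! Suc n) = on_obj S (Dom C (X ! 0))"
  shows "X \<in> seqs"
  using assms by (auto simp: sigma_seqs_def in_set_conv_nth less_Suc_eq_le)

lemma angle_seq: "X \<in> T \<Longrightarrow> X \<in> seqs"
  using angles_subset by blast

lemma mor:
  assumes "mor X Y f"
  shows "length f = Suc (Suc n)"
    "k \<le> Suc n \<Longrightarrow> f ! k \<in> Arr C" "k \<le> Suc n \<Longrightarrow> Dom C (f ! k) = Dom C (X ! k)"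
    "k \<le> Suc n \<Longrightarrow> Cod C (f ! k) = Dom C (Y ! k)"
    "k \<le> n \<Longrightarrow> f ! Suc k \<cdot> X ! k = Y ! k \<cdot> f ! k"
    "on_arr S (f ! 0) \<cdot> X ! Suc n = Y ! Suc n \<cdot> f ! Suc n"
  using assms by (auto simp: seq_morphism_def Mor_def)

lemma morI:
  assumes "length f = Suc (Suc n)"
    "\<And>k. k \<le> Suc n \<Longrightarrow> f ! k \<in> Arr C" "\<And>k. k \<le> Suc n \<Longrightarrow> Dom C (f ! k) = Dom C (X ! k)"
    "\<And>k. k \<le> Suc n \<Longrightarrow> Cod C (f ! k) = Dom C (Y ! k)"
    "\<And>k. k \<le> n \<Longrightarrow> f ! Suc k \<cdot> X ! k = Y ! k \<cdot> f ! k"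
    "on_arr S (f ! 0) \<cdot> X ! Suc n = Y ! Suc n \<cdot> f ! Suc n"
  shows "mor X Y f"
  using assms by (auto simp: seq_morphism_def Mor_def)

lemma rot_nth:
  assumes "X \<in> seqs"
  shows "k \<le> n \<Longrightarrow> rot X ! k = X ! Suc k" "rot X ! Suc n = signed (on_arr S (X ! 0))"
proof -
  obtain x Y where X: "X = x # Y" "length Y = Suc n"
    using seq(1)[OF assms] by (cases X) auto
  show "k \<le> n \<Longrightarrow> rot X ! k = X ! Suc k" "rot X ! Suc n = signed (on_arr S (X ! 0))"
    using X by (auto simp: rotate_seq_def signed_def nth_append)
qed

lemma rot_seq:
  assumes "X \<in> seqs"
  shows "rot X \<in> seqs"
proof (rule seqI)
  note [simp] = rot_nth[OF assms] seq(2-4)[OF assms]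
  show "length (rot X) = Suc (Suc n)"
    using seq(1)[OF assms] by (simp add: rotate_seq_def)
  show "rot X ! k \<in> Arr C" if "k \<le> Suc n" for k
    using that by (cases "k = Suc n") simp_all
  show "Cod C (rot X ! k) = Dom C (rot X ! Suc k)" if "k \<le> n" for k
    using that by (cases "k = n") simp_all
  show "Cod C (rot X ! Suc n) = on_obj S (Dom C (rot X ! 0))"
    by simp
qed

lemma rot_angle: "X \<in> T \<Longrightarrow> rot X \<in> T"
  using F2 angle_seq by blast

text \<open>The candidate puts the \<Sigma>-preimage of the signed last morphism in front.
  Bijectivity of \<Sigma> on objects and arrows makes its rotation equal to \<open>Y\<close>, not
  just isomorphic to it, so (F2) applies directly.\<close>

lemma unrotate:
  assumes Y: "Y \<in> T"
  obtains X where "X \<in> T" "rot X = Y"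
proof -
  note Ys = angle_seq[OF Y]
  note [simp] = seq[OF Ys]
  obtain x where x: "x \<in> Arr C" "on_arr S x = signed (Y ! Suc n)"
    using S_surj[of "signed (Y ! Suc n)"] by auto
  have "on_obj S (Cod C x) = on_obj S (Dom C (Y ! 0))" "on_obj S (Dom C x) = Dom C (Y ! Suc n)"
    using S.map_Arr(2,3)[OF x(1)] x by simp_all
  then have x': "Cod C x = Dom C (Y ! 0)" "on_obj S (Dom C x) = Dom C (Y ! Suc n)"
    using x by (auto intro: S_inj_Obj)
  let ?X = "x # butlast Y"
  have X: "?X ! 0 = x" "\<And>k. k \<le> n \<Longrightarrow> ?X ! Suc k = Y ! k"
    by (simp_all add: nth_butlast)
  have Xs: "?X \<in> seqs"
  proof (rule seqI)
    show "?X ! k \<in> Arr C" if "k \<le> Suc n" for k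
      using that X x by (cases k) auto
    show "Cod C (?X ! k) = Dom C (?X ! Suc k)" if "k \<le> n" for k
      using that X x' by (cases k) auto
    show "Cod C (?X ! Suc n) = on_obj S (Dom C (?X ! 0))"
      using X x' n_pos by auto
  qed simp
  have "rot ?X = Y"
  proof (rule nth_equalityI)
    show "length (rot ?X) = length Y"
      using seq(1)[OF rot_seq[OF Xs]] by simp
    show "rot ?X ! k = Y ! k" if "k < length (rot ?X)" for k
      using that seq(1)[OF rot_seq[OF Xs]] rot_nth[OF Xs] X x by (cases "k = Suc n") auto
  qed
  moreover have "?X \<in> T"
    using F2[OF Xs] Y calculation by simp
  ultimately show ?thesis
    using that by blast
qed

text \<open>The last component of \<open>f\<close> desuspends to the new first one. The first square
  is the last square of \<open>f\<close> after cancelling the sign and the faithful \<Sigma>; the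
  other squares are only renumbered.\<close>

lemma unrotate_mor:
  assumes X: "X \<in> seqs" and Y: "Y \<in> seqs" and f: "mor (rot X) (rot Y) f"
  obtains g where "mor X Y g" "\<And>k. k \<le> n \<Longrightarrow> g ! Suc k = f ! k" "on_arr S (g ! 0) = f ! Suc n"
proof -
  note [simp] = seq[OF X] seq[OF Y] mor(1-4)[OF f] rot_nth[OF X] rot_nth[OF Y]
  obtain g where g: "g \<in> Arr C" "on_arr S g = f ! Suc n"
    using S_surj[of "f ! Suc n"] by auto
  have "on_obj S (Cod C g) = on_obj S (Dom C (Y ! 0))" "on_obj S (Dom C g) = on_obj S (Dom C (X ! 0))"
    using S.map_Arr(2,3)[OF g(1)] g by simp_all
  then have g': "Cod C g = Dom C (Y ! 0)" "Dom C g = Dom C (X ! 0)"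
    using g by (auto intro: S_inj_Obj)
  let ?g = "g # butlast f"
  have G: "?g ! 0 = g" "\<And>k. k \<le> n \<Longrightarrow> ?g ! Suc k = f ! k"
    by (simp_all add: nth_butlast)
  have "on_arr S (f ! 0) \<cdot> signed (on_arr S (X ! 0)) = signed (on_arr S (Y ! 0)) \<cdot> on_arr S g"
    using mor(6)[OF f] g by simp
  then have "signed (on_arr S (f ! 0 \<cdot> X ! 0)) = signed (on_arr S (Y ! 0 \<cdot> g))"
    using g g' by simp
  then have "f ! 0 \<cdot> X ! 0 = Y ! 0 \<cdot> g"
    using g g' signed_inject[of "on_arr S (f ! 0 \<cdot> X ! 0)" "on_arr S (Y ! 0 \<cdot> g)"]
      S_inj[of "f ! 0 \<cdot> X ! 0" "Y ! 0 \<cdot> g"] by (simp del: S.map_Comp)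
  moreover have "f ! Suc k \<cdot> X ! Suc k = Y ! Suc k \<cdot> f ! k" if "k \<le> n" for k
    using that mor(5)[OF f, of k] by simp
  ultimately have "mor X Y ?g"
  proof (intro morI)
    show "?g ! k \<in> Arr C" "Dom C (?g ! k) = Dom C (X ! k)" "Cod C (?g ! k) = Dom C (Y ! k)"
      if "k \<le> Suc n" for k
      using that G g g' by (cases k; simp)+
    assume a: "f ! 0 \<cdot> X ! 0 = Y ! 0 \<cdot> g" "\<And>k. k \<le> n \<Longrightarrow> f ! Suc k \<cdot> X ! Suc k = Y ! Suc k \<cdot> f ! k"
    show "?g ! Suc k \<cdot> X ! k = Y ! k \<cdot> ?g ! k" if "k \<le> n" for k
      using that G g g' a by (cases k) simp_all
    show "on_arr S (?g ! 0) \<cdot> X ! Suc n = Y ! Suc n \<cdot> ?g ! Suc n"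
      using G g g' a(2)[of n] by simp
  qed simp
  then show ?thesis
    using that G g by metis
qed

text \<open>Rotating both angles \<open>k\<close> times brings the given square to the front, where
  (F3) applies; the morphism found there is then pulled back one rotation at a time. This is why the
  induction varies \<open>X\<close> and \<open>Y\<close>.\<close>

lemma F3_at:
  assumes "X \<in> T" "Y \<in> T" "k \<le> n" "u \<in> Arr C" "Dom C u = Dom C (X ! k)" "Cod C u = Dom C (Y ! k)"
    "v \<in> Arr C" "Dom C v = Dom C (X ! Suc k)" "Cod C v = Dom C (Y ! Suc k)"
    "v \<cdot> X ! k = Y ! k \<cdot> u"
  shows "\<exists>f. mor X Y f \<and> f ! k = u \<and> f ! Suc k = v"
  using assms
proof (induction k arbitrary: X Y)
  case 0
  then show ?case
    using F3[of X Y u v] by (simp add: Mor_def)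
next
  case (Suc k)
  note XY = angle_seq[OF Suc.prems(1)] angle_seq[OF Suc.prems(2)]
  have "Dom C (rot X ! Suc k) = Dom C (X ! Suc (Suc k))" "Dom C (rot Y ! Suc k) = Dom C (Y ! Suc
      (Suc k))"
    using Suc.prems XY by (auto simp: rot_nth)
  then have "\<exists>f. mor (rot X) (rot Y) f \<and> f ! k = u \<and> f ! Suc k = v"
    using Suc.prems XY by (intro Suc.IH rot_angle) (simp_all add: rot_nth)
  then obtain f where "mor (rot X) (rot Y) f" "f ! k = u" "f ! Suc k = v"
    by blast
  then show ?case
    using unrotate_mor[OF XY] Suc.prems(3) by (metis Suc_leD)
qed

text \<open>The square that closes up through \<Sigma> becomes an ordinary square in position
  \<open>n\<close> after one rotation.\<close>

lemma F3_last:
  assumes "X \<in> T" "Y \<in> T" "u \<in> Arr C" "Dom C u = Dom C (X ! Suc n)" "Cod C u = Dom C (Y ! Suc n)"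
    "v \<in> Arr C" "Dom C v = Dom C (X ! 0)" "Cod C v = Dom C (Y ! 0)"
    "on_arr S v \<cdot> X ! Suc n = Y ! Suc n \<cdot> u"
  obtains f where "mor X Y f" "f ! Suc n = u" "f ! 0 = v"
proof -
  note XY = angle_seq[OF assms(1)] angle_seq[OF assms(2)]
  have "\<exists>f. mor (rot X) (rot Y) f \<and> f ! n = u \<and> f ! Suc n = on_arr S v"
    using assms XY by (intro F3_at rot_angle) (simp_all add: rot_nth seq)
  then obtain f where f: "mor (rot X) (rot Y) f" "f ! n = u" "f ! Suc n = on_arr S v"
    by blast
  obtain g where g: "mor X Y g" "\<And>k. k \<le> n \<Longrightarrow> g ! Suc k = f ! k" "on_arr S (g ! 0) = f ! Suc n"
    using unrotate_mor[OF XY f(1)] by blast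
  then have "g ! 0 = v"
    using f assms(6) mor(2)[OF g(1), of 0] S_inj[of "g ! 0" v] by simp
  with g f that show ?thesis
    by simp
qed

section \<open>Trivial angles in every position, and exactness of angles\<close>

lemma trivial_angle:
  assumes "Z \<in> Obj C" "k \<le> n"
  shows "\<exists>U \<in> T. U ! k = Idt C Z \<and>
    (\<forall>i \<le> Suc n. i \<noteq> k \<and> i \<noteq> Suc k \<longrightarrow> is_zero_object C (Dom C (U ! i)))"
  using assms(2)
proof (induction k)
  case 0
  obtain O' where O': "is_zero_object C O'"
    using zero_object_exists by blast
  let ?U = "trivial_seq n C S Z O'"
  have "Dom C (?U ! i) = O'" if "i \<le> Suc n" "i \<noteq> 0" "i \<noteq> 1" for i
  proof -
    obtain l where "i = Suc (Suc l)"
      using \<open>i \<noteq> 0\<close> \<open>i \<noteq> 1\<close> by (metis One_nat_def not0_implies_Suc)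
    then show ?thesis
      using that O' assms(1) by (auto simp: trivial_seq_def nth_append zero_object_iff)
  qed
  then show ?case
    using F1b[OF assms(1) O'] O' by (intro bexI[of _ ?U]) (auto simp: trivial_seq_def)
next
  case (Suc k)
  then obtain V where V: "V \<in> T" "V ! k = Idt C Z"
    "\<And>i. i \<le> Suc n \<Longrightarrow> i \<noteq> k \<Longrightarrow> i \<noteq> Suc k \<Longrightarrow> is_zero_object C (Dom C (V ! i))"
    by auto
  \<comment> \<open>Undoing a rotation pushes the identity one place to the right. The new object in
    degree 0 desuspends the last object of \<open>V\<close>, which is zero because
    \<open>Suc k \<le> n\<close>.\<close>
  obtain U where U: "U \<in> T" "rot U = V"
    using unrotate[OF V(1)] by blast
  note Us = angle_seq[OF U(1)]
  have "is_zero_object C (Dom C (U ! i))" if "i \<le> Suc n" "i \<noteq> Suc k" "i \<noteq> Suc (Suc k)" for i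
  proof (cases i)
    case 0
    have "Dom C (V ! Suc n) = on_obj S (Dom C (U ! 0))"
      using rot_nth(2)[OF Us] seq(2)[OF Us, of 0] seq(3)[OF Us, of n] U by simp
    then show ?thesis
      using 0 V(3)[of "Suc n"] Suc.prems seq(2)[OF Us, of 0]
        zero_object_S[of "Dom C (U ! 0)"] by auto
  next
    case (Suc l)
    then show ?thesis
      using V(3)[of l] rot_nth(1)[OF Us, of l] U that by simp
  qed
  then show ?case
    using U V(2) rot_nth(1)[OF Us, of k] Suc.prems by auto
qed

text \<open>The pair of zero and \<open>u\<close> is a commuting square from \<open>X\<close> to the
  trivial angle whose identity on the codomain of \<open>u\<close> sits in position
  \<open>k + 1\<close>. Extending it to a morphism of angles, the next square reads
  \<open>v d = u\<close>.\<close>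

lemma angle_exact:
  assumes "X \<in> T" "k < n" "u \<in> Arr C" "Dom C u = Dom C (X ! Suc k)"
    "u \<cdot> X ! k = Nul C (Dom C (X ! k)) (Cod C u)"
  obtains v where "v \<in> Arr C" "Dom C v = Dom C (X ! Suc (Suc k))" "Cod C v = Cod C u" "v \<cdot> X ! Suc k
      = u"
proof -
  obtain U where U: "U \<in> T" "U ! Suc k = Idt C (Cod C u)"
    using trivial_angle[of "Cod C u" "Suc k"] assms by auto
  note XU [simp] = seq[OF angle_seq[OF U(1)]] seq[OF angle_seq[OF assms(1)]]
  have UD [simp]: "Dom C (U ! Suc k) = Cod C u" "Cod C (U ! Suc k) = Cod C u"
    using U assms by simp_all
  have "\<exists>f. mor X U f \<and> f ! k = Nul C (Dom C (X ! k)) (Dom C (U ! k)) \<and> f ! Suc k = u"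
    using assms U by (intro F3_at) simp_all
  then obtain f where f: "mor X U f" "f ! Suc k = u"
    by blast
  then show ?thesis
    using that[of "f ! Suc (Suc k)"] mor(2-4)[OF f(1), of "Suc (Suc k)"] mor(5)[OF f(1), of "Suc k"]
      assms U XU(3)[of "Suc k"] by auto
qed

lemma angle_exact_last:
  assumes "X \<in> T" "u \<in> Arr C" "Dom C u = Dom C (X ! Suc n)"
    "u \<cdot> X ! n = Nul C (Dom C (X ! n)) (Cod C u)"
  obtains v where "v \<in> Arr C" "Dom C v = on_obj S (Dom C (X ! 0))" "Cod C v = Cod C u" "v \<cdot> X ! Suc
      n = u"
proof -
  obtain m where m: "n = Suc m"
    using n_pos by (cases n) auto
  note Xs = angle_seq[OF assms(1)]
  have r: "rot X ! m = X ! n" "rot X ! Suc m = X ! Suc n" "rot X ! Suc (Suc m) = signed (on_arr S (X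
      ! 0))"
    using rot_nth[OF Xs] m by simp_all
  have "Dom C (rot X ! Suc (Suc m)) = on_obj S (Dom C (X ! 0))"
    using seq(2)[OF Xs, of 0] r by simp
  then show ?thesis
    using angle_exact[OF rot_angle[OF assms(1)], of m u] assms r m that by (metis lessI)
qed

text \<open>Exactness at \<open>\<Sigma> X^0\<close> is exactness in the last place for the rotated
  angle. The sign that the rotation puts on \<open>\<Sigma> d^0\<close> is moved to
  \<open>v\<close>.\<close>

lemma angle_exact_shift:
  assumes "X \<in> T" "u \<in> Arr C" "Dom C u = on_obj S (Dom C (X ! 0))"
    "u \<cdot> X ! Suc n = Nul C (Dom C (X ! Suc n)) (Cod C u)"
  obtains v where "v \<in> Arr C" "Dom C v = on_obj S (Cod C (X ! 0))" "Cod C v = Cod C u"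
    "v \<cdot> on_arr S (X ! 0) = u"
proof -
  note Xs = angle_seq[OF assms(1)]
  note [simp] = seq[OF Xs]
  have r: "rot X ! n = X ! Suc n" "rot X ! Suc n = signed (on_arr S (X ! 0))" "rot X ! 0 = X ! 1"
    using rot_nth[OF Xs] by simp_all
  have "Dom C u = Dom C (rot X ! Suc n)" "u \<cdot> rot X ! n = Nul C (Dom C (rot X ! n)) (Cod C u)"
    using assms r by simp_all
  from angle_exact_last[OF rot_angle[OF assms(1)] assms(2) this]
  obtain v where v: "v \<in> Arr C" "Dom C v = on_obj S (Dom C (X ! 1))" "Cod C v = Cod C u"
    "v \<cdot> signed (on_arr S (X ! 0)) = u"
    using r by auto
  then show ?thesis
    using that[of "signed v"] by simp
qed

text \<open>The square with components the identity and \<open>X ! k\<close> extends to a morphism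
  from a trivial angle to \<open>X\<close>. Its next component starts at a zero object, and the
  square leading there says that the composite vanishes.\<close>

lemma angle_Comp:
  assumes "X \<in> T" "k \<le> n"
  shows "X ! Suc k \<cdot> X ! k = Nul C (Dom C (X ! k)) (Cod C (X ! Suc k))"
proof -
  note Xs = angle_seq[OF assms(1)]
  obtain U where U: "U \<in> T" "U ! k = Idt C (Dom C (X ! k))"
    "\<And>i. i \<le> Suc n \<Longrightarrow> i \<noteq> k \<Longrightarrow> i \<noteq> Suc k \<Longrightarrow> is_zero_object C (Dom C (U ! i))"
    using trivial_angle[of "Dom C (X ! k)" k] assms seq[OF Xs] by auto
  note Us = angle_seq[OF U(1)]
  note [simp] = seq[OF Xs]
  note XU [simp] = seq[OF Us]
  have UD [simp]: "Dom C (U ! k) = Dom C (X ! k)" "Dom C (U ! Suc k) = Dom C (X ! k)"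
    using U(2) assms XU(3)[of k] by simp_all
  have "\<exists>f. mor U X f \<and> f ! k = Idt C (Dom C (X ! k)) \<and> f ! Suc k = X ! k"
    using assms U by (intro F3_at) simp_all
  then obtain f where f: "mor U X f" "f ! Suc k = X ! k"
    by blast
  note [simp] = mor(2-4)[OF f(1)]
  show ?thesis
  proof (cases "k = n")
    \<comment> \<open>Here the next object is the suspension of degree 0. That degree is zero
      because \<open>n \<ge> 1\<close> keeps it apart from the two degrees \<open>n\<close> and
      \<open>n + 1\<close> carrying the identity.\<close>
    case True
    have "is_zero_object C (Dom C (U ! 0))"
      using U(3)[of 0] True n_pos by simp
    then have "f ! 0 = Nul C (Dom C (U ! 0)) (Dom C (X ! 0))"
      using zero_object_Nul[of _ "f ! 0"] by simp
    then show ?thesis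
      using mor(6)[OF f(1)] f(2) UD(2)[unfolded True] True by simp
  next
    case False
    then have "is_zero_object C (Dom C (U ! Suc (Suc k)))"
      using U(3)[of "Suc (Suc k)"] assms by simp
    then have "f ! Suc (Suc k) = Nul C (Dom C (U ! Suc (Suc k))) (Dom C (X ! Suc (Suc k)))"
      using zero_object_Nul[of _ "f ! Suc (Suc k)"] False assms by simp
    then show ?thesis
      using mor(5)[OF f(1), of "Suc k"] f(2) False assms by simp
  qed
qed

lemma angle_Comp_shift:
  assumes "X \<in> T"
  shows "on_arr S (X ! 0) \<cdot> X ! Suc n = Nul C (Dom C (X ! Suc n)) (on_obj S (Cod C (X ! 0)))"
proof -
  note Xs = angle_seq[OF assms]
  note [simp] = seq[OF Xs]
  have "signed (on_arr S (X ! 0)) \<cdot> X ! Suc n = Nul C (Dom C (X ! Suc n)) (on_obj S (Cod C (X ! 0)))"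
    using angle_Comp[OF rot_angle[OF assms], of n] rot_nth[OF Xs] by simp
  then show ?thesis
    using signed_inject[of "on_arr S (X ! 0) \<cdot> X ! Suc n" "Nul C (Dom C (X ! Suc n)) (on_obj S (Cod
        C (X ! 0)))"]
    by simp
qed

end

section \<open>Homotopy equivalence of complexes with fixed ends\<close>

context additive_category
begin

lemma complexes:
  assumes "X \<in> complexes n C A B"
  shows "length X = Suc n" "k \<le> n \<Longrightarrow> X ! k \<in> Arr C"
    "k \<le> n \<Longrightarrow> Dom C (X ! k) = cpx_obj C X k" "k \<le> n \<Longrightarrow> Cod C (X ! k) = cpx_obj C X (Suc k)"
    "cpx_obj C X 0 = A" "cpx_obj C X (Suc n) = B" "k \<le> Suc n \<Longrightarrow> cpx_obj C X k \<in> Obj C"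
    "k < n \<Longrightarrow> X ! Suc k \<cdot> X ! k = Nul C (cpx_obj C X k) (cpx_obj C X (Suc (Suc k)))"
    "A \<in> Obj C" "B \<in> Obj C"
proof -
  have 0: "length X = Suc n" "\<And>k. k \<le> n \<Longrightarrow> X ! k \<in> Arr C" "\<And>k. k < n \<Longrightarrow> Cod C (X ! k) = Dom C (X ! Suc
      k)"
    "Cod C (last X) = B" "Dom C (hd X) = A"
    using assms by (auto simp: complexes_def)
  then have "X \<noteq> []"
    by auto
  with 0(1) have l: "last X = X ! n" "hd X = X ! 0"
    by (simp_all add: last_conv_nth hd_conv_nth)
  show e: "length X = Suc n" "k \<le> n \<Longrightarrow> X ! k \<in> Arr C"
    "k \<le> n \<Longrightarrow> Dom C (X ! k) = cpx_obj C X k" "k \<le> n \<Longrightarrow> Cod C (X ! k) = cpx_obj C X (Suc k)"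
    "cpx_obj C X 0 = A" "cpx_obj C X (Suc n) = B" for k
    using 0 l by (auto simp: cpx_obj_def le_less)
  show "k \<le> Suc n \<Longrightarrow> cpx_obj C X k \<in> Obj C" for k
    using 0 l by (cases "k = Suc n") (auto simp: cpx_obj_def)
  show "k < n \<Longrightarrow> X ! Suc k \<cdot> X ! k = Nul C (cpx_obj C X k) (cpx_obj C X (Suc (Suc k)))"
    using assms e(3)[of k] e(4)[of "Suc k"] by (auto simp: complexes_def)
  show "A \<in> Obj C" "B \<in> Obj C"
    using 0 l by auto
qed

lemma complexesI:
  assumes "length X = Suc n" "\<And>k. k \<le> n \<Longrightarrow> X ! k \<in> Arr C" "Dom C (X ! 0) = A" "Cod C (X ! n) = B"
    "\<And>k. k < n \<Longrightarrow> Cod C (X ! k) = Dom C (X ! Suc k)"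
    "\<And>k. k < n \<Longrightarrow> X ! Suc k \<cdot> X ! k = Nul C (Dom C (X ! k)) (Cod C (X ! Suc k))"
  shows "X \<in> complexes n C A B"
proof -
  have "X \<noteq> []"
    using assms(1) by auto
  with assms show ?thesis
    by (auto simp: complexes_def in_set_conv_nth less_Suc_eq_le hd_conv_nth last_conv_nth)
qed

lemma cpx_morphism:
  assumes "cpx_morphism n C A B X Y f"
  shows "length f = Suc (Suc n)" "k \<le> Suc n \<Longrightarrow> f ! k \<in> Arr C"
    "k \<le> Suc n \<Longrightarrow> Dom C (f ! k) = cpx_obj C X k" "k \<le> Suc n \<Longrightarrow> Cod C (f ! k) = cpx_obj C Y k"
    "k \<le> n \<Longrightarrow> f ! Suc k \<cdot> X ! k = Y ! k \<cdot> f ! k"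
    "f ! 0 = Idt C A" "f ! Suc n = Idt C B"
  using assms by (auto simp: cpx_morphism_def Mor_def)

lemma cpx_morphismI:
  assumes "length f = Suc (Suc n)" "\<And>k. k \<le> Suc n \<Longrightarrow> f ! k \<in> Arr C"
    "\<And>k. k \<le> Suc n \<Longrightarrow> Dom C (f ! k) = cpx_obj C X k" "\<And>k. k \<le> Suc n \<Longrightarrow> Cod C (f ! k) = cpx_obj C Y k"
    "\<And>k. k \<le> n \<Longrightarrow> f ! Suc k \<cdot> X ! k = Y ! k \<cdot> f ! k"
    "f ! 0 = Idt C A" "f ! Suc n = Idt C B"
  shows "cpx_morphism n C A B X Y f"
  using assms by (auto simp: cpx_morphism_def Mor_def)

text \<open>Homotopy equivalence only ever compares an endomorphism with the identity, so this
  special case of \<open>homotopic\<close> is enough. Families indexed by \<open>nat\<close> replace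
  lists to ease the algebra.\<close>

definition id_homotopy :: "nat \<Rightarrow> 'm list \<Rightarrow> (nat \<Rightarrow> 'm) \<Rightarrow> (nat \<Rightarrow> 'm) \<Rightarrow> bool" where
  "id_homotopy n X a h \<longleftrightarrow>
     (\<forall>k \<le> n. h k \<in> Arr C \<and> Dom C (h k) = cpx_obj C X (Suc k) \<and> Cod C (h k) = cpx_obj C X k) \<and>
     a 0 = Idt C (cpx_obj C X 0) \<boxplus> h 0 \<cdot> X ! 0 \<and>
     (\<forall>k < n. a (Suc k) = Idt C (cpx_obj C X (Suc k)) \<boxplus> (X ! k \<cdot> h k \<boxplus> h (Suc k) \<cdot> X ! Suc k)) \<and>
     a (Suc n) = Idt C (cpx_obj C X (Suc n)) \<boxplus> X ! n \<cdot> h n"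

lemma id_homotopy:
  assumes "id_homotopy n X a h"
  shows "k \<le> n \<Longrightarrow> h k \<in> Arr C" "k \<le> n \<Longrightarrow> Dom C (h k) = cpx_obj C X (Suc k)"
    "k \<le> n \<Longrightarrow> Cod C (h k) = cpx_obj C X k"
    "a 0 = Idt C (cpx_obj C X 0) \<boxplus> h 0 \<cdot> X ! 0"
    "k < n \<Longrightarrow> a (Suc k) = Idt C (cpx_obj C X (Suc k)) \<boxplus> (X ! k \<cdot> h k \<boxplus> h (Suc k) \<cdot> X ! Suc k)"
    "a (Suc n) = Idt C (cpx_obj C X (Suc n)) \<boxplus> X ! n \<cdot> h n"
  using assms by (auto simp: id_homotopy_def)

lemma homotopic_id_iff:
  assumes "length f = Suc (Suc n)" "length g = Suc (Suc n)"
  shows "homotopic n C X X (cpx_comp C g f) (cpx_id n C X) \<longleftrightarrow>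
    (\<exists>h. id_homotopy n X (\<lambda>k. g ! k \<cdot> f ! k) h)"
proof -
  have [simp]: "cpx_comp C g f ! k = g ! k \<cdot> f ! k" if "k \<le> Suc n" for k
    using that assms by (simp add: cpx_comp_def)
  have [simp]: "cpx_id n C X ! k = Idt C (cpx_obj C X k)" if "k \<le> Suc n" for k
    using that by (simp add: cpx_id_def del: upt_Suc)
  have all: "(\<forall>i. Suc 0 \<le> i \<and> i \<le> n \<longrightarrow> P i) \<longleftrightarrow> (\<forall>k < n. P (Suc k))" for P
    by (metis Suc_le_D Suc_le_eq zero_less_Suc)
  show ?thesis
  proof
    assume "homotopic n C X X (cpx_comp C g f) (cpx_id n C X)"
    then obtain h where "length h = n + 1"
      "\<forall>i \<le> n. h ! i \<in> Mor C (cpx_obj C X (i + 1)) (cpx_obj C X i)"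
      "cpx_comp C g f ! 0 = cpx_id n C X ! 0 \<boxplus> h ! 0 \<cdot> X ! 0"
      "\<forall>k < n. cpx_comp C g f ! Suc k = cpx_id n C X ! Suc k \<boxplus> (X ! k \<cdot> h ! k \<boxplus> h ! Suc k \<cdot> X ! Suc
          k)"
      "cpx_comp C g f ! (n + 1) = cpx_id n C X ! (n + 1) \<boxplus> X ! n \<cdot> h ! n"
      unfolding homotopic_def by (auto simp: all)
    then have "id_homotopy n X (\<lambda>k. g ! k \<cdot> f ! k) (\<lambda>k. h ! k)"
      by (auto simp: id_homotopy_def Mor_def)
    then show "\<exists>h. id_homotopy n X (\<lambda>k. g ! k \<cdot> f ! k) h"
      by blast
  next
    assume "\<exists>h. id_homotopy n X (\<lambda>k. g ! k \<cdot> f ! k) h"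
    then obtain h where "id_homotopy n X (\<lambda>k. g ! k \<cdot> f ! k) h"
      by blast
    then show "homotopic n C X X (cpx_comp C g f) (cpx_id n C X)"
      unfolding homotopic_def id_homotopy_def
      by (intro exI[of _ "tab (Suc n) h"]) (auto simp: all Mor_def)
  qed
qed

lemma homotopy_equivalent_iff:
  "homotopy_equivalent n C A B X Y \<longleftrightarrow> (\<exists>f g h h'. cpx_morphism n C A B X Y f \<and> cpx_morphism n C A B Y
      X g \<and>
     id_homotopy n X (\<lambda>k. g ! k \<cdot> f ! k) h \<and> id_homotopy n Y (\<lambda>k. f ! k \<cdot> g ! k) h')"
proof -
  have "cpx_morphism n C A B X Y f \<and> cpx_morphism n C A B Y X g \<and>
      homotopic n C X X (cpx_comp C g f) (cpx_id n C X) \<and> homotopic n C Y Y (cpx_comp C f g) (cpx_id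
          n C Y) \<longleftrightarrow>
    (\<exists>h h'. cpx_morphism n C A B X Y f \<and> cpx_morphism n C A B Y X g \<and>
     id_homotopy n X (\<lambda>k. g ! k \<cdot> f ! k) h \<and> id_homotopy n Y (\<lambda>k. f ! k \<cdot> g ! k) h')" for f g
    using homotopic_id_iff[of f n g X] homotopic_id_iff[of g n f Y] cpx_morphism(1)[of n A B X Y f]
      cpx_morphism(1)[of n A B Y X g] by auto
  then show ?thesis
    unfolding homotopy_equivalent_def by simp
qed

section \<open>Homotopy equivalence is an equivalence relation\<close>

lemma homotopy_equivalent_refl:
  assumes "X \<in> complexes n C A B"
  shows "homotopy_equivalent n C A B X X"
proof -
  note [simp] = complexes[OF assms]
  let ?i = "tab (Suc (Suc n)) (\<lambda>k. Idt C (cpx_obj C X k))"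
  have "cpx_morphism n C A B X X ?i"
    by (intro cpx_morphismI) simp_all
  moreover have "id_homotopy n X (\<lambda>k. ?i ! k \<cdot> ?i ! k) (\<lambda>k. Nul C (cpx_obj C X (Suc k)) (cpx_obj C X
      k))"
    by (simp add: id_homotopy_def)
  ultimately show ?thesis
    unfolding homotopy_equivalent_iff by blast
qed

lemma homotopy_equivalent_sym:
  "homotopy_equivalent n C A B X Y \<Longrightarrow> homotopy_equivalent n C A B Y X"
  unfolding homotopy_equivalent_def by blast

text \<open>Sandwiching \<open>a = 1 + d h' + h' d\<close> between the chain maps \<open>g\<close>
  and \<open>f\<close> gives \<open>g f + d (g h' f) + (g h' f) d\<close>, and \<open>g f\<close> is
  in turn homotopic to the identity through \<open>h\<close>. With \<open>a\<close> a composite of a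
  second pair of maps this yields transitivity.\<close>

lemma id_homotopy_conj:
  assumes X: "X \<in> complexes n C A B" and Y: "Y \<in> complexes n C A B"
    and f: "cpx_morphism n C A B X Y f" and g: "cpx_morphism n C A B Y X g"
    and h: "id_homotopy n X (\<lambda>k. g ! k \<cdot> f ! k) h" and h': "id_homotopy n Y a h'"
  shows "id_homotopy n X (\<lambda>k. g ! k \<cdot> (a k \<cdot> f ! k)) (\<lambda>k. g ! k \<cdot> (h' k \<cdot> f ! Suc k) \<boxplus> h k)"
proof -
  note [simp] = complexes[OF X] complexes[OF Y] cpx_morphism(1-4)[OF f] cpx_morphism(1-4)[OF g]
    id_homotopy(1-3)[OF h] id_homotopy(1-3)[OF h'] id_homotopy(4-6)[OF h']
  note [simp] = cpx_morphism(6-7)[OF f] cpx_morphism(6-7)[OF g]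
  have cf: "Y ! k \<cdot> f ! k = f ! Suc k \<cdot> X ! k" if "k \<le> n" for k
    using cpx_morphism(5)[OF f that] by simp
  have cg: "g ! Suc k \<cdot> (Y ! k \<cdot> u) = X ! k \<cdot> (g ! k \<cdot> u)"
    if "k \<le> n" "u \<in> Arr C" "Cod C u = cpx_obj C Y k" for k u
    using cpx_morphism(5)[OF g that(1)] that by (simp flip: Comp_assoc')
  show ?thesis
    unfolding id_homotopy_def
  proof (intro conjI allI impI)
    fix k assume k: "k < n"
    have "g ! Suc k \<cdot> (a (Suc k) \<cdot> f ! Suc k) = g ! Suc k \<cdot> f ! Suc k \<boxplus>
      (X ! k \<cdot> (g ! k \<cdot> (h' k \<cdot> f ! Suc k)) \<boxplus> g ! Suc k \<cdot> (h' (Suc k) \<cdot> (f ! Suc (Suc k) \<cdot> X ! Suc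
          k)))"
      using k by (simp add: distribL distribR Comp_assoc' cf cg)
    also have "g ! Suc k \<cdot> f ! Suc k = Idt C (cpx_obj C X (Suc k)) \<boxplus> (X ! k \<cdot> h k \<boxplus> h (Suc k) \<cdot> X !
        Suc k)"
      using id_homotopy(5)[OF h] k by simp
    finally show "g ! Suc k \<cdot> (a (Suc k) \<cdot> f ! Suc k) = Idt C (cpx_obj C X (Suc k)) \<boxplus>
       (X ! k \<cdot> (g ! k \<cdot> (h' k \<cdot> f ! Suc k) \<boxplus> h k) \<boxplus>
        (g ! Suc k \<cdot> (h' (Suc k) \<cdot> f ! Suc (Suc k)) \<boxplus> h (Suc k)) \<cdot> X ! Suc k)"
      using k by (simp add: distribL distribR Comp_assoc' Add_assoc Add_commute Add_left_commute)
  next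
    have "g ! 0 \<cdot> (a 0 \<cdot> f ! 0) = g ! 0 \<cdot> f ! 0 \<boxplus> g ! 0 \<cdot> (h' 0 \<cdot> (f ! Suc 0 \<cdot> X ! 0))"
      using cf[of 0, symmetric] by (simp add: distribL distribR Comp_assoc')
    also have "g ! 0 \<cdot> f ! 0 = Idt C (cpx_obj C X 0) \<boxplus> h 0 \<cdot> X ! 0"
      using id_homotopy(4)[OF h] by simp
    finally show "g ! 0 \<cdot> (a 0 \<cdot> f ! 0) = Idt C (cpx_obj C X 0) \<boxplus> (g ! 0 \<cdot> (h' 0 \<cdot> f ! Suc 0) \<boxplus> h 0)
        \<cdot> X ! 0"
      by (simp add: distribL distribR Comp_assoc' Add_assoc Add_commute Add_left_commute)
  next
    have "g ! Suc n \<cdot> (a (Suc n) \<cdot> f ! Suc n) = g ! Suc n \<cdot> f ! Suc n \<boxplus> X ! n \<cdot> (g ! n \<cdot> (h' n \<cdot> f !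
        Suc n))"
      using cg[of n "h' n"] by (simp add: distribL distribR Comp_assoc')
    also have "g ! Suc n \<cdot> f ! Suc n = Idt C (cpx_obj C X (Suc n)) \<boxplus> X ! n \<cdot> h n"
      using id_homotopy(6)[OF h] by simp
    finally show "g ! Suc n \<cdot> (a (Suc n) \<cdot> f ! Suc n) = Idt C (cpx_obj C X (Suc n)) \<boxplus>
        X ! n \<cdot> (g ! n \<cdot> (h' n \<cdot> f ! Suc n) \<boxplus> h n)"
      by (simp add: distribL distribR Comp_assoc' Add_assoc Add_commute Add_left_commute)
  qed simp_all
qed

lemma homotopy_equivalent_trans:
  assumes X: "X \<in> complexes n C A B" and Y: "Y \<in> complexes n C A B" and Z: "Z \<in> complexes n C A B"
    and XY: "homotopy_equivalent n C A B X Y" and YZ: "homotopy_equivalent n C A B Y Z"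
  shows "homotopy_equivalent n C A B X Z"
proof -
  obtain f g h h' where f: "cpx_morphism n C A B X Y f" and g: "cpx_morphism n C A B Y X g"
    and h: "id_homotopy n X (\<lambda>k. g ! k \<cdot> f ! k) h" "id_homotopy n Y (\<lambda>k. f ! k \<cdot> g ! k) h'"
    using XY unfolding homotopy_equivalent_iff by blast
  obtain f' g' H H' where f': "cpx_morphism n C A B Y Z f'" and g': "cpx_morphism n C A B Z Y g'"
    and H: "id_homotopy n Y (\<lambda>k. g' ! k \<cdot> f' ! k) H" "id_homotopy n Z (\<lambda>k. f' ! k \<cdot> g' ! k) H'"
    using YZ unfolding homotopy_equivalent_iff by blast
  note [simp] = complexes[OF X] complexes[OF Y] complexes[OF Z] cpx_morphism(1-4)[OF f]
    cpx_morphism(1-4)[OF g] cpx_morphism(1-4)[OF f'] cpx_morphism(1-4)[OF g']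
  have mor: "cpx_morphism n C A B P R (tab (Suc (Suc n)) (\<lambda>k. q ! k \<cdot> p ! k))"
    if P: "P \<in> complexes n C A B" and Q: "Q \<in> complexes n C A B" and R: "R \<in> complexes n C A B"
      and p: "cpx_morphism n C A B P Q p" and q: "cpx_morphism n C A B Q R q" for P Q R p q
  proof (rule cpx_morphismI)
    note [simp] = complexes[OF P] complexes[OF Q] complexes[OF R] cpx_morphism(1-4)[OF p]
        cpx_morphism(1-4)[OF q]
    show "tab (Suc (Suc n)) (\<lambda>k. q ! k \<cdot> p ! k) ! Suc k \<cdot> P ! k = R ! k \<cdot> tab (Suc (Suc n)) (\<lambda>k. q !
        k \<cdot> p ! k) ! k"
      if k: "k \<le> n" for k
    proof -
      have "q ! Suc k \<cdot> (p ! Suc k \<cdot> P ! k) = (q ! Suc k \<cdot> Q ! k) \<cdot> p ! k"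
        using cpx_morphism(5)[OF p k] k by (simp add: Comp_assoc')
      then show ?thesis
        using cpx_morphism(5)[OF q k] k by (simp add: Comp_assoc')
    qed
    show "tab (Suc (Suc n)) (\<lambda>k. q ! k \<cdot> p ! k) ! 0 = Idt C A" "tab (Suc (Suc n)) (\<lambda>k. q ! k \<cdot> p !
        k) ! Suc n = Idt C B"
      using cpx_morphism(6-7)[OF p] cpx_morphism(6-7)[OF q] by simp_all
  qed (use cpx_morphism(1-4)[OF p] cpx_morphism(1-4)[OF q] in simp_all)
  let ?F = "tab (Suc (Suc n)) (\<lambda>k. f' ! k \<cdot> f ! k)" and ?G = "tab (Suc (Suc n)) (\<lambda>k. g ! k \<cdot> g' ! k)"
  have "id_homotopy n X (\<lambda>k. ?G ! k \<cdot> ?F ! k) (\<lambda>k. g ! k \<cdot> (H k \<cdot> f ! Suc k) \<boxplus> h k)"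
    using id_homotopy_conj[OF X Y f g h(1) H(1)] unfolding id_homotopy_def by (simp add: Comp_assoc')
  moreover have "id_homotopy n Z (\<lambda>k. ?F ! k \<cdot> ?G ! k) (\<lambda>k. f' ! k \<cdot> (h' k \<cdot> g' ! Suc k) \<boxplus> H' k)"
    using id_homotopy_conj[OF Z Y g' f' H(2) h(2)] unfolding id_homotopy_def by (simp add:
        Comp_assoc')
  ultimately show ?thesis
    using mor[OF X Y Z f f'] mor[OF Z Y X g' g] unfolding homotopy_equivalent_iff by blast
qed

lemma homotopy_class_eq_iff:
  assumes "X \<in> complexes n C A B" "Y \<in> complexes n C A B"
  shows "homotopy_class n C A B X = homotopy_class n C A B Y \<longleftrightarrow> homotopy_equivalent n C A B X Y"
proof
  assume "homotopy_class n C A B X = homotopy_class n C A B Y"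
  then show "homotopy_equivalent n C A B X Y"
    using assms homotopy_equivalent_refl[OF assms(2)] unfolding homotopy_class_def by blast
next
  assume XY: "homotopy_equivalent n C A B X Y"
  then show "homotopy_class n C A B X = homotopy_class n C A B Y"
    using homotopy_equivalent_trans[OF assms] homotopy_equivalent_trans[OF assms(2,1)]
      homotopy_equivalent_sym[OF XY] unfolding homotopy_class_def by blast
qed

end

context additive_functor_pair
begin

lemma map_complexes:
  assumes "X \<in> complexes n C A B"
  shows "map (on_arr F) X \<in> complexes n D (on_obj F A) (on_obj F B)"
    "k \<le> Suc n \<Longrightarrow> cpx_obj D (map (on_arr F) X) k = on_obj F (cpx_obj C X k)"
proof -
  note [simp] = C.complexes[OF assms]
  show X: "map (on_arr F) X \<in> complexes n D (on_obj F A) (on_obj F B)"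
    by (intro D.complexesI) (simp_all flip: map_Comp)
  show "k \<le> Suc n \<Longrightarrow> cpx_obj D (map (on_arr F) X) k = on_obj F (cpx_obj C X k)"
    using D.complexes(3)[OF X, of k] D.complexes(6)[OF X] by (cases "k = Suc n") simp_all
qed

end

section \<open>Completions of a morphism to an angle are homotopy equivalent\<close>

context angulated
begin

lemma angle_complex:
  assumes "X @ [\<delta>] \<in> T"
  shows "length X = Suc n" "X \<in> complexes n C (Dom C (X ! 0)) (Dom C \<delta>)"
    "k \<le> Suc n \<Longrightarrow> cpx_obj C X k = Dom C ((X @ [\<delta>]) ! k)"
    "\<delta> \<in> Arr C" "Cod C \<delta> = on_obj S (Dom C (X ! 0))"
proof -
  note s = seq[OF angle_seq[OF assms]]
  show l: "length X = Suc n"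
    using s(1) by simp
  have n: "(X @ [\<delta>]) ! k = X ! k" if "k \<le> n" for k
    using that l by (simp add: nth_append)
  have d: "(X @ [\<delta>]) ! Suc n = \<delta>"
    using l by (simp add: nth_append)
  show X: "X \<in> complexes n C (Dom C (X ! 0)) (Dom C \<delta>)"
  proof (rule complexesI)
    show "X ! k \<in> Arr C" if "k \<le> n" for k
      using s(2)[of k] n that by simp
    show "Cod C (X ! n) = Dom C \<delta>"
      using s(3)[of n] n d by simp
    show "Cod C (X ! k) = Dom C (X ! Suc k)" if "k < n" for k
      using s(3)[of k] n[of k] n[of "Suc k"] that by simp
    show "X ! Suc k \<cdot> X ! k = Nul C (Dom C (X ! k)) (Cod C (X ! Suc k))" if "k < n" for k
      using angle_Comp[OF assms, of k] n[of k] n[of "Suc k"] that by simp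
  qed (simp_all add: l)
  show "k \<le> Suc n \<Longrightarrow> cpx_obj C X k = Dom C ((X @ [\<delta>]) ! k)"
    using complexes(3)[OF X, of k] complexes(6)[OF X] n[of k] d by (cases "k = Suc n") simp_all
  show "\<delta> \<in> Arr C" "Cod C \<delta> = on_obj S (Dom C (X ! 0))"
    using s(2)[of "Suc n"] s(4) d n[of 0] by simp_all
qed

text \<open>Lifting \<open>\<phi>\<close> along the differentials gives \<open>\<phi> = d h + h d\<close> except in the last degree, where
  \<open>d h\<close> need not vanish. Multiplying by \<open>\<phi>\<close> once more removes this defect.\<close>

lemma square_null_homotopic:
  assumes XT: "X @ [\<delta>] \<in> T"
    and \<phi>: "\<And>k. k \<le> Suc n \<Longrightarrow> \<phi> k \<in> Arr C \<and> Dom C (\<phi> k) = cpx_obj C X k \<and> Cod C (\<phi> k) = cpx_obj C X k"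
    and chain: "\<And>k. k \<le> n \<Longrightarrow> \<phi> (Suc k) \<cdot> X ! k = X ! k \<cdot> \<phi> k"
    and ends: "\<phi> 0 = Nul C (cpx_obj C X 0) (cpx_obj C X 0)"
      "\<phi> (Suc n) = Nul C (cpx_obj C X (Suc n)) (cpx_obj C X (Suc n))"
  shows "\<exists>h. id_homotopy n X (\<lambda>k. Idt C (cpx_obj C X k) \<boxminus> \<phi> k \<cdot> \<phi> k) h"
proof -
  note X = angle_complex(2)[OF XT]
  have n: "(X @ [\<delta>]) ! k = X ! k" if "k \<le> n" for k
    using that angle_complex(1)[OF XT] by (simp add: nth_append)
  note [simp] = complexes(1-4,7-10)[OF X] \<phi>
  \<comment> \<open>The components are chosen by recursion with invariant
    \<open>d h d = d \<phi>\<close>. It makes \<open>\<phi> - d h\<close> in the next degree vanish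
    on the incoming differential, so exactness supplies the next component. The start
    \<open>h 0 = 0\<close> meets the invariant because \<open>\<phi>\<close> is zero in degree
    0.\<close>
  have "\<exists>h. \<forall>k. (k \<le> n \<longrightarrow> h k \<in> Arr C \<and> Dom C (h k) = cpx_obj C X (Suc k) \<and> Cod C (h k) = cpx_obj C X
      k \<and>
      X ! k \<cdot> (h k \<cdot> X ! k) = X ! k \<cdot> \<phi> k) \<and>
    (k < n \<longrightarrow> h (Suc k) \<cdot> X ! Suc k = \<phi> (Suc k) \<boxminus> X ! k \<cdot> h k) \<and>
    (k = 0 \<longrightarrow> h k = Nul C (cpx_obj C X (Suc 0)) (cpx_obj C X 0))"
    (is "\<exists>h. \<forall>k. ?P k (h k) \<and> ?Q k (h k) (h (Suc k)) \<and> ?R k (h k)")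
  proof -
    have "\<exists>h. \<forall>k. (?P k (h k) \<and> ?R k (h k)) \<and> ?Q k (h k) (h (Suc k))"
    proof (intro dependent_nat_choice)
      show "\<exists>x. ?P 0 x \<and> ?R 0 x"
        using ends(1) by (intro exI[of _ "Nul C (cpx_obj C X (Suc 0)) (cpx_obj C X 0)"]) simp
      fix x k assume x: "?P k x \<and> ?R k x"
      show "\<exists>y. (?P (Suc k) y \<and> ?R (Suc k) y) \<and> ?Q k x y"
      proof (cases "k < n")
        case True
        with x have [simp]: "x \<in> Arr C" "Dom C x = cpx_obj C X (Suc k)" "Cod C x = cpx_obj C X k"
          and x': "X ! k \<cdot> (x \<cdot> X ! k) = X ! k \<cdot> \<phi> k"
          by simp_all
        let ?w = "\<phi> (Suc k) \<boxminus> X ! k \<cdot> x"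
        have w: "?w \<cdot> X ! k = Nul C (cpx_obj C X k) (cpx_obj C X (Suc k))"
          using True x' chain[of k] by (simp add: distribR Comp_Neg Comp_assoc')
        have "?w \<in> Arr C" "Dom C ?w = cpx_obj C X (Suc k)" "Cod C ?w = cpx_obj C X (Suc k)"
          using True by simp_all
        with angle_exact[OF XT True, of ?w] True w
        obtain y where [simp]: "y \<in> Arr C" "Dom C y = cpx_obj C X (Suc (Suc k))" "Cod C y = cpx_obj
            C X (Suc k)"
          and y: "y \<cdot> X ! Suc k = ?w"
          using n[of k] n[of "Suc k"] angle_complex(3)[OF XT, of "Suc (Suc k)"] by auto
        have "X ! Suc k \<cdot> (X ! k \<cdot> x) = (X ! Suc k \<cdot> X ! k) \<cdot> x"
          using True by (simp add: Comp_assoc' del: complexes(8)[OF X])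
        then have "X ! Suc k \<cdot> (y \<cdot> X ! Suc k) = X ! Suc k \<cdot> \<phi> (Suc k)"
          using True unfolding y by (simp add: distribL Comp_Neg)
        with y True show ?thesis
          by (intro exI[of _ y]) simp
      qed simp
    qed
    then show ?thesis
      by blast
  qed
  then obtain h where h [simp]: "\<And>k. k \<le> n \<Longrightarrow> h k \<in> Arr C" "\<And>k. k \<le> n \<Longrightarrow> Dom C (h k) = cpx_obj C X
      (Suc k)"
      "\<And>k. k \<le> n \<Longrightarrow> Cod C (h k) = cpx_obj C X k"
    and hd: "\<And>k. k < n \<Longrightarrow> h (Suc k) \<cdot> X ! Suc k = \<phi> (Suc k) \<boxminus> X ! k \<cdot> h k"
    and h0: "h 0 = Nul C (cpx_obj C X (Suc 0)) (cpx_obj C X 0)"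
    by metis
  have chain': "\<phi> (Suc k) \<cdot> (X ! k \<cdot> u) = X ! k \<cdot> (\<phi> k \<cdot> u)"
    if "k \<le> n" "u \<in> Arr C" "Cod C u = cpx_obj C X k" for k u
    using chain[of k] that by (simp flip: Comp_assoc')
  have o0: "cpx_obj C X 0 \<in> Obj C" "cpx_obj C X (Suc n) \<in> Obj C"
    using complexes(7)[OF X] by blast+
  have "id_homotopy n X (\<lambda>k. Idt C (cpx_obj C X k) \<boxminus> \<phi> k \<cdot> \<phi> k) (\<lambda>k. Neg C (\<phi> k \<cdot> h k))"
    unfolding id_homotopy_def
  proof (intro conjI allI impI)
    show "Idt C (cpx_obj C X 0) \<boxminus> \<phi> 0 \<cdot> \<phi> 0 = Idt C (cpx_obj C X 0) \<boxplus> Neg C (\<phi> 0 \<cdot> h 0) \<cdot> X ! 0"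
      by (simp add: ends h0 del: complexes(5,6)[OF X])
    \<comment> \<open>In the top degree the chain condition moves \<open>\<phi>\<close> past the
      differential, where it becomes the zero map \<open>\<phi> (Suc n)\<close>.\<close>
    have "X ! n \<cdot> Neg C (\<phi> n \<cdot> h n) = Neg C (\<phi> (Suc n) \<cdot> (X ! n \<cdot> h n))"
      by (simp add: Comp_Neg chain')
    also have "\<dots> = Nul C (cpx_obj C X (Suc n)) (cpx_obj C X (Suc n))"
      using o0 by (simp add: ends del: complexes(5,6)[OF X])
    finally show "Idt C (cpx_obj C X (Suc n)) \<boxminus> \<phi> (Suc n) \<cdot> \<phi> (Suc n) = Idt C (cpx_obj C X (Suc n))
        \<boxplus> X ! n \<cdot> Neg C (\<phi> n \<cdot> h n)"
      using o0 by (simp add: ends del: complexes(5,6)[OF X])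
    fix k assume k: "k < n"
    have "\<phi> (Suc k) \<cdot> (h (Suc k) \<cdot> X ! Suc k) = \<phi> (Suc k) \<cdot> \<phi> (Suc k) \<boxminus> X ! k \<cdot> (\<phi> k \<cdot> h k)"
      using k by (simp add: hd distribL Comp_Neg chain')
    then have "Neg C (\<phi> (Suc k) \<cdot> h (Suc k)) \<cdot> X ! Suc k = Neg C (\<phi> (Suc k) \<cdot> \<phi> (Suc k)) \<boxplus> X ! k \<cdot>
        (\<phi> k \<cdot> h k)"
      using k by (simp add: Comp_Neg Comp_assoc' Neg_Add)
    then show "Idt C (cpx_obj C X (Suc k)) \<boxminus> \<phi> (Suc k) \<cdot> \<phi> (Suc k) = Idt C (cpx_obj C X (Suc k)) \<boxplus>
       (X ! k \<cdot> Neg C (\<phi> k \<cdot> h k) \<boxplus> Neg C (\<phi> (Suc k) \<cdot> h (Suc k)) \<cdot> X ! Suc k)"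
      using k by (simp add: Comp_Neg Add_commute[of "Neg C (\<phi> (Suc k) \<cdot> \<phi> (Suc k))" "X ! k \<cdot> (\<phi> k \<cdot>
          h k)"])
  qed simp_all
  then show ?thesis
    by blast
qed

text \<open>Comparison maps with identity ends come from (F3) at the closing square. Their composite
  \<open>g f = 1 + \<phi>\<close> need not be homotopic to the identity relative to the lifting
  above, but replacing \<open>g\<close> by \<open>(1 - \<phi>) g\<close> makes it
  \<open>1 - \<phi> \<phi>\<close>, which \<open>square_null_homotopic\<close> handles.\<close>

lemma angle_homotopy_equivalent:
  assumes XT: "X @ [\<delta>] \<in> T" and YT: "Y @ [\<delta>] \<in> T" and XA: "Dom C (X ! 0) = A" and YA: "Dom C (Y ! 0)
      = A"
  shows "homotopy_equivalent n C A (Dom C \<delta>) X Y"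
proof -
  note X = angle_complex(2)[OF XT, unfolded XA] and Y = angle_complex(2)[OF YT, unfolded YA]
  note \<delta> = angle_complex(4,5)[OF XT]
  have nth: "(Z @ [\<delta>]) ! k = (if k \<le> n then Z ! k else \<delta>)" if "k \<le> Suc n" "Z @ [\<delta>] \<in> T" for Z k
    using that angle_complex(1)[OF that(2)] by (auto simp: nth_append)
  have ex: "\<exists>f. cpx_morphism n C A (Dom C \<delta>) P Q f"
    if P: "P @ [\<delta>] \<in> T" and Q: "Q @ [\<delta>] \<in> T" and PA: "Dom C (P ! 0) = A" and QA: "Dom C (Q ! 0) = A"
        for P Q
  proof -
    have "A \<in> Obj C"
      using complexes(9)[OF X] .
    then obtain f where f: "mor (P @ [\<delta>]) (Q @ [\<delta>]) f" "f ! Suc n = Idt C (Dom C \<delta>)" "f ! 0 = Idt C A"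
      using F3_last[OF P Q, of "Idt C (Dom C \<delta>)" "Idt C A"] P Q PA QA angle_complex(1,4,5)[OF P]
      by (auto simp: nth)
    have "cpx_morphism n C A (Dom C \<delta>) P Q f"
    proof (rule cpx_morphismI)
      show "f ! Suc k \<cdot> P ! k = Q ! k \<cdot> f ! k" if "k \<le> n" for k
        using mor(5)[OF f(1) that] that P Q by (simp add: nth)
    qed (use mor(1-4)[OF f(1)] f(2,3) angle_complex(3)[OF P] angle_complex(3)[OF Q] in auto)
    then show ?thesis ..
  qed
  obtain f g where f: "cpx_morphism n C A (Dom C \<delta>) X Y f" and g: "cpx_morphism n C A (Dom C \<delta>) Y X g"
    using ex[OF XT YT XA YA] ex[OF YT XT YA XA] by blast
  note [simp] = complexes(1-4,7-10)[OF X] complexes(1-4,7-10)[OF Y] cpx_morphism(1-4)[OF f]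
      cpx_morphism(1-4)[OF g]
  note ends = cpx_morphism(6,7)[OF f] cpx_morphism(6,7)[OF g] complexes(5,6)[OF X] complexes(5,6)[OF
      Y]
  define \<phi> \<psi> where "\<phi> k = g ! k \<cdot> f ! k \<boxminus> Idt C (cpx_obj C X k)"
    and "\<psi> k = f ! k \<cdot> g ! k \<boxminus> Idt C (cpx_obj C Y k)" for k
  have \<phi> [simp]: "\<phi> k \<in> Arr C" "Dom C (\<phi> k) = cpx_obj C X k" "Cod C (\<phi> k) = cpx_obj C X k" if "k \<le>
      Suc n" for k
    using that by (simp_all add: \<phi>_def)
  have \<psi> [simp]: "\<psi> k \<in> Arr C" "Dom C (\<psi> k) = cpx_obj C Y k" "Cod C (\<psi> k) = cpx_obj C Y k" if "k \<le>
      Suc n" for k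
    using that by (simp_all add: \<psi>_def)
  have gf: "g ! k \<cdot> f ! k = Idt C (cpx_obj C X k) \<boxplus> \<phi> k"
    and fg: "f ! k \<cdot> g ! k = Idt C (cpx_obj C Y k) \<boxplus> \<psi> k" if "k \<le> Suc n" for k
    using that Add_commute[of "Idt C (cpx_obj C X k)" "\<phi> k"] Add_commute[of "Idt C (cpx_obj C Y k)"
        "\<psi> k"]
    unfolding \<phi>_def \<psi>_def by (simp_all add: Add_assoc)
  \<comment> \<open>Since \<open>f\<close> intertwines \<open>\<phi>\<close> and
    \<open>\<psi>\<close>, the same correction of \<open>g\<close> turns the other composite into
    \<open>(1 - \<psi>)(1 + \<psi>) = 1 - \<psi> \<psi>\<close>.\<close>
  have f\<phi>: "f ! k \<cdot> \<phi> k = \<psi> k \<cdot> f ! k" if "k \<le> Suc n" for k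
    using that by (simp add: \<phi>_def \<psi>_def distribL distribR Comp_Neg Comp_assoc')
  have fc: "f ! Suc k \<cdot> (X ! k \<cdot> u) = Y ! k \<cdot> (f ! k \<cdot> u)" if "k \<le> n" "u \<in> Arr C" "Cod C u = cpx_obj
      C X k" for k u
    using cpx_morphism(5)[OF f, of k] that by (simp flip: Comp_assoc')
  have gc: "g ! Suc k \<cdot> (Y ! k \<cdot> u) = X ! k \<cdot> (g ! k \<cdot> u)" if "k \<le> n" "u \<in> Arr C" "Cod C u = cpx_obj
      C Y k" for k u
    using cpx_morphism(5)[OF g, of k] that by (simp flip: Comp_assoc')
  have \<phi>c: "\<phi> (Suc k) \<cdot> X ! k = X ! k \<cdot> \<phi> k" and \<psi>c: "\<psi> (Suc k) \<cdot> Y ! k = Y ! k \<cdot> \<psi> k" if "k \<le> n"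
      for k
    using that cpx_morphism(5)[OF f, of k] cpx_morphism(5)[OF g, of k]
    by (simp_all add: \<phi>_def \<psi>_def distribL distribR Comp_Neg Comp_assoc' fc gc)
  have e: "\<phi> 0 = Nul C (cpx_obj C X 0) (cpx_obj C X 0)" "\<phi> (Suc n) = Nul C (cpx_obj C X (Suc n))
      (cpx_obj C X (Suc n))"
    "\<psi> 0 = Nul C (cpx_obj C Y 0) (cpx_obj C Y 0)" "\<psi> (Suc n) = Nul C (cpx_obj C Y (Suc n)) (cpx_obj
        C Y (Suc n))"
    by (simp_all add: \<phi>_def \<psi>_def ends)
  obtain h where h: "id_homotopy n X (\<lambda>k. Idt C (cpx_obj C X k) \<boxminus> \<phi> k \<cdot> \<phi> k) h"
    using square_null_homotopic[OF XT, of \<phi>] \<phi> \<phi>c e by auto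
  obtain h' where h': "id_homotopy n Y (\<lambda>k. Idt C (cpx_obj C Y k) \<boxminus> \<psi> k \<cdot> \<psi> k) h'"
    using square_null_homotopic[OF YT, of \<psi>] \<psi> \<psi>c e by auto
  let ?g = "tab (Suc (Suc n)) (\<lambda>k. g ! k \<boxminus> \<phi> k \<cdot> g ! k)"
  have "cpx_morphism n C A (Dom C \<delta>) Y X ?g"
  proof (rule cpx_morphismI)
    show "?g ! Suc k \<cdot> Y ! k = X ! k \<cdot> ?g ! k" if "k \<le> n" for k
    proof -
      have "\<phi> (Suc k) \<cdot> (X ! k \<cdot> g ! k) = X ! k \<cdot> (\<phi> k \<cdot> g ! k)"
        using \<phi>c[of k] that by (simp flip: Comp_assoc')
      then show ?thesis
        using cpx_morphism(5)[OF g, of k] that by (simp add: distribL distribR Comp_Neg Comp_assoc')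
    qed
    show "?g ! 0 = Idt C A" "?g ! Suc n = Idt C (Dom C \<delta>)"
      by (simp_all add: e ends)
  qed simp_all
  moreover have "?g ! k \<cdot> f ! k = Idt C (cpx_obj C X k) \<boxminus> \<phi> k \<cdot> \<phi> k" if "k \<le> Suc n" for k
    using that by (simp add: distribL distribR Comp_Neg Comp_assoc' gf Neg_Add Add_assoc)
  with h have "id_homotopy n X (\<lambda>k. ?g ! k \<cdot> f ! k) h"
    unfolding id_homotopy_def by simp
  moreover have "f ! k \<cdot> ?g ! k = Idt C (cpx_obj C Y k) \<boxminus> \<psi> k \<cdot> \<psi> k" if "k \<le> Suc n" for k
  proof -
    have "f ! k \<cdot> (\<phi> k \<cdot> g ! k) = \<psi> k \<cdot> (f ! k \<cdot> g ! k)"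
      using that f\<phi>[of k] by (simp flip: Comp_assoc')
    then show ?thesis
      using that by (simp add: distribL distribR Comp_Neg Comp_assoc' fg Neg_Add Add_assoc)
  qed
  with h' have "id_homotopy n Y (\<lambda>k. f ! k \<cdot> ?g ! k) h'"
    unfolding id_homotopy_def by simp
  ultimately show ?thesis
    using f unfolding homotopy_equivalent_iff by blast
qed

end

section \<open>Angles are closed under homotopy equivalence\<close>

context angulated
begin

text \<open>Together with \<open>extend\<close> this continues objects and maps to degree
  \<open>n + 2\<close> by \<open>\<Sigma> X^0\<close> and \<open>\<Sigma> f^0\<close>, so that the
  square through \<Sigma> can be treated like all the others.\<close>

definition obj :: "'m list \<Rightarrow> nat \<Rightarrow> 'o" where
  "obj X k = (if k \<le> Suc n then Dom C (X ! k) else on_obj S (Dom C (X ! 0)))"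

definition extend :: "(nat \<Rightarrow> 'm) \<Rightarrow> nat \<Rightarrow> 'm" where
  "extend f k = (if k \<le> Suc n then f k else on_arr S (f 0))"

lemma obj_last: "obj X (Suc (Suc n)) = on_obj S (obj X 0)"
  by (simp add: obj_def)

lemma seq_obj:
  assumes "X \<in> seqs"
  shows "k \<le> Suc n \<Longrightarrow> X ! k \<in> Arr C" "k \<le> Suc n \<Longrightarrow> Dom C (X ! k) = obj X k"
    "k \<le> Suc n \<Longrightarrow> Cod C (X ! k) = obj X (Suc k)" "obj X k \<in> Obj C"
  using seq[OF assms] seq(2)[OF assms, of k] seq(2)[OF assms, of 0]
  by (auto simp: obj_def not_less_eq_eq le_Suc_eq)

lemma seqI_obj:
  assumes "\<And>k. k \<le> Suc n \<Longrightarrow> f k \<in> Arr C" "\<And>k. k \<le> Suc n \<Longrightarrow> Dom C (f k) = d k"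
    "\<And>k. k \<le> Suc n \<Longrightarrow> Cod C (f k) = d (Suc k)" "d (Suc (Suc n)) = on_obj S (d 0)"
  shows "tab (Suc (Suc n)) f \<in> seqs" "k \<le> Suc (Suc n) \<Longrightarrow> obj (tab (Suc (Suc n)) f) k = d k"
proof -
  show "tab (Suc (Suc n)) f \<in> seqs"
    using assms by (intro seqI) simp_all
  show "k \<le> Suc (Suc n) \<Longrightarrow> obj (tab (Suc (Suc n)) f) k = d k"
    using assms by (auto simp: obj_def le_Suc_eq)
qed

lemma mor_extend:
  assumes "mor X Y f"
  shows "k \<le> Suc n \<Longrightarrow> extend ((!) f) (Suc k) \<cdot> X ! k = Y ! k \<cdot> extend ((!) f) k"
  using mor(5)[OF assms, of k] mor(6)[OF assms] by (cases "k = Suc n") (auto simp: extend_def)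

lemma morI_extend:
  assumes "\<And>k. k \<le> Suc n \<Longrightarrow> f k \<in> Arr C" "\<And>k. k \<le> Suc n \<Longrightarrow> Dom C (f k) = obj X k"
    "\<And>k. k \<le> Suc n \<Longrightarrow> Cod C (f k) = obj Y k"
    "\<And>k. k \<le> Suc n \<Longrightarrow> extend f (Suc k) \<cdot> X ! k = Y ! k \<cdot> f k"
  shows "mor X Y (tab (Suc (Suc n)) f)"
proof (rule morI)
  show "tab (Suc (Suc n)) f ! Suc k \<cdot> X ! k = Y ! k \<cdot> tab (Suc (Suc n)) f ! k" if "k \<le> n" for k
    using assms(4)[of k] that by (simp add: extend_def)
  show "on_arr S (tab (Suc (Suc n)) f ! 0) \<cdot> X ! Suc n = Y ! Suc n \<cdot> tab (Suc (Suc n)) f ! Suc n"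
    using assms(4)[of "Suc n"] by (simp add: extend_def)
qed (use assms in \<open>simp_all add: obj_def\<close>)

lemma extend_biproduct:
  assumes "\<And>k. k \<le> Suc n \<Longrightarrow> is_biproduct C (A k) (B k) (D k) (i k) (j k) (p k) (q k)"
    and "A (Suc (Suc n)) = on_obj S (A 0)" "B (Suc (Suc n)) = on_obj S (B 0)" "D (Suc (Suc n)) =
        on_obj S (D 0)"
    and "k \<le> Suc (Suc n)"
  shows "is_biproduct C (A k) (B k) (D k) (extend i k) (extend j k) (extend p k) (extend q k)"
  using assms(1)[of k] S.map_biproduct[OF assms(1)[of 0]] assms(2-5)
  by (cases "k = Suc (Suc n)") (auto simp: extend_def)

text \<open>(F1) says that sums of angles are angles but does not produce them. Biproducts are
  chosen degreewise and the differential is the diagonal one along these choices.\<close>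

lemma direct_sum:
  assumes X: "X \<in> T" and Y: "Y \<in> T"
  shows "\<exists>W i j p q. W \<in> T \<and> mor X W i \<and> mor Y W j \<and> mor W X p \<and> mor W Y q \<and>
    (\<forall>k \<le> Suc n. is_biproduct C (Dom C (X ! k)) (Dom C (Y ! k)) (Dom C (W ! k)) (i ! k) (j ! k) (p !
        k) (q ! k))"
proof -
  note XY [simp] = seq_obj[OF angle_seq[OF X]] seq_obj[OF angle_seq[OF Y]]
  have "\<exists>D i j p q. is_biproduct C (obj X k) (obj Y k) D i j p q" for k
    using biproduct_exists[of "obj X k" "obj Y k"] XY by blast
  then obtain D0 i j p q where b0: "\<And>k. is_biproduct C (obj X k) (obj Y k) (D0 k) (i k) (j k) (p k)
      (q k)"
    by metis
  \<comment> \<open>Degree \<open>n + 2\<close> may not be chosen afresh: it has to be the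
    suspension of the biproduct chosen in degree 0.\<close>
  define D where "D k = (if k \<le> Suc n then D0 k else on_obj S (D0 0))" for k
  have b: "is_biproduct C (obj X k) (obj Y k) (D k) (extend i k) (extend j k) (extend p k) (extend q
      k)"
    if "k \<le> Suc (Suc n)" for k
    by (rule extend_biproduct[where A = "obj X" and B = "obj Y" and D = D and i = i and j = j and p
        = p and q = q])
      (use that b0 in \<open>simp_all add: D_def obj_last\<close>)
  note [simp] = biproduct_simps[OF b]
  have e [simp]: "extend i k = i k" "extend j k = j k" "extend p k = p k" "extend q k = q k" if "k \<le>
      Suc n" for k
    using that by (simp_all add: extend_def)
  have b1: "is_biproduct C (obj X k) (obj Y k) (D k) (i k) (j k) (p k) (q k)" if "k \<le> Suc n" for k
    using b[of k] that by simp
  note [simp] = biproduct_simps[OF b1]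
  define w where "w k = extend i (Suc k) \<cdot> (X ! k \<cdot> extend p k) \<boxplus> extend j (Suc k) \<cdot> (Y ! k \<cdot> extend
      q k)" for k
  have w: "w k \<in> Arr C" "Dom C (w k) = D k" "Cod C (w k) = D (Suc k)" if "k \<le> Suc n" for k
    using that by (simp_all add: w_def del: e)
  let ?W = "tab (Suc (Suc n)) w"
  have Ws: "?W \<in> seqs" and Wo: "k \<le> Suc (Suc n) \<Longrightarrow> obj ?W k = D k" for k
    using seqI_obj[of w D] w by (simp_all add: D_def)
  have ij: "mor X ?W (tab (Suc (Suc n)) i)" "mor Y ?W (tab (Suc (Suc n)) j)"
    "mor ?W X (tab (Suc (Suc n)) p)" "mor ?W Y (tab (Suc (Suc n)) q)"
    by (rule morI_extend; simp add: Wo w w_def[unfolded e] distribL distribR Comp_assoc')+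
  have bb: "is_biproduct C (Dom C (X ! k)) (Dom C (Y ! k)) (Dom C (?W ! k)) (tab (Suc (Suc n)) i !
      k) (tab (Suc (Suc n)) j ! k)
     (tab (Suc (Suc n)) p ! k) (tab (Suc (Suc n)) q ! k)" if "k \<le> Suc n" for k
    using b[of k] that w by simp
  have "seq_direct_sum n C S X Y ?W"
    unfolding seq_direct_sum_def
    by (intro conjI Ws angle_seq[OF X] angle_seq[OF Y] exI[of _ "tab (Suc (Suc n)) i"]
        exI[of _ "tab (Suc (Suc n)) j"] exI[of _ "tab (Suc (Suc n)) p"] exI[of _ "tab (Suc (Suc n))
            q"] ij allI impI bb)
      simp
  then have "?W \<in> T"
    by (rule F1a_sum[OF X Y])
  with ij bb show ?thesis
    by (intro exI[of _ ?W] exI[of _ "tab (Suc (Suc n)) i"] exI[of _ "tab (Suc (Suc n)) j"]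
        exI[of _ "tab (Suc (Suc n)) p"] exI[of _ "tab (Suc (Suc n)) q"] conjI allI impI)
qed

section \<open>Composition and addition of morphisms of sequences, and retracts of angles\<close>

lemma mor_Comp:
  assumes X: "X \<in> seqs" and Y: "Y \<in> seqs" and Z: "Z \<in> seqs" and f: "mor X Y f" and g: "mor Y Z g"
  shows "mor X Z (tab (Suc (Suc n)) (\<lambda>k. g ! k \<cdot> f ! k))"
proof -
  note [simp] = seq[OF X] seq[OF Y] seq[OF Z] mor(1-4)[OF f] mor(1-4)[OF g]
  show ?thesis
  proof (rule morI; simp?)
    show "g ! Suc k \<cdot> f ! Suc k \<cdot> X ! k = Z ! k \<cdot> (g ! k \<cdot> f ! k)" if "k \<le> n" for k
    proof -
      have "g ! Suc k \<cdot> (f ! Suc k \<cdot> X ! k) = (g ! Suc k \<cdot> Y ! k) \<cdot> f ! k"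
        using that mor(5)[OF f that] by (simp add: Comp_assoc')
      then show ?thesis
        using that mor(5)[OF g that] by (simp add: Comp_assoc')
    qed
    show "on_arr S (g ! 0) \<cdot> on_arr S (f ! 0) \<cdot> X ! Suc n = Z ! Suc n \<cdot> (g ! Suc n \<cdot> f ! Suc n)"
    proof -
      have "on_arr S (g ! 0) \<cdot> (on_arr S (f ! 0) \<cdot> X ! Suc n) = (on_arr S (g ! 0) \<cdot> Y ! Suc n) \<cdot> f !
          Suc n"
        using mor(6)[OF f] by (simp add: Comp_assoc')
      then show ?thesis
        using mor(6)[OF g] by (simp add: Comp_assoc')
    qed
  qed
qed

lemma mor_Add:
  assumes X: "X \<in> seqs" and Y: "Y \<in> seqs" and f: "mor X Y f" and g: "mor X Y g"
  shows "mor X Y (tab (Suc (Suc n)) (\<lambda>k. f ! k \<boxplus> g ! k))"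
proof -
  note [simp] = seq[OF X] seq[OF Y] mor(1-4)[OF f] mor(1-4)[OF g]
  show ?thesis
    using mor(5,6)[OF f] mor(5,6)[OF g] by (intro morI) (simp_all add: distribL distribR)
qed

text \<open>Stronger than the usual notion: one of the retractions has to be a biproduct projection.
  By \<open>retract_complement\<close>, every retraction of such a map then has a
  complement.\<close>

definition split_mono :: "'m \<Rightarrow> bool" where
  "split_mono i \<longleftrightarrow> (\<exists>c. split_proj (Dom C i) (Cod C i) c \<and> c \<cdot> i = Idt C (Dom C i))"

lemma split_proj_Arr:
  assumes "split_proj A B c"
  shows "c \<in> Arr C" "Dom C c = B" "Cod C c = A"
proof -
  obtain E a b q where "is_biproduct C A E B a b c q"
    using assms unfolding split_proj_def by blast
  then show "c \<in> Arr C" "Dom C c = B" "Cod C c = A"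
    using biproduct_simps by simp_all
qed

text \<open>If \<open>c\<close> is a good retraction of \<open>p i\<close>, then \<open>c p\<close>
  is one of \<open>i\<close>, because biproduct projections compose.\<close>

lemma split_mono_Comp:
  assumes "split_proj B D p" "i \<in> Arr C" "Cod C i = D" "split_mono (p \<cdot> i)"
  shows "split_mono i"
proof -
  note [simp] = split_proj_Arr[OF assms(1)] assms(2,3)
  obtain c where c: "split_proj (Dom C i) B c" "c \<cdot> (p \<cdot> i) = Idt C (Dom C i)"
    using assms(4) unfolding split_mono_def by auto
  note [simp] = split_proj_Arr[OF c(1)]
  show ?thesis
    unfolding split_mono_def using split_proj_Comp[OF c(1) assms(1)] c(2)
    by (intro exI[of _ "c \<cdot> p"]) (simp add: Comp_assoc')
qed

lemma split_mono_Idt: "A \<in> Obj C \<Longrightarrow> split_mono (Idt C A)"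
  using split_proj_Idt unfolding split_mono_def by (intro exI[of _ "Idt C A"]) simp

lemma biproduct_pairing:
  assumes b: "is_biproduct C A B D i j p q"
    and u: "u \<in> Arr C" "Cod C u = A" and v: "v \<in> Arr C" "Cod C v = B" "Dom C v = Dom C u"
  shows "p \<cdot> (i \<cdot> u \<boxplus> j \<cdot> v) = u" "q \<cdot> (i \<cdot> u \<boxplus> j \<cdot> v) = v"
    "\<lbrakk>x \<in> Arr C; y \<in> Arr C; Dom C x = A; Dom C y = B; Cod C y = Cod C x\<rbrakk> \<Longrightarrow>
      (x \<cdot> p \<boxplus> y \<cdot> q) \<cdot> (i \<cdot> u \<boxplus> j \<cdot> v) = x \<cdot> u \<boxplus> y \<cdot> v"
proof -
  note [simp] = biproduct_simps[OF b] u v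
  show 1: "p \<cdot> (i \<cdot> u \<boxplus> j \<cdot> v) = u" "q \<cdot> (i \<cdot> u \<boxplus> j \<cdot> v) = v"
    by (simp_all add: distribL)
  show "(x \<cdot> p \<boxplus> y \<cdot> q) \<cdot> (i \<cdot> u \<boxplus> j \<cdot> v) = x \<cdot> u \<boxplus> y \<cdot> v"
    if "x \<in> Arr C" "y \<in> Arr C" "Dom C x = A" "Dom C y = B" "Cod C y = Cod C x"
    using that 1 by (simp add: distribR Comp_assoc')
qed

text \<open>On the sum of \<open>W\<close> and \<open>U\<close> the maps with components
  \<open>(i, a)\<close> and \<open>(p, b)\<close> compose to \<open>p i + b a\<close>. So an extra
  angle corrects the composite by \<open>b a\<close>, and in each degree it suffices that one of the
  two components is a split inclusion.\<close>

lemma add_angle: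
  assumes W: "W \<in> T" and U: "U \<in> T" and Y: "Y \<in> seqs"
    and i: "mor Y W i" and p: "mor W Y p" and a: "mor Y U a" and b: "mor U Y b"
  shows "\<exists>V i' p'. V \<in> T \<and> mor Y V i' \<and> mor V Y p' \<and>
    (\<forall>k \<le> Suc n. p' ! k \<cdot> i' ! k = p ! k \<cdot> i ! k \<boxplus> b ! k \<cdot> a ! k) \<and>
    (\<forall>k \<le> Suc n. split_mono (i ! k) \<or> split_mono (a ! k) \<longrightarrow> split_mono (i' ! k))"
proof -
  obtain V i1 j1 p1 q1 where "V \<in> T \<and> mor W V i1 \<and> mor U V j1 \<and> mor V W p1 \<and> mor V U q1 \<and>
    (\<forall>k \<le> Suc n. is_biproduct C (Dom C (W ! k)) (Dom C (U ! k)) (Dom C (V ! k)) (i1 ! k) (j1 ! k)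
        (p1 ! k) (q1 ! k))"
    using direct_sum[OF W U] by (elim exE)
  then have V: "V \<in> T" and i1: "mor W V i1" and j1: "mor U V j1" and p1: "mor V W p1" and q1: "mor V
      U q1"
    and bp: "\<And>k. k \<le> Suc n \<Longrightarrow> is_biproduct C (Dom C (W ! k)) (Dom C (U ! k)) (Dom C (V ! k)) (i1 ! k)
        (j1 ! k) (p1 ! k) (q1 ! k)"
    by simp_all
  note s = angle_seq[OF W] angle_seq[OF U] angle_seq[OF V]
  note [simp] = mor(1-4)[OF i1] mor(1-4)[OF j1] mor(1-4)[OF p1] mor(1-4)[OF q1] mor(1-4)[OF i]
      mor(1-4)[OF p] mor(1-4)[OF a] mor(1-4)[OF b]
  note [simp] = seq(1-2)[OF s(1)] seq(1-2)[OF s(2)] seq(1-2)[OF s(3)] seq(1-2)[OF Y]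
  let ?N = "Suc (Suc n)"
  let ?i = "tab ?N (\<lambda>k. tab ?N (\<lambda>k. i1 ! k \<cdot> i ! k) ! k \<boxplus> tab ?N (\<lambda>k. j1 ! k \<cdot> a ! k) ! k)"
  let ?p = "tab ?N (\<lambda>k. tab ?N (\<lambda>k. p ! k \<cdot> p1 ! k) ! k \<boxplus> tab ?N (\<lambda>k. b ! k \<cdot> q1 ! k) ! k)"
  have ip: "mor Y V ?i" "mor V Y ?p"
    using mor_Add[OF Y s(3) mor_Comp[OF Y s(1,3) i i1] mor_Comp[OF Y s(2,3) a j1]]
      mor_Add[OF s(3) Y mor_Comp[OF s(3,1) Y p1 p] mor_Comp[OF s(3,2) Y q1 b]] .
  have pi: "?p ! k \<cdot> ?i ! k = p ! k \<cdot> i ! k \<boxplus> b ! k \<cdot> a ! k" if "k \<le> Suc n" for k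
    using that biproduct_pairing(3)[OF bp, of k "i ! k" "a ! k" "p ! k" "b ! k"] by simp
  have split: "split_mono (?i ! k)" if k: "k \<le> Suc n" and "split_mono (i ! k) \<or> split_mono (a ! k)"
      for k
    using that(2)
  proof
    assume m: "split_mono (i ! k)"
    show ?thesis
      by (rule split_mono_Comp[OF split_proj_biproduct(1)[OF bp[OF k]]])
        (use m k biproduct_pairing(1)[OF bp, of k "i ! k" "a ! k"] in simp_all)
  next
    assume m: "split_mono (a ! k)"
    show ?thesis
      by (rule split_mono_Comp[OF split_proj_biproduct(2)[OF bp[OF k]]])
        (use m k biproduct_pairing(2)[OF bp, of k "i ! k" "a ! k"] in simp_all)
  qed
  show ?thesis
    by (intro exI[of _ V] exI[of _ ?i] exI[of _ ?p] conjI allI impI V ip pi split)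
qed

text \<open>The summand axiom requires a complementary sequence, not just a retraction. Each degree
  has a complement by \<open>retract_complement\<close>, and these assemble because \<open>i\<close>
  and \<open>p\<close> commute with the differentials.\<close>

lemma split_retract_angle:
  assumes W: "W \<in> T" and Y: "Y \<in> seqs" and i: "mor Y W i" and p: "mor W Y p"
    and pi: "\<And>k. k \<le> Suc n \<Longrightarrow> p ! k \<cdot> i ! k = Idt C (Dom C (Y ! k))"
    and split: "\<And>k. k \<le> Suc n \<Longrightarrow> split_mono (i ! k)"
  shows "Y \<in> T"
proof -
  note [simp] = seq_obj[OF angle_seq[OF W]] seq_obj[OF Y]
  have m [simp]: "k \<le> Suc n \<Longrightarrow> i ! k \<in> Arr C" "k \<le> Suc n \<Longrightarrow> Dom C (i ! k) = obj Y k" "k \<le> Suc n \<Longrightarrow> Cod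
      C (i ! k) = obj W k"
    "k \<le> Suc n \<Longrightarrow> p ! k \<in> Arr C" "k \<le> Suc n \<Longrightarrow> Dom C (p ! k) = obj W k" "k \<le> Suc n \<Longrightarrow> Cod C (p ! k) =
        obj Y k" for k
    using mor[OF i] mor[OF p] by (simp_all)
  have "\<exists>E j q. is_biproduct C (obj Y k) E (obj W k) (i ! k) j (p ! k) q" if k: "k \<le> Suc n" for k
  proof -
    obtain c where "split_proj (obj Y k) (obj W k) c" "c \<cdot> i ! k = Idt C (obj Y k)"
      using split[OF k] k unfolding split_mono_def by auto
    then show ?thesis
      using pi k by (intro retract_complement) simp_all
  qed
  then obtain E0 j q where b0: "\<And>k. k \<le> Suc n \<Longrightarrow> is_biproduct C (obj Y k) (E0 k) (obj W k) (i ! k) (j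
      k) (p ! k) (q k)"
    by metis
  define E where "E k = (if k \<le> Suc n then E0 k else on_obj S (E0 0))" for k
  have b: "is_biproduct C (obj Y k) (E k) (obj W k) (extend ((!) i) k) (extend j k) (extend ((!) p)
      k) (extend q k)"
    if "k \<le> Suc (Suc n)" for k
    by (rule extend_biproduct[where A = "obj Y" and B = E and D = "obj W" and i = "(!) i" and j = j
        and p = "(!) p" and q = q])
      (use that b0 in \<open>simp_all add: E_def obj_last\<close>)
  note [simp] = biproduct_simps[OF b]
  note ci = mor_extend[OF i] mor_extend[OF p]
  have e: "extend j k = j k" "extend q k = q k" if "k \<le> Suc n" for k
    using that by (simp_all add: extend_def)
  have b1: "is_biproduct C (obj Y k) (E k) (obj W k) (i ! k) (j k) (p ! k) (q k)" if "k \<le> Suc n" for k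
    using b0[OF that] that by (simp add: E_def)
  note [simp] = biproduct_simps(7-9,13-15)[OF b1]
  \<comment> \<open>The differential of \<open>W\<close> compressed to the complement; no choice
    remains if \<open>j\<close> and \<open>q\<close> are to be morphisms of sequences.\<close>
  define v where "v k = extend q (Suc k) \<cdot> (W ! k \<cdot> extend j k)" for k
  have v: "v k \<in> Arr C" "Dom C (v k) = E k" "Cod C (v k) = E (Suc k)" if "k \<le> Suc n" for k
    using that by (simp_all add: v_def)
  let ?V = "tab (Suc (Suc n)) v"
  have Vs: "?V \<in> seqs" and Vo: "k \<le> Suc (Suc n) \<Longrightarrow> obj ?V k = E k" for k
    using seqI_obj[of v E] v by (simp_all add: E_def)
  have jq: "mor ?V W (tab (Suc (Suc n)) j)" "mor W ?V (tab (Suc (Suc n)) q)"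
  proof -
    show "mor ?V W (tab (Suc (Suc n)) j)"
    proof (rule morI_extend)
      fix k assume k: "k \<le> Suc n"
      \<comment> \<open>As \<open>p\<close> commutes with the differentials and
        \<open>p j = 0\<close>, the differential carries the complement into the complement.\<close>
      then have "extend ((!) p) (Suc k) \<cdot> (W ! k \<cdot> extend j k) = Nul C (E k) (obj Y (Suc k))"
        using ci(2)[OF k] by (simp flip: Comp_assoc') (simp add: Comp_assoc')
      then have "extend j (Suc k) \<cdot> v k = W ! k \<cdot> extend j k"
        using biproduct_simps(25)[OF b[of "Suc k"], of "W ! k \<cdot> extend j k"] k by (simp add: v_def)
      then show "extend j (Suc k) \<cdot> ?V ! k = W ! k \<cdot> j k"
        using k by (simp add: e)
    qed (simp_all add: Vo)
    show "mor W ?V (tab (Suc (Suc n)) q)"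
    proof (rule morI_extend)
      fix k assume k: "k \<le> Suc n"
      have [simp]: "k \<le> Suc (Suc n)"
        using k by simp
      \<comment> \<open>Inserting the identity as \<open>i p + j q\<close>, the first part dies
        under \<open>q\<close> since \<open>i\<close> commutes with the differentials and
        \<open>q i = 0\<close>.\<close>
      have "W ! k = W ! k \<cdot> (extend ((!) i) k \<cdot> extend ((!) p) k \<boxplus> extend j k \<cdot> extend q k)"
        using k by simp
      also have "\<dots> = (extend ((!) i) (Suc k) \<cdot> Y ! k) \<cdot> extend ((!) p) k \<boxplus> W ! k \<cdot> extend j k \<cdot>
          extend q k"
        using ci(1)[OF k] k by (subst distribL) (simp_all flip: Comp_assoc')
      finally have "extend q (Suc k) \<cdot> W ! k = extend q (Suc k) \<cdot>
        ((extend ((!) i) (Suc k) \<cdot> Y ! k) \<cdot> extend ((!) p) k \<boxplus> W ! k \<cdot> extend j k \<cdot> extend q k)"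
        by (rule arg_cong)
      also have "\<dots> = v k \<cdot> extend q k"
        using k by (simp add: v_def distribL Comp_assoc')
      finally show "extend q (Suc k) \<cdot> W ! k = ?V ! k \<cdot> q k"
        using k by (simp add: e)
    qed (simp_all add: Vo)
  qed
  have "is_biproduct C (Dom C (Y ! k)) (Dom C (?V ! k)) (Dom C (W ! k)) (i ! k) (tab (Suc (Suc n)) j
      ! k)
     (p ! k) (tab (Suc (Suc n)) q ! k)" if "k \<le> Suc n" for k
    using b[of k] that v by (simp add: e extend_def)
  then have "seq_direct_sum n C S Y ?V W"
    unfolding seq_direct_sum_def
    by (intro conjI Vs Y angle_seq[OF W] exI[of _ i] exI[of _ "tab (Suc (Suc n)) j"]
        exI[of _ p] exI[of _ "tab (Suc (Suc n)) q"] i p jq allI impI) simp_all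
  then show ?thesis
    using F1a_summand[OF W] by blast
qed

text \<open>Every differential other than the identity starts or ends at a zero object. For
  \<open>m = n\<close> the one right after the identity ends at the suspension of degree 0, which is
  zero since \<Sigma> is additive.\<close>

lemma trivial_angle_Nul:
  assumes "Z \<in> Obj C" "m \<le> n"
  obtains U where "U \<in> T" "U ! m = Idt C Z" "Dom C (U ! m) = Z" "Dom C (U ! Suc m) = Z"
    "\<And>k. k \<le> Suc n \<Longrightarrow> k \<noteq> m \<Longrightarrow> U ! k = Nul C (Dom C (U ! k)) (Cod C (U ! k))"
proof -
  obtain U where U: "U \<in> T" "U ! m = Idt C Z"
    and z: "\<And>i. i \<le> Suc n \<Longrightarrow> i \<noteq> m \<Longrightarrow> i \<noteq> Suc m \<Longrightarrow> is_zero_object C (Dom C (U ! i))"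
    using trivial_angle[OF assms] by blast
  note s = seq[OF angle_seq[OF U(1)]]
  have "U ! k = Nul C (Dom C (U ! k)) (Cod C (U ! k))" if k: "k \<le> Suc n" "k \<noteq> m" for k
  proof (cases "k = Suc m")
    case True
    have "is_zero_object C (Cod C (U ! k))"
    proof (cases "m = n")
      case True
      have "is_zero_object C (Dom C (U ! 0))"
        using z[of 0] True n_pos by simp
      then have "is_zero_object C (on_obj S (Dom C (U ! 0)))"
        using S.map_Idt[of "Dom C (U ! 0)"] by (auto simp: zero_object_iff)
      then show ?thesis
        using s(4) True \<open>k = Suc m\<close> by simp
    next
      case False
      then show ?thesis
        using z[of "Suc k"] s(3)[of k] True assms(2) by simp
    qed
    then show ?thesis
      using zero_object_Nul s(2)[OF k(1)] by blast
  next
    case False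
    then show ?thesis
      using zero_object_Nul z s(2) k by blast
  qed
  moreover have "Dom C (U ! m) = Z" "Dom C (U ! Suc m) = Z"
    using U(2) assms s(3)[of m] by simp_all
  ultimately show ?thesis
    using that U by blast
qed

text \<open>The difference \<open>f g - 1 = d h + h d\<close> is a sum of maps that factor through trivial angles on the
  objects of \<open>Y\<close>. Adding them to \<open>X\<close> one at a time turns \<open>g\<close> and \<open>f\<close> into an inclusion and a
  retraction.\<close>

lemma homotopy_equivalent_angle:
  assumes XT: "X @ [\<delta>] \<in> T" and XA: "Dom C (X ! 0) = A"
    and Yc: "Y \<in> complexes n C A (Dom C \<delta>)"
    and XY: "homotopy_equivalent n C A (Dom C \<delta>) X Y"
  shows "Y @ [\<delta>] \<in> T"
proof -
  let ?X = "X @ [\<delta>]" and ?Y = "Y @ [\<delta>]"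
  note Xc = angle_complex(2)[OF XT, unfolded XA]
  note \<delta> = angle_complex(4,5)[OF XT, unfolded XA]
  obtain f g h' h where f: "cpx_morphism n C A (Dom C \<delta>) X Y f" and g: "cpx_morphism n C A (Dom C \<delta>)
      Y X g"
    and h: "id_homotopy n Y (\<lambda>k. f ! k \<cdot> g ! k) h"
    using XY unfolding homotopy_equivalent_iff by blast
  have nX: "?X ! k = X ! k" and nY: "?Y ! k = Y ! k" if "k \<le> n" for k
    using that complexes(1)[OF Xc] complexes(1)[OF Yc] by (simp_all add: nth_append)
  have nX': "?X ! Suc n = \<delta>" and nY': "?Y ! Suc n = \<delta>"
    using complexes(1)[OF Xc] complexes(1)[OF Yc] by (simp_all add: nth_append)
  have dX: "Dom C (?X ! k) = cpx_obj C X k" and dY: "Dom C (?Y ! k) = cpx_obj C Y k" if "k \<le> Suc n"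
      for k
    using that nX[of k] nY[of k] nX' nY' complexes(3,6)[OF Xc] complexes(3,6)[OF Yc]
    by (cases "k = Suc n"; simp)+
  note [simp] = complexes(1-4,7-10)[OF Xc] complexes(1-4,7-10)[OF Yc] cpx_morphism(1-4)[OF f]
      cpx_morphism(1-4)[OF g]
    id_homotopy(1-3)[OF h] \<delta>
  note ends = cpx_morphism(6,7)[OF f] cpx_morphism(6,7)[OF g] complexes(5,6)[OF Xc]
      complexes(5,6)[OF Yc]
  have Ys: "?Y \<in> seqs"
  proof (rule seqI)
    show "?Y ! k \<in> Arr C" if "k \<le> Suc n" for k
      using that nY[of k] nY' by (cases "k = Suc n") simp_all
    show "Cod C (?Y ! k) = Dom C (?Y ! Suc k)" if "k \<le> n" for k
      using that by (simp add: dY) (simp add: nY)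
    show "Cod C (?Y ! Suc n) = on_obj S (Dom C (?Y ! 0))"
      by (simp add: dY ends) (simp add: nY')
  qed simp
  have gm: "mor ?Y ?X g"
  proof (rule morI)
    show "g ! Suc k \<cdot> ?Y ! k = ?X ! k \<cdot> g ! k" if "k \<le> n" for k
      using that cpx_morphism(5)[OF g that] by (simp add: nX nY)
    show "on_arr S (g ! 0) \<cdot> ?Y ! Suc n = ?X ! Suc n \<cdot> g ! Suc n"
      by (simp add: ends nX' nY')
  qed (simp_all add: dX dY)
  have fm: "mor ?X ?Y f"
  proof (rule morI)
    show "f ! Suc k \<cdot> ?X ! k = ?Y ! k \<cdot> f ! k" if "k \<le> n" for k
      using that cpx_morphism(5)[OF f that] by (simp add: nX nY)
    show "on_arr S (f ! 0) \<cdot> ?X ! Suc n = ?Y ! Suc n \<cdot> f ! Suc n"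
      by (simp add: ends nX' nY')
  qed (simp_all add: dX dY)
  note [simp] = seq(2-4)[OF Ys]
  \<comment> \<open>In degree \<open>n\<close> this is not part of \<open>Y\<close> being a complex.
    Since \<open>g\<close> is the identity in degree \<open>n + 1\<close>, the last differential of
    \<open>Y\<close> factors through that of \<open>X\<close>, which \<open>\<delta>\<close>
    annihilates.\<close>
  have dd: "?Y ! Suc k \<cdot> ?Y ! k = Nul C (Dom C (?Y ! k)) (Cod C (?Y ! Suc k))" if "k \<le> n" for k
  proof (cases "k = n")
    case True
    have "\<delta> \<cdot> X ! n = Nul C (cpx_obj C X n) (on_obj S A)"
      using angle_Comp[OF XT, of n] by (simp add: nX nX')
    then have "\<delta> \<cdot> (X ! n \<cdot> g ! n) = Nul C (cpx_obj C X n) (on_obj S A) \<cdot> g ! n"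
      by (simp add: Comp_assoc'[symmetric] ends)
    then show ?thesis
      using cpx_morphism(5)[OF g, of n] True by (simp add: nY nY' ends)
  next
    case False
    then show ?thesis
      using that by (simp add: nY)
  qed
  \<comment> \<open>Dually, \<open>f\<close> is the identity in degree 0, so the first differential
    of \<open>Y\<close> factors through that of \<open>X\<close>.\<close>
  have Sd: "on_arr S (?Y ! 0) \<cdot> ?Y ! Suc n = Nul C (Dom C \<delta>) (on_obj S (Cod C (?Y ! 0)))"
  proof -
    have "Y ! 0 = f ! Suc 0 \<cdot> X ! 0"
      using cpx_morphism(5)[OF f, of 0] by (simp add: ends)
    then have "on_arr S (Y ! 0) \<cdot> \<delta> = on_arr S (f ! Suc 0) \<cdot> (on_arr S (X ! 0) \<cdot> \<delta>)"
      by (simp add: Comp_assoc' ends)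
    then show ?thesis
      using angle_Comp_shift[OF XT] by (simp add: nX nX' nY nY')
  qed
  \<comment> \<open>The value of retraction after inclusion once \<open>m\<close> trivial angles
    have been added: repaired below \<open>m\<close>, only the term \<open>h d\<close> left in
    degree \<open>m\<close>, and still \<open>f g\<close> above. For \<open>m = 0\<close> it is
    \<open>f g\<close> itself, for \<open>m = n + 1\<close> the identity.\<close>
  define r where "r m k = (if k < m then Idt C (cpx_obj C Y k)
    else if k = m \<and> k \<le> n then Idt C (cpx_obj C Y k) \<boxplus> h k \<cdot> Y ! k
    else if k = m then Idt C (cpx_obj C Y k) else f ! k \<cdot> g ! k)" for m k
  \<comment> \<open>Split inclusions are recorded up to degree \<open>m\<close> for the final
    passage to a summand. Degree 0 is split because \<open>g\<close> is the identity there, and each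
    new angle contributes an identity in degree \<open>m + 1\<close>.\<close>
  have "\<exists>W i p. W \<in> T \<and> mor ?Y W i \<and> mor W ?Y p \<and> (\<forall>k \<le> Suc n. p ! k \<cdot> i ! k = r m k) \<and>
      (\<forall>k \<le> m. split_mono (i ! k))" if "m \<le> Suc n" for m
    using that
  proof (induction m)
    case 0
    have "f ! 0 \<cdot> g ! 0 = Idt C (cpx_obj C Y 0) \<boxplus> h 0 \<cdot> Y ! 0"
      using id_homotopy(4)[OF h] .
    then have "f ! k \<cdot> g ! k = r 0 k" for k
      by (simp add: r_def)
    moreover have "split_mono (g ! 0)"
      using split_mono_Idt by (simp add: ends)
    ultimately show ?case
      using XT gm fm by (intro exI[of _ ?X] exI[of _ g] exI[of _ f]) simp
  next
    case (Suc m)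
    then have m: "m \<le> n"
      by simp
    obtain W i p where W: "W \<in> T" and i: "mor ?Y W i" and p: "mor W ?Y p"
      and pi: "\<And>k. k \<le> Suc n \<Longrightarrow> p ! k \<cdot> i ! k = r m k" and split: "\<And>k. k \<le> m \<Longrightarrow> split_mono (i ! k)"
      using Suc by auto
    let ?Z = "cpx_obj C Y (Suc m)"
    obtain U where U: "U \<in> T" and Um [simp]: "U ! m = Idt C ?Z" "Dom C (U ! m) = ?Z" "Dom C (U ! Suc
        m) = ?Z"
      and Uz: "\<And>k. k \<le> Suc n \<Longrightarrow> k \<noteq> m \<Longrightarrow> U ! k = Nul C (Dom C (U ! k)) (Cod C (U ! k))"
      using trivial_angle_Nul[of ?Z m] m by auto
    note Us [simp] = seq(2-4)[OF angle_seq[OF U]]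
    let ?N = "Suc (Suc n)"
    \<comment> \<open>The trivial angle on \<open>Y^(m+1)\<close> lives in degrees \<open>m\<close>
      and \<open>m + 1\<close>. There \<open>a\<close> is \<open>(d, 1)\<close> and \<open>b\<close>
      is \<open>(- h, - d h)\<close>, so \<open>b a\<close> removes \<open>h d\<close> in degree
      \<open>m\<close> and \<open>d h\<close> in degree \<open>m + 1\<close>.\<close>
    define a where "a = tab ?N (\<lambda>k. if k = m then Y ! m else if k = Suc m then Idt C ?Z
      else Nul C (Dom C (?Y ! k)) (Dom C (U ! k)))"
    define b where "b = tab ?N (\<lambda>k. if k = m then Neg C (h m) else if k = Suc m then Neg C (Y ! m \<cdot>
        h m)
      else Nul C (Dom C (U ! k)) (Dom C (?Y ! k)))"
    have a_nth: "a ! k \<in> Arr C" "Dom C (a ! k) = Dom C (?Y ! k)" "Cod C (a ! k) = Dom C (U ! k)" if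
        "k \<le> Suc n" for k
      using that m by (auto simp: a_def dY)
    have Ua: "U ! k \<cdot> a ! k = Nul C (Dom C (?Y ! k)) (Cod C (U ! k))" if "k \<le> Suc n" "k \<noteq> m" for k
      using that a_nth[of k] by (subst Uz) simp_all
    have a: "mor ?Y U a"
    proof (rule morI)
      show "a ! Suc k \<cdot> ?Y ! k = U ! k \<cdot> a ! k" if k: "k \<le> n" for k
      proof (cases "k = m")
        case True
        then show ?thesis
          using k by (simp add: a_def nY)
      next
        case False
        have "a ! Suc k \<cdot> ?Y ! k = Nul C (Dom C (?Y ! k)) (Cod C (U ! k))"
        proof (cases "Suc k = m")
          case True
          then have "a ! Suc k = ?Y ! Suc k" "Cod C (?Y ! Suc k) = Cod C (U ! k)"
            using m a_nth(3)[of m] by (auto simp: a_def nY)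
          then show ?thesis
            using dd[OF k] by simp
        next
          case False
          then show ?thesis
            using k \<open>k \<noteq> m\<close> by (simp add: a_def)
        qed
        then show ?thesis
          using Ua[of k] k False by simp
      qed
      have "on_arr S (a ! 0) \<cdot> ?Y ! Suc n = Nul C (Dom C (?Y ! Suc n)) (Cod C (U ! Suc n))"
      proof (cases "m = 0")
        case True
        then have "a ! 0 = ?Y ! 0" "Cod C (?Y ! 0) = Dom C (U ! 0)"
          using a_nth(3)[of 0] by (simp_all add: a_def nY)
        then show ?thesis
          using Sd by (simp add: nY')
      next
        case False
        then show ?thesis
          by (simp add: a_def)
      qed
      then show "on_arr S (a ! 0) \<cdot> ?Y ! Suc n = U ! Suc n \<cdot> a ! Suc n"
        using Ua[of "Suc n"] m by simp
    qed (simp_all add: a_nth, simp add: a_def)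
    have b_nth: "b ! k \<in> Arr C" "Dom C (b ! k) = Dom C (U ! k)" "Cod C (b ! k) = Dom C (?Y ! k)" if
        "k \<le> Suc n" for k
      using that m by (auto simp: b_def dY)
    have bU: "v \<cdot> U ! k = Nul C (Dom C (U ! k)) (Cod C v)"
      if "k \<le> Suc n" "k \<noteq> m" "v \<in> Arr C" "Dom C v = Cod C (U ! k)" for k v
      using that by (subst Uz) simp_all
    have b: "mor U ?Y b"
    proof (rule morI)
      have Yb: "?Y ! k \<cdot> b ! k = Nul C (Dom C (U ! k)) (Cod C (?Y ! k))" if k: "k \<le> Suc n" "k \<noteq> m"
          for k
      proof (cases "k = Suc m")
        case True
        have "?Y ! Suc m \<cdot> (?Y ! m \<cdot> h m) = Nul C ?Z (Cod C (?Y ! Suc m))"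
          using dd[OF m] m by (simp add: Comp_assoc'[symmetric] dY)
        then show ?thesis
          using True m by (simp add: b_def Comp_Neg nY dY)
      next
        case False
        then show ?thesis
          using k by (simp add: b_def)
      qed
      show "b ! Suc k \<cdot> U ! k = ?Y ! k \<cdot> b ! k" if k: "k \<le> n" for k
      proof (cases "k = m")
        case True
        then show ?thesis
          using m by (simp add: b_def nY Comp_Neg)
      next
        case False
        then show ?thesis
          using k b_nth[of "Suc k"] Yb[of k] bU[of k "b ! Suc k"] by simp
      qed
      show "on_arr S (b ! 0) \<cdot> U ! Suc n = ?Y ! Suc n \<cdot> b ! Suc n"
        using b_nth[of 0] Yb[of "Suc n"] bU[of "Suc n" "on_arr S (b ! 0)"] m by simp
    qed (simp_all add: b_nth, simp add: b_def)
    have ba: "r m k \<boxplus> b ! k \<cdot> a ! k = r (Suc m) k" if k: "k \<le> Suc n" for k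
    proof -
      consider "k = m" | "k = Suc m" | "k \<noteq> m" "k \<noteq> Suc m"
        by blast
      then show ?thesis
      proof cases
        case 1
        then show ?thesis
          using m by (simp add: r_def a_def b_def Comp_Neg Add_assoc)
      next
        case 2
        show ?thesis
        proof (cases "m = n")
          case True
          then show ?thesis
            using 2 id_homotopy(6)[OF h] by (simp add: r_def a_def b_def Add_assoc)
        next
          case False
          then have "Y ! m \<cdot> h m \<boxplus> (h (Suc m) \<cdot> Y ! Suc m \<boxminus> Y ! m \<cdot> h m) = h (Suc m) \<cdot> Y ! Suc m"
            using m by (subst Add_commute[of "h (Suc m) \<cdot> Y ! Suc m"]) simp_all
          then show ?thesis
            using 2 m False id_homotopy(5)[OF h, of m] by (simp add: r_def a_def b_def Add_assoc)
        qed
      next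
        case 3
        have "r m k \<in> Arr C" "Dom C (r m k) = cpx_obj C Y k" "Cod C (r m k) = cpx_obj C Y k"
          using k 3 by (auto simp: r_def)
        moreover have "r (Suc m) k = r m k"
          using 3 by (auto simp: r_def)
        ultimately show ?thesis
          using 3 k by (simp add: a_def b_def dY)
      qed
    qed
    have sa: "split_mono (a ! Suc m)"
      using m split_mono_Idt by (simp add: a_def)
    obtain V i' p' where V: "V \<in> T \<and> mor ?Y V i' \<and> mor V ?Y p' \<and>
      (\<forall>k \<le> Suc n. p' ! k \<cdot> i' ! k = p ! k \<cdot> i ! k \<boxplus> b ! k \<cdot> a ! k) \<and>
      (\<forall>k \<le> Suc n. split_mono (i ! k) \<or> split_mono (a ! k) \<longrightarrow> split_mono (i' ! k))"
      using add_angle[OF W U Ys i p a b] by (elim exE)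
    have "split_mono (i' ! k)" if "k \<le> Suc m" for k
    proof -
      have "split_mono (i ! k) \<or> split_mono (a ! k)"
        using split[of k] sa that by (cases "k = Suc m") auto
      with V m that show ?thesis
        by auto
    qed
    then have "V \<in> T \<and> mor ?Y V i' \<and> mor V ?Y p' \<and> (\<forall>k \<le> Suc n. p' ! k \<cdot> i' ! k = r (Suc m) k) \<and>
        (\<forall>k \<le> Suc m. split_mono (i' ! k))"
      using V by (simp add: pi ba)
    then show ?case
      by (intro exI)
  qed
  from this[of "Suc n"] obtain W i p where W: "W \<in> T" "mor ?Y W i" "mor W ?Y p"
      and pi: "\<And>k. k \<le> Suc n \<Longrightarrow> p ! k \<cdot> i ! k = r (Suc n) k" and split: "\<And>k. k \<le> Suc n \<Longrightarrow> split_mono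
          (i ! k)"
    by auto
  show ?thesis
    by (rule split_retract_angle[OF W(1) Ys W(2,3)]) (use pi split in \<open>simp_all add: r_def dY\<close>)
qed

end

section \<open>Angulated and exangulated functors\<close>

context angulated
begin

text \<open>(F1)(c) provides an angle that begins with \<open>\<delta>\<close>. Undoing
  \<open>n + 1\<close> rotations carries \<open>\<delta>\<close> unchanged to the last place, since
  a sign is only put on a morphism that moves from the end to the front. Injectivity of \<Sigma> on
  objects identifies the first object with \<open>A\<close>.\<close>

lemma angle_completion:
  assumes "\<delta> \<in> Arr C" "A \<in> Obj C" "Cod C \<delta> = on_obj S A"
  obtains X where "X @ [\<delta>] \<in> T" "Dom C (X ! 0) = A"
proof -
  obtain Y where Y: "Y \<in> T" "Y ! 0 = \<delta>"
    using F1c[OF assms(1)] by blast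
  have "\<exists>X \<in> T. X ! k = \<delta>" if "k \<le> Suc n" for k
    using that
  proof (induction k)
    case 0
    then show ?case
      using Y by blast
  next
    case (Suc k)
    then obtain Z where Z: "Z \<in> T" "Z ! k = \<delta>"
      by auto
    obtain X where "X \<in> T" "rot X = Z"
      using unrotate[OF Z(1)] by blast
    then show ?case
      using Z Suc.prems rot_nth(1)[OF angle_seq, of X k] by auto
  qed
  from this[of "Suc n"] obtain X where X: "X \<in> T" "X ! Suc n = \<delta>"
    by auto
  note Xs = seq[OF angle_seq[OF X(1)]]
  have "X \<noteq> []"
    using Xs(1) by auto
  then have "butlast X @ [\<delta>] = X"
    using X(2) Xs(1) append_butlast_last_id[of X] by (simp add: last_conv_nth)
  moreover have "Dom C (butlast X ! 0) = A"
    using X(2) Xs(1,4) Xs(2)[of 0] assms S_inj_Obj[of "Dom C (X ! 0)" A] by (simp add: nth_butlast)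
  ultimately show ?thesis
    using X(1) that[of "butlast X"] by simp
qed

lemma Real_eq_iff:
  assumes "\<delta> \<in> Mor C B (on_obj S A)" and X: "X \<in> complexes n C A B"
  shows "Real (exang_of_angulated n C S T) B A \<delta> = homotopy_class n C A B X \<longleftrightarrow> X @ [\<delta>] \<in> T"
proof -
  have \<delta>: "\<delta> \<in> Arr C" "Dom C \<delta> = B" "Cod C \<delta> = on_obj S A"
    using assms(1) by (simp_all add: Mor_def)
  have hd: "hd Z = Z ! 0" if "Z @ [\<delta>] \<in> T" for Z
    using angle_complex(1)[OF that] by (auto intro: hd_conv_nth)
  \<comment> \<open>The representative hidden in \<open>Real\<close>. Nothing is known about it
    except that it completes \<open>\<delta>\<close>.\<close>
  define Z where "Z = (SOME X. X @ [\<delta>] \<in> T \<and> Dom C (hd X) = A)"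
  have "\<exists>X. X @ [\<delta>] \<in> T \<and> Dom C (hd X) = A"
    using angle_completion[OF \<delta>(1) complexes(9)[OF X] \<delta>(3)] hd by metis
  then have "Z @ [\<delta>] \<in> T \<and> Dom C (hd Z) = A"
    unfolding Z_def by (rule someI_ex)
  then have Z: "Z @ [\<delta>] \<in> T" "Dom C (Z ! 0) = A"
    using hd[of Z] by simp_all
  have Zc: "Z \<in> complexes n C A B"
    using angle_complex(2)[OF Z(1)] Z(2) \<delta>(2) by simp
  have XA: "Dom C (X ! 0) = A"
    using complexes(3)[OF X, of 0] complexes(5)[OF X] by simp
  have "homotopy_equivalent n C A B Z X \<longleftrightarrow> X @ [\<delta>] \<in> T"
    using homotopy_equivalent_angle[OF Z(1,2), of X] angle_homotopy_equivalent[OF Z(1) _ Z(2) XA] X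
        \<delta>(2)
    by blast
  then show ?thesis
    using homotopy_class_eq_iff[OF Zc X] by (simp add: exang_of_angulated_def Z_def)
qed

text \<open>As the differential before \<open>\<theta>\<close> is zero, exactness lets the identity
  factor through \<open>\<theta>\<close>, which gives a left inverse \<open>v\<close>. Then
  \<open>\<theta> v - 1\<close> kills \<open>\<theta>\<close>, so it factors through the suspended
  first differential, which is zero; hence \<open>v\<close> is also a right inverse.\<close>

lemma iso_arrow_of_zero_ends:
  assumes XT: "X @ [\<theta>] \<in> T" and X0: "X ! 0 = Nul C (Dom C (X ! 0)) (Cod C (X ! 0))"
    and Xn: "X ! n = Nul C (Dom C (X ! n)) (Cod C (X ! n))"
  shows "iso_arrow C \<theta>"
proof -
  note X = complexes[OF angle_complex(2)[OF XT]]
  note \<theta> [simp] = angle_complex(4,5)[OF XT]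
  have nth: "(X @ [\<theta>]) ! k = X ! k" if "k \<le> n" for k
    using that X(1) by (simp add: nth_append)
  have nth': "(X @ [\<theta>]) ! Suc n = \<theta>"
    using X(1) by (simp add: nth_append)
  have Cn: "Cod C (X ! n) = Dom C \<theta>"
    using X(4)[of n] X(6) by simp
  have "Idt C (Dom C \<theta>) \<cdot> X ! n = Nul C (Dom C (X ! n)) (Dom C \<theta>)"
    using Xn Cn X(2)[of n] by simp
  then obtain v where v [simp]: "v \<in> Arr C" "Dom C v = on_obj S (Dom C (X ! 0))" "Cod C v = Dom C \<theta>"
    and v\<theta>: "v \<cdot> \<theta> = Idt C (Dom C \<theta>)"
    using angle_exact_last[OF XT, of "Idt C (Dom C \<theta>)"] nth[of n] nth[of 0] nth' by auto
  let ?w = "\<theta> \<cdot> v \<boxminus> Idt C (on_obj S (Dom C (X ! 0)))"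
  have Xo [simp]: "Dom C (X ! 0) \<in> Obj C" "X ! 0 \<in> Arr C"
    using X(2)[of 0] by simp_all
  have w: "?w \<in> Arr C" "Dom C ?w = on_obj S (Dom C (X ! 0))" "Cod C ?w = on_obj S (Dom C (X ! 0))"
    by simp_all
  have "?w \<cdot> \<theta> = Nul C (Dom C \<theta>) (on_obj S (Dom C (X ! 0)))"
    by (simp add: distribR Comp_Neg Comp_assoc' v\<theta>)
  then obtain z where z: "z \<in> Arr C" "Dom C z = on_obj S (Cod C (X ! 0))" "Cod C z = Cod C ?w"
    "z \<cdot> on_arr S (X ! 0) = ?w"
    using angle_exact_shift[OF XT, of ?w] w nth[of 0] nth' by auto
  have "on_arr S (X ! 0) = Nul C (on_obj S (Dom C (X ! 0))) (on_obj S (Cod C (X ! 0)))"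
    using X0 S.map_Nul[of "Dom C (X ! 0)" "Cod C (X ! 0)"] Xo by simp
  then have "?w = Nul C (on_obj S (Dom C (X ! 0))) (on_obj S (Dom C (X ! 0)))"
    using z w Xo by simp
  then have "\<theta> \<cdot> v \<boxplus> Neg C (Idt C (on_obj S (Dom C (X ! 0)))) \<boxplus> Idt C (on_obj S (Dom C (X ! 0)))
      = Idt C (on_obj S (Dom C (X ! 0)))"
    by simp
  then have "\<theta> \<cdot> v = Idt C (on_obj S (Dom C (X ! 0)))"
    by (simp add: Add_assoc)
  with v\<theta> show ?thesis
    unfolding iso_arrow_def by (auto simp: Mor_def intro!: exI[of _ v])
qed

end

lemma angulated_imp_exangulated:
  assumes "angulated n C S T" "angulated n C' S' T'" "additive_functor C C' F"
    and "angulated_functor C S T C' S' T' F"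
  shows "exangulated_functor n C (exang_of_angulated n C S T) C' (exang_of_angulated n C' S' T') F"
proof -
  interpret A: angulated n C S T by fact
  interpret B: angulated n C' S' T' by fact
  interpret F: additive_functor_pair C C' F by unfold_locales fact
  obtain \<Theta> where nat: "nat_iso C C' (comp_functor F S) (comp_functor S' F) \<Theta>"
    and ang: "\<And>X. X \<in> T \<Longrightarrow> map (on_arr F) (butlast X) @ [\<Theta> (Dom C (hd X)) \<cdot>\<^bsub>C'\<^esub> on_arr F (last X)] \<in>
        T'"
    using assms(4) unfolding angulated_functor_def by blast
  have \<Theta> [simp]: "\<Theta> A \<in> Arr C'" "Dom C' (\<Theta> A) = on_obj F (on_obj S A)" "Cod C' (\<Theta> A) = on_obj S'
      (on_obj F A)"
    if "A \<in> Obj C" for A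
    using nat that by (auto simp: nat_iso_def comp_functor_def Mor_def)
  have natural: "\<Theta> (Cod C f) \<cdot>\<^bsub>C'\<^esub> on_arr F (on_arr S f) = on_arr S' (on_arr F f) \<cdot>\<^bsub>C'\<^esub> \<Theta> (Dom C f)"
    if "f \<in> Arr C" for f
    using nat that by (auto simp: nat_iso_def comp_functor_def Mor_def)
  define \<Gamma> where "\<Gamma> B A \<delta> = \<Theta> A \<cdot>\<^bsub>C'\<^esub> on_arr F \<delta>" for B :: 'a and A \<delta>
  let ?E = "exang_of_angulated n C S T" and ?E' = "exang_of_angulated n C' S' T'"
  have "\<Gamma> B A \<in> hom (Ext ?E B A) (Ext ?E' (on_obj F B) (on_obj F A))" if "B \<in> Obj C" "A \<in> Obj C" for
      A B
    using that by (auto simp: \<Gamma>_def hom_def exang_of_angulated_def hom_group_def Mor_def B.distribL)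
  moreover have "\<Gamma> B' A' (ExtMap ?E f g \<delta>) = ExtMap ?E' (on_arr F f) (on_arr F g) (\<Gamma> B A \<delta>)"
    if "f \<in> Mor C B' B" "g \<in> Mor C A A'" "\<delta> \<in> carrier (Ext ?E B A)" for A A' B B' f g \<delta>
  proof -
    have [simp]: "f \<in> Arr C" "Dom C f = B'" "Cod C f = B" "g \<in> Arr C" "Dom C g = A" "Cod C g = A'"
      "\<delta> \<in> Arr C" "Dom C \<delta> = B" "Cod C \<delta> = on_obj S A"
      using that by (auto simp: Mor_def exang_of_angulated_def hom_group_def)
    have [simp]: "A \<in> Obj C" "A' \<in> Obj C"
      using A.Obj_Arr[of g] by simp_all
    have "\<Theta> A' \<cdot>\<^bsub>C'\<^esub> (on_arr F (on_arr S g) \<cdot>\<^bsub>C'\<^esub> u) = on_arr S' (on_arr F g) \<cdot>\<^bsub>C'\<^esub> (\<Theta> A \<cdot>\<^bsub>C'\<^esub> u)"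
      if "u \<in> Arr C'" "Cod C' u = on_obj F (on_obj S A)" for u
      using natural[of g] that by (simp flip: B.Comp_assoc')
    then show ?thesis
      by (simp add: \<Gamma>_def exang_of_angulated_def B.Comp_assoc')
  qed
  moreover have "Real ?E' (on_obj F B) (on_obj F A) (\<Gamma> B A \<delta>) = homotopy_class n C' (on_obj F A)
      (on_obj F B) (map (on_arr F) X)"
    if \<delta>: "\<delta> \<in> carrier (Ext ?E B A)" and X: "X \<in> complexes n C A B" and R: "Real ?E B A \<delta> =
        homotopy_class n C A B X" for A B \<delta> X
  proof -
    have \<delta>': "\<delta> \<in> Mor C B (on_obj S A)"
      using \<delta> by (simp add: exang_of_angulated_def hom_group_def)
    have [simp]: "A \<in> Obj C"
      using A.complexes(9)[OF X] .
    have XT: "X @ [\<delta>] \<in> T"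
      using A.Real_eq_iff[OF \<delta>' X] R by blast
    have "Dom C (hd (X @ [\<delta>])) = A"
      using A.complexes(1)[OF X] A.complexes(3)[OF X, of 0] A.complexes(5)[OF X] by (cases X) auto
    then have "map (on_arr F) X @ [\<Gamma> B A \<delta>] \<in> T'"
      using ang[OF XT] by (simp add: \<Gamma>_def)
    moreover have "\<Gamma> B A \<delta> \<in> Mor C' (on_obj F B) (on_obj S' (on_obj F A))"
      using \<delta>' by (simp add: \<Gamma>_def Mor_def)
    ultimately show ?thesis
      using B.Real_eq_iff F.map_complexes(1)[OF X] by blast
  qed
  ultimately show ?thesis
    unfolding exangulated_functor_def using assms(3) by (intro conjI exI[of _ \<Gamma>]) blast+
qed

lemma exangulated_imp_angulated:
  assumes "angulated n C S T" "angulated n C' S' T'" "additive_functor C C' F"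
    and "exangulated_functor n C (exang_of_angulated n C S T) C' (exang_of_angulated n C' S' T') F"
  shows "angulated_functor C S T C' S' T' F"
proof -
  interpret A: angulated n C S T by fact
  interpret B: angulated n C' S' T' by fact
  interpret F: additive_functor_pair C C' F by unfold_locales fact
  let ?E = "exang_of_angulated n C S T" and ?E' = "exang_of_angulated n C' S' T'"
  obtain \<Gamma> where H: "\<forall>B \<in> Obj C. \<forall>A \<in> Obj C. \<Gamma> B A \<in> hom (Ext ?E B A) (Ext ?E' (on_obj F B) (on_obj
      F A))"
    "\<forall>B \<in> Obj C. \<forall>B' \<in> Obj C. \<forall>A \<in> Obj C. \<forall>A' \<in> Obj C.
      \<forall>f \<in> Mor C B' B. \<forall>g \<in> Mor C A A'. \<forall>\<delta> \<in> carrier (Ext ?E B A).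
        \<Gamma> B' A' (ExtMap ?E f g \<delta>) = ExtMap ?E' (on_arr F f) (on_arr F g) (\<Gamma> B A \<delta>)"
    "\<forall>B \<in> Obj C. \<forall>A \<in> Obj C. \<forall>\<delta> \<in> carrier (Ext ?E B A). \<forall>X \<in> complexes n C A B.
      Real ?E B A \<delta> = homotopy_class n C A B X \<longrightarrow>
      Real ?E' (on_obj F B) (on_obj F A) (\<Gamma> B A \<delta>) = homotopy_class n C' (on_obj F A) (on_obj F B)
          (map (on_arr F) X)"
    using assms(4) unfolding exangulated_functor_def by (elim conjE exE)
  have nat: "\<Gamma> B' A' (ExtMap ?E f g \<delta>) = ExtMap ?E' (on_arr F f) (on_arr F g) (\<Gamma> B A \<delta>)"
    if "f \<in> Mor C B' B" "g \<in> Mor C A A'" "\<delta> \<in> carrier (Ext ?E B A)" for B B' A A' f g \<delta>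
    using H(2) that A.Mor_Obj[OF that(1)] A.Mor_Obj[OF that(2)] by simp
  have car: "carrier (Ext ?E B A) = Mor C B (on_obj S A)" "carrier (Ext ?E' B' A') = Mor C' B'
      (on_obj S' A')" for A B A' B'
    by (simp_all add: exang_of_angulated_def hom_group_def)
  have \<Gamma>_Mor: "\<Gamma> B A \<delta> \<in> Mor C' (on_obj F B) (on_obj S' (on_obj F A))"
    if "\<delta> \<in> Mor C B (on_obj S A)" "A \<in> Obj C" for A B \<delta>
    using H(1) A.Mor_Obj[OF that(1)] that by (auto simp: hom_def car)
  \<comment> \<open>The Yoneda element: \<open>\<Gamma>\<close> evaluated at the identity of
    \<open>\<Sigma> A\<close>, read as an extension of \<open>\<Sigma> A\<close> by
    \<open>A\<close>.\<close>
  define \<Theta> where "\<Theta> A = \<Gamma> (on_obj S A) A (Idt C (on_obj S A))" for A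
  have \<Theta> [simp]: "\<Theta> A \<in> Arr C'" "Dom C' (\<Theta> A) = on_obj F (on_obj S A)" "Cod C' (\<Theta> A) = on_obj S'
      (on_obj F A)"
    if "A \<in> Obj C" for A
    using \<Gamma>_Mor[of "Idt C (on_obj S A)" "on_obj S A" A] that by (auto simp: \<Theta>_def Mor_def)
  \<comment> \<open>Every \<open>\<delta>\<close> is the pullback along itself of this universal
    extension, so naturality in the first variable gives the formula.\<close>
  have \<Gamma>_eq: "\<Gamma> B A \<delta> = \<Theta> A \<cdot>\<^bsub>C'\<^esub> on_arr F \<delta>" if "\<delta> \<in> Mor C B (on_obj S A)" "A \<in> Obj C" for A B \<delta>
    using nat[of \<delta> B "on_obj S A" "Idt C A" A A "Idt C (on_obj S A)"] that A.Mor_Obj[OF that(1)]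
    by (auto simp: hom_group_def Mor_def exang_of_angulated_def simp flip: \<Theta>_def)
  have natural: "\<Theta> A' \<cdot>\<^bsub>C'\<^esub> on_arr F (on_arr S g) = on_arr S' (on_arr F g) \<cdot>\<^bsub>C'\<^esub> \<Theta> A"
    if g: "g \<in> Mor C A A'" for g A A'
  proof -
    have [simp]: "A \<in> Obj C" "A' \<in> Obj C" "g \<in> Arr C" "Dom C g = A" "Cod C g = A'"
      using A.Mor_Obj[OF g] g by (auto simp: Mor_def)
    have "\<Gamma> (on_obj S A) A' (on_arr S g) = on_arr S' (on_arr F g) \<cdot>\<^bsub>C'\<^esub> \<Theta> A"
      using nat[of "Idt C (on_obj S A)" "on_obj S A" "on_obj S A" g A A' "Idt C (on_obj S A)"]
      by (auto simp: hom_group_def Mor_def exang_of_angulated_def simp flip: \<Theta>_def)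
    then show ?thesis
      using \<Gamma>_eq[of "on_arr S g" "on_obj S A" A'] by (simp add: Mor_def)
  qed
  have ang: "map (on_arr F) X @ [\<Theta> A \<cdot>\<^bsub>C'\<^esub> on_arr F \<delta>] \<in> T'" if XT: "X @ [\<delta>] \<in> T" and XA: "Dom C (X
      ! 0) = A" for X \<delta> A
  proof -
    have X: "X \<in> complexes n C A (Dom C \<delta>)"
      using A.angle_complex(2)[OF XT] XA by simp
    have o: "A \<in> Obj C" "Dom C \<delta> \<in> Obj C"
      using A.complexes(9,10)[OF X] .
    have \<delta>: "\<delta> \<in> Mor C (Dom C \<delta>) (on_obj S A)"
      using A.angle_complex(4,5)[OF XT] XA by (simp add: Mor_def)
    have "Real ?E' (on_obj F (Dom C \<delta>)) (on_obj F A) (\<Gamma> (Dom C \<delta>) A \<delta>) = homotopy_class n C' (on_obj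
        F A) (on_obj F (Dom C \<delta>)) (map (on_arr F) X)"
      using H(3) o X A.Real_eq_iff[OF \<delta> X] XT \<delta> car by simp
    then show ?thesis
      using B.Real_eq_iff[OF \<Gamma>_Mor[OF \<delta> o(1)] F.map_complexes(1)[OF X]] \<Gamma>_eq[OF \<delta> o(1)] by simp
  qed
  \<comment> \<open>In an angle closing with the identity of \<open>\<Sigma> A\<close>, the
    vanishing of consecutive composites forces the last differential and the suspended first one to
    be zero, and \<Sigma> is faithful. Additivity of \<open>F\<close> preserves these zeros, and the
    closing map of the image angle is \<open>\<Theta> A\<close>.\<close>
  have iso: "iso_arrow C' (\<Theta> A)" if A [simp]: "A \<in> Obj C" for A
  proof -
    obtain X where XT: "X @ [Idt C (on_obj S A)] \<in> T" and XA: "Dom C (X ! 0) = A"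
      using A.angle_completion[of "Idt C (on_obj S A)" A] by auto
    note X = A.complexes[OF A.angle_complex(2)[OF XT]]
    have nth: "(X @ [Idt C (on_obj S A)]) ! k = X ! k" if "k \<le> n" for k
      using that X(1) by (simp add: nth_append)
    have nth': "(X @ [Idt C (on_obj S A)]) ! Suc n = Idt C (on_obj S A)"
      using X(1) by (simp add: nth_append)
    have Xn: "X ! n = Nul C (Dom C (X ! n)) (Cod C (X ! n))"
      using A.angle_Comp[OF XT, of n] nth[of n] nth' X(2)[of n] X(4)[of n] X(6) by simp
    have "on_arr S (X ! 0) = on_arr S (Nul C (Dom C (X ! 0)) (Cod C (X ! 0)))"
      using A.angle_Comp_shift[OF XT] nth[of 0] nth' X(2)[of 0] XA by simp
    then have X0: "X ! 0 = Nul C (Dom C (X ! 0)) (Cod C (X ! 0))"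
      using X(2)[of 0] by (intro A.S_inj[of "X ! 0"]) simp_all
    have FX: "map (on_arr F) X @ [\<Theta> A] \<in> T'"
      using ang[OF XT XA] by simp
    have FN: "map (on_arr F) X ! k = Nul C' (Dom C' (map (on_arr F) X ! k)) (Cod C' (map (on_arr F)
        X ! k))"
      if k: "k \<le> n" and N: "X ! k = Nul C (Dom C (X ! k)) (Cod C (X ! k))" for k
      using arg_cong[OF N, of "on_arr F"] X(2)[OF k] X(1) k by simp
    show ?thesis
      by (rule B.iso_arrow_of_zero_ends[OF FX FN[OF _ X0] FN[OF _ Xn]]) simp_all
  qed
  have "nat_iso C C' (comp_functor F S) (comp_functor S' F) \<Theta>"
    using iso natural by (auto simp: nat_iso_def comp_functor_def Mor_def)
  moreover have "map (on_arr F) (butlast X) @ [\<Theta> (Dom C (hd X)) \<cdot>\<^bsub>C'\<^esub> on_arr F (last X)] \<in> T'" if "X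
      \<in> T" for X
  proof -
    have l: "length X = Suc (Suc n)"
      using A.seq(1)[OF A.angle_seq[OF that]] .
    then have "X \<noteq> []"
      by auto
    then have X: "butlast X @ [last X] = X" "butlast X ! 0 = hd X"
      using l by (simp_all add: nth_butlast hd_conv_nth)
    then show ?thesis
      using ang[of "butlast X" "last X"] that by simp
  qed
  ultimately show ?thesis
    unfolding angulated_functor_def using assms(3) by blast
qed

theorem theorem2p33:
  fixes n :: nat
    and C :: "('o, 'm, 'r) addcat_scheme"
    and S :: "('o, 'm, 'o, 'm) cat_functor"
    and T :: "'m list set"
    and C' :: "('p, 'q, 's) addcat_scheme"
    and S' :: "('p, 'q, 'p, 'q) cat_functor"
    and T' :: "'q list set"
    and F :: "('o, 'm, 'p, 'q) cat_functor"
  assumes "n \<ge> 1"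
    and "angulated_category n C S T"
    and "angulated_category n C' S' T'"
    and "additive_functor C C' F"
  shows "angulated_functor C S T C' S' T' F \<longleftrightarrow>
    exangulated_functor n C (exang_of_angulated n C S T) C' (exang_of_angulated n C' S' T') F"
proof -
  have "angulated n C S T" "angulated n C' S' T'"
    using assms(1-3) by (simp_all add: angulated_def angulated_axioms_def)
  then show ?thesis
    using angulated_imp_exangulated exangulated_imp_angulated assms(4) by blast
qed

end
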